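(* Let $a,b,\sigma$ be (real) constants, let $f:[0,\infty)\times[0,1]\to\mathbb{R}$ and $h,g:[0,\infty)\to\mathbb{R}$ be Borel measurable, and consider the stochastic heat equation $$\frac{\partial}{\partial t}U(t,x)=a^2\frac{\partial^2}{\partial x^2}U(t,x)+bU(t,x)+f(t,x)+\sigma\frac{\partial}{\partial t}W(t,x),\quad t>0,\ x\in(0,1),$$ with $\frac{\partial}{\partial x}U(t,0)=h(t)$, $U(t,1)=g(t)$ for $t\ge0$ and $U(0,x)=U_0(x)$ for $x\in(0,1)$, where $W$ is the $Q$-Wiener process described in the context. Assume: (A0) $g,h\in C^1([0,\infty))$ and $f\in C^1([0,\infty);L^1([0,1]))$; (A1) the initial value $U_n(0)$ of the process $U_n(t)=\langle U(t,\cdot),e_n\rangle$, $t\ge 0$, obeys the normal distribution $N(\mu_n(0),\nu_n(0))$ with constants $\mu_n(0)\in\mathbb{R}$, $\nu_n(0)\in(0,\infty)$, and moreover $\sum_{n=1}^\infty|\mu_n(0)|<\infty$ and $\sum_{n=1}^\infty|\nu_n(0)|<\infty$. Let $T>0$ and suppose that $$\sum_{n=1}^\infty[2\lambda_n\nu_n(0)+(\sigma q_n)^2]\,e_n^2(x)\exp(2\lambda_ns)>0\quad\text{for }(s,x)\in[0,T)\times(0,1),$$ and that $\hat U(s,x)$ is a solution of the stochastic differential equation $$d\hat U(s,x)=\tilde{\mathcal{M}}(s,x)\,ds+\sqrt{\tilde{\mathcal{G}}(s,x)}\,dB(s),\quad T-t\le s\le T,\ x\in(0,1),$$ with the initial condition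 $\hat U(T-t,x)=u$, where $B$ is a Brownian motion and $\tilde{\mathcal{M}},\tilde{\mathcal{G}}$ are defined in the context. Then the density function $p$ of the stochastic heat equation admits the probabilistic representation $$p(u,t,x)=\mathbb{E}\big[p(\hat U(T,x),0,x)\,\big|\,\hat U(T-t,x)=u\big],\quad(u,t,x)\in\mathbb{R}\times[0,T]\times[0,1].$$
   Context: $\langle\phi,\psi\rangle=\int_0^1\phi\psi\,dx$. For $n\ge1$: $\beta_n=(n-1/2)\pi$, $e_n(x)=\sqrt2\cos(\beta_nx)$, $\lambda_n=b-(a\beta_n)^2$. $Q$-Wiener process: $W(t,x)=\sum_{n=1}^\infty q_nW_n(t)e_n(x)$, where $q_n\ge0$, $\mathrm{Tr}(Q)=\sum_{n=1}^\infty q_n^2<\infty$, and $\{W_n(t)\}_{n\ge1}$ are independent standard scalar Brownian motions. Put $Y(t,x)=h(t)(x-1)+g(t)$, $Y_n(t,x)=\langle Y(t,\cdot),e_n\rangle e_n(x)$, $\tilde f(t,x)=f(t,x)-\frac{\partial}{\partial t}Y(t,x)+bY(t,x)$, $\tilde f_n(t,x)=\langle\tilde f(t,\cdot),e_n\rangle e_n(x)$. With $U_n(t,x)=\langle U(t,\cdot),e_n\rangle e_n(x)$, the mean and variance of $U_n(t,x)$ are $$\mu_n(t,x)=[\mu_n(0)e_n(x)-Y_n(0,x)]e^{\lambda_nt}+\int_0^te^{\lambda_n(t-s)}\tilde f_n(s,x)\,ds+Y_n(t,x),$$ $$\nu_n(t,x)=\nu_n(0)e_n^2(x)e^{2\lambda_nt}+\frac{[\sigma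 q_ne_n(x)]^2}{2\lambda_n}\left[e^{2\lambda_nt}-1\right]\ \text{ if }\lambda_n\ne0,$$ and $\nu_n(t,x)=\nu_n(0)e_n^2(x)+[\sigma q_ne_n(x)]^2t$ if $\lambda_n=0$. Set $\mu=\sum_{n\ge1}\mu_n$, $\nu=\sum_{n\ge1}\nu_n$. The density function of the stochastic heat equation (i.e. of $U(t,x)$) is $p(u,t,x)=\frac{1}{\sqrt{2\pi\nu(t,x)}}\exp\{-\frac{(u-\mu(t,x))^2}{2\nu(t,x)}\}$, $t\ge0$. Coefficients: $\mathcal{M}(t,x)=-\frac{\partial\mu(t,x)}{\partial t}$, $\mathcal{G}(t,x)=\frac{\partial\nu(t,x)}{\partial t}$, and for $s\in[0,T]$, $\tilde{\mathcal{M}}(s,x)=\mathcal{M}(T-s,x)$, $\tilde{\mathcal{G}}(s,x)=\mathcal{G}(T-s,x)$.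
   Formalization: The constant a is assumed nonzero (for a = 0 there is no heat equation and the series for the mean may diverge), and the stochastic differential equation for Û is assumed at the given x in [0,1], endpoints included, not only for x in (0,1). *)

theory Defs
  imports "HOL-Probability.Probability"
begin

section \<open>Brownian motion and the Ito integral\<close>

text \<open>All processes live on the time axis \<^term>\<open>{0::real..}\<close>; their values (and those of
  filtrations) at negative times play no role.\<close>

definition brownian_motion_wrt ::
  "'w measure \<Rightarrow> (real \<Rightarrow> 'w measure) \<Rightarrow> (real \<Rightarrow> 'w \<Rightarrow> real) \<Rightarrow> bool"
where
  "brownian_motion_wrt M F B \<longleftrightarrow>
     prob_space M \<and> filtration (space M) F \<and> (\<forall>t. sets (F t) \<subseteq> sets M) \<and>
     (\<forall>t\<ge>0. B t \<in> borel_measurable (F t)) \<and>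
     (AE w in M. B 0 w = 0) \<and>
     (AE w in M. continuous_on {0..} (\<lambda>t. B t w)) \<and>
     (\<forall>s t. 0 \<le> s \<and> s < t \<longrightarrow>
        distributed M lborel (\<lambda>w. B t w - B s w) (normal_density 0 (sqrt (t - s))) \<and>
        prob_space.indep_set M
          (sets (vimage_algebra (space M) (\<lambda>w. B t w - B s w) borel)) (sets (F s)))"

definition natural_filtration :: "'w measure \<Rightarrow> (real \<Rightarrow> 'w \<Rightarrow> real) \<Rightarrow> real \<Rightarrow> 'w measure"
where
  "natural_filtration M B t =
     sigma (space M) (\<Union>s\<in>{0..t}. {B s -` A \<inter> space M | A. A \<in> sets borel})"

definition brownian_motion :: "'w measure \<Rightarrow> (real \<Rightarrow> 'w \<Rightarrow> real) \<Rightarrow> bool"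
where
  "brownian_motion M B \<longleftrightarrow> brownian_motion_wrt M (natural_filtration M B) B"

definition simple_process ::
  "(real \<Rightarrow> 'w measure) \<Rightarrow> real \<Rightarrow> real \<Rightarrow> nat \<Rightarrow> (nat \<Rightarrow> real) \<Rightarrow> (nat \<Rightarrow> 'w \<Rightarrow> real) \<Rightarrow> bool"
where
  "simple_process F a b N \<tau> \<xi> \<longleftrightarrow>
     (\<forall>i\<le>N. a \<le> \<tau> i \<and> \<tau> i \<le> b) \<and> (\<forall>i<N. \<tau> i \<le> \<tau> (Suc i)) \<and>
     (\<forall>i<N. \<xi> i \<in> borel_measurable (F (\<tau> i)) \<and> (\<exists>C. \<forall>w\<in>space (F (\<tau> i)). \<bar>\<xi> i w\<bar> \<le> C))"

definition simple_value :: "nat \<Rightarrow> (nat \<Rightarrow> real) \<Rightarrow> (nat \<Rightarrow> 'w \<Rightarrow> real) \<Rightarrow> real \<Rightarrow> 'w \<Rightarrow> real"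
where
  "simple_value N \<tau> \<xi> r w = (\<Sum>i<N. \<xi> i w * indicator {\<tau> i<..\<tau> (Suc i)} r)"

definition simple_integral ::
  "(real \<Rightarrow> 'w \<Rightarrow> real) \<Rightarrow> nat \<Rightarrow> (nat \<Rightarrow> real) \<Rightarrow> (nat \<Rightarrow> 'w \<Rightarrow> real) \<Rightarrow> 'w \<Rightarrow> real"
where
  "simple_integral B N \<tau> \<xi> w = (\<Sum>i<N. \<xi> i w * (B (\<tau> (Suc i)) w - B (\<tau> i) w))"

text \<open>\<open>I\<close> is (a version of) the Ito integral of \<open>H\<close> with respect to \<open>B\<close> over \<^term>\<open>{a..b}\<close>, for
  square-integrable \<open>H\<close>: the limit in \<open>L\<^sup>2\<close> of the integrals of simple processes that approximate
  \<open>H\<close> in \<open>L\<^sup>2\<close> of the product space. Existence of the approximation subsumes adaptedness and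
  square integrability of \<open>H\<close>.\<close>

definition is_ito_integral ::
  "'w measure \<Rightarrow> (real \<Rightarrow> 'w measure) \<Rightarrow> (real \<Rightarrow> 'w \<Rightarrow> real) \<Rightarrow> real \<Rightarrow> real \<Rightarrow>
   (real \<Rightarrow> 'w \<Rightarrow> real) \<Rightarrow> ('w \<Rightarrow> real) \<Rightarrow> bool"
where
  "is_ito_integral M F B a b H I \<longleftrightarrow>
     (\<lambda>(r, w). H r w) \<in> borel_measurable (restrict_space borel {a..b} \<Otimes>\<^sub>M M) \<and>
     I \<in> borel_measurable M \<and>
     (\<exists>N \<tau> \<xi>. (\<forall>k. simple_process F a b (N k) (\<tau> k) (\<xi> k)) \<and>
        (\<lambda>k. \<integral>\<^sup>+w. (\<integral>\<^sup>+r\<in>{a..b}.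
            ennreal ((simple_value (N k) (\<tau> k) (\<xi> k) r w - H r w)\<^sup>2) \<partial>lborel) \<partial>M)
          \<longlonglongrightarrow> 0 \<and>
        (\<lambda>k. \<integral>\<^sup>+w. ennreal ((simple_integral B (N k) (\<tau> k) (\<xi> k) w - I w)\<^sup>2) \<partial>M)
          \<longlonglongrightarrow> 0)"

text \<open>\<open>X\<close> solves \<open>dX(s) = m(s) ds + k(s) dB(s)\<close> on \<^term>\<open>{t0..t1}\<close>. The coefficients are
  deterministic, so restricting to square-integrable integrands is no loss of generality.\<close>

definition sde_solution ::
  "'w measure \<Rightarrow> (real \<Rightarrow> 'w measure) \<Rightarrow> (real \<Rightarrow> 'w \<Rightarrow> real) \<Rightarrow> (real \<Rightarrow> real) \<Rightarrow> (real \<Rightarrow> real) \<Rightarrow>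
   real \<Rightarrow> real \<Rightarrow> (real \<Rightarrow> 'w \<Rightarrow> real) \<Rightarrow> bool"
where
  "sde_solution M F B m k t0 t1 X \<longleftrightarrow>
     (\<forall>s\<in>{t0..t1}. X s \<in> borel_measurable (F s)) \<and>
     (AE w in M. continuous_on {t0..t1} (\<lambda>s. X s w)) \<and>
     set_integrable lborel {t0..t1} m \<and>
     (\<forall>s\<in>{t0..t1}. \<exists>I. is_ito_integral M F B t0 s (\<lambda>r w. k r) I \<and>
        (AE w in M. X s w = X t0 w + (LINT r:{t0..s}|lborel. m r) + I w))"

definition cond_expectation_event :: "'w measure \<Rightarrow> ('w \<Rightarrow> real) \<Rightarrow> 'w set \<Rightarrow> real"
where
  "cond_expectation_event M X A = (\<integral>w. X w \<partial>uniform_measure M A)"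

section \<open>Function spaces\<close>

definition inner01 :: "(real \<Rightarrow> real) \<Rightarrow> (real \<Rightarrow> real) \<Rightarrow> real"
where
  "inner01 \<phi> \<psi> = (LINT x:{0..1}|lborel. \<phi> x * \<psi> x)"

definition L1norm01 :: "(real \<Rightarrow> real) \<Rightarrow> real"
where
  "L1norm01 \<phi> = (LINT x:{0..1}|lborel. \<bar>\<phi> x\<bar>)"

text \<open>Time derivative on \<^term>\<open>{0::real..}\<close>: one-sided at \<open>0\<close>, two-sided elsewhere.\<close>

definition time_deriv :: "(real \<Rightarrow> real) \<Rightarrow> real \<Rightarrow> real"
where
  "time_deriv \<phi> t = vector_derivative \<phi> (at t within {0..})"

definition C1_halfline :: "(real \<Rightarrow> real) \<Rightarrow> bool"
where
  "C1_halfline \<phi> \<longleftrightarrow>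
     (\<exists>\<phi>'. (\<forall>t\<ge>0. (\<phi> has_real_derivative \<phi>' t) (at t within {0..})) \<and> continuous_on {0..} \<phi>')"

definition C1_halfline_L1 :: "(real \<Rightarrow> real \<Rightarrow> real) \<Rightarrow> bool"
where
  "C1_halfline_L1 f \<longleftrightarrow>
     (\<forall>t\<ge>0. set_integrable lborel {0..1} (f t)) \<and>
     (\<exists>f'. \<forall>t\<ge>0. set_integrable lborel {0..1} (f' t) \<and>
        ((\<lambda>s. L1norm01 (\<lambda>x. (f s x - f t x) / (s - t) - f' t x)) \<longlongrightarrow> 0) (at t within {0..}) \<and>
        ((\<lambda>s. L1norm01 (\<lambda>x. f' s x - f' t x)) \<longlongrightarrow> 0) (at t within {0..}))"

section \<open>The stochastic heat equation\<close>

text \<open>The spectral indices are \<open>n \<ge> 1\<close>, so series over them are written with \<^term>\<open>Suc n\<close>.\<close>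

definition bfreq :: "nat \<Rightarrow> real"
where
  "bfreq n = (real n - 1/2) * pi"

definition efun :: "nat \<Rightarrow> real \<Rightarrow> real"
where
  "efun n x = sqrt 2 * cos (bfreq n * x)"

definition eigval :: "real \<Rightarrow> real \<Rightarrow> nat \<Rightarrow> real"
where
  "eigval a b n = b - (a * bfreq n)\<^sup>2"

definition Q_wiener :: "(nat \<Rightarrow> real) \<Rightarrow> (nat \<Rightarrow> real \<Rightarrow> 'w \<Rightarrow> real) \<Rightarrow> real \<Rightarrow> real \<Rightarrow> 'w \<Rightarrow> real"
where
  "Q_wiener q Wn t x w = (\<Sum>n. q (Suc n) * Wn (Suc n) t w * efun (Suc n) x)"

definition independent_brownian_motions :: "'w measure \<Rightarrow> (nat \<Rightarrow> real \<Rightarrow> 'w \<Rightarrow> real) \<Rightarrow> bool"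
where
  "independent_brownian_motions M Wn \<longleftrightarrow>
     (\<forall>n\<ge>1. brownian_motion M (Wn n)) \<and>
     prob_space.indep_vars M (\<lambda>_. PiM {0..} (\<lambda>_. borel)) (\<lambda>n w. \<lambda>t\<in>{0..}. Wn n t w) {1..}"

text \<open>Test functions: \<open>C\<^sup>2\<close> on \<open>[0,1]\<close> with the homogeneous boundary conditions
  \<open>\<phi>'(0) = 0\<close> and \<open>\<phi>(1) = 0\<close>.\<close>

definition test_function :: "(real \<Rightarrow> real) \<Rightarrow> (real \<Rightarrow> real) \<Rightarrow> (real \<Rightarrow> real) \<Rightarrow> bool"
where
  "test_function \<phi> \<phi>' \<phi>'' \<longleftrightarrow>
     (\<forall>x\<in>{0..1}. (\<phi> has_real_derivative \<phi>' x) (at x within {0..1})) \<and>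
     (\<forall>x\<in>{0..1}. (\<phi>' has_real_derivative \<phi>'' x) (at x within {0..1})) \<and>
     continuous_on {0..1} \<phi>'' \<and> \<phi>' 0 = 0 \<and> \<phi> 1 = 0"

text \<open>Weak (distributional in space, integrated in time) form of
  \<open>dU = (a\<^sup>2 U\<^sub>x\<^sub>x + b U + f) dt + \<sigma> dW\<close> with \<open>U\<^sub>x(t,0) = h(t)\<close>, \<open>U(t,1) = g(t)\<close> and
  \<open>U(0,x) = U0(x)\<close>. Integrating \<open>U\<^sub>x\<^sub>x\<close> twice by parts against a test function produces the boundary
  contribution \<open>- h \<phi>(0) - g \<phi>'(1)\<close>, which is where the boundary data enter.\<close>

definition heat_equation_solution ::
  "'w measure \<Rightarrow> real \<Rightarrow> real \<Rightarrow> real \<Rightarrow> (real \<Rightarrow> real \<Rightarrow> real) \<Rightarrow> (real \<Rightarrow> real) \<Rightarrow> (real \<Rightarrow> real) \<Rightarrow>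
   (real \<Rightarrow> real \<Rightarrow> 'w \<Rightarrow> real) \<Rightarrow> (real \<Rightarrow> 'w \<Rightarrow> real) \<Rightarrow> (real \<Rightarrow> real \<Rightarrow> 'w \<Rightarrow> real) \<Rightarrow> bool"
where
  "heat_equation_solution M a b \<sigma> f h g W U0 U \<longleftrightarrow>
     (\<lambda>(t, x, w). U t x w)
       \<in> borel_measurable (restrict_space borel {0..} \<Otimes>\<^sub>M restrict_space borel {0..1} \<Otimes>\<^sub>M M) \<and>
     (\<forall>x\<in>{0<..<1}. AE w in M. U 0 x w = U0 x w) \<and>
     (\<forall>t\<ge>0. AE w in M.
        set_integrable lborel {0..1} (\<lambda>x. (U t x w)\<^sup>2) \<and>
        set_integrable (lborel \<Otimes>\<^sub>M lborel) ({0..t} \<times> {0..1}) (\<lambda>(s, x). (U s x w)\<^sup>2)) \<and>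
     (\<forall>\<phi> \<phi>' \<phi>''. test_function \<phi> \<phi>' \<phi>'' \<longrightarrow> (\<forall>t\<ge>0. AE w in M.
        inner01 (\<lambda>x. U t x w) \<phi> =
          inner01 (\<lambda>x. U 0 x w) \<phi>
          + (LINT s:{0..t}|lborel.
               a\<^sup>2 * (inner01 (\<lambda>x. U s x w) \<phi>'' - h s * \<phi> 0 - g s * \<phi>' 1)
               + b * inner01 (\<lambda>x. U s x w) \<phi> + inner01 (f s) \<phi>)
          + \<sigma> * inner01 (\<lambda>x. W t x w) \<phi>))"

section \<open>Mean, variance and density\<close>

definition Yfun :: "(real \<Rightarrow> real) \<Rightarrow> (real \<Rightarrow> real) \<Rightarrow> real \<Rightarrow> real \<Rightarrow> real"
where
  "Yfun h g t x = h t * (x - 1) + g t"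

definition Yn :: "(real \<Rightarrow> real) \<Rightarrow> (real \<Rightarrow> real) \<Rightarrow> nat \<Rightarrow> real \<Rightarrow> real \<Rightarrow> real"
where
  "Yn h g n t x = inner01 (Yfun h g t) (efun n) * efun n x"

definition ftilde ::
  "real \<Rightarrow> (real \<Rightarrow> real \<Rightarrow> real) \<Rightarrow> (real \<Rightarrow> real) \<Rightarrow> (real \<Rightarrow> real) \<Rightarrow> real \<Rightarrow> real \<Rightarrow> real"
where
  "ftilde b f h g t x = f t x - time_deriv (\<lambda>s. Yfun h g s x) t + b * Yfun h g t x"

definition ftilde_n ::
  "real \<Rightarrow> (real \<Rightarrow> real \<Rightarrow> real) \<Rightarrow> (real \<Rightarrow> real) \<Rightarrow> (real \<Rightarrow> real) \<Rightarrow> nat \<Rightarrow> real \<Rightarrow> real \<Rightarrow> real"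
where
  "ftilde_n b f h g n t x = inner01 (ftilde b f h g t) (efun n) * efun n x"

text \<open>\<open>m0 n\<close> and \<open>v0 n\<close> are the mean and the variance of \<open>\<langle>U(0,\<cdot>), e\<^sub>n\<rangle>\<close>.\<close>

definition mu_n ::
  "real \<Rightarrow> real \<Rightarrow> (real \<Rightarrow> real \<Rightarrow> real) \<Rightarrow> (real \<Rightarrow> real) \<Rightarrow> (real \<Rightarrow> real) \<Rightarrow> (nat \<Rightarrow> real) \<Rightarrow>
   nat \<Rightarrow> real \<Rightarrow> real \<Rightarrow> real"
where
  "mu_n a b f h g m0 n t x =
     (m0 n * efun n x - Yn h g n 0 x) * exp (eigval a b n * t)
     + (LINT s:{0..t}|lborel. exp (eigval a b n * (t - s)) * ftilde_n b f h g n s x)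
     + Yn h g n t x"

definition nu_n ::
  "real \<Rightarrow> real \<Rightarrow> real \<Rightarrow> (nat \<Rightarrow> real) \<Rightarrow> (nat \<Rightarrow> real) \<Rightarrow> nat \<Rightarrow> real \<Rightarrow> real \<Rightarrow> real"
where
  "nu_n a b \<sigma> q v0 n t x =
     (if eigval a b n \<noteq> 0 then
        v0 n * (efun n x)\<^sup>2 * exp (2 * eigval a b n * t)
        + (\<sigma> * q n * efun n x)\<^sup>2 / (2 * eigval a b n) * (exp (2 * eigval a b n * t) - 1)
      else v0 n * (efun n x)\<^sup>2 + (\<sigma> * q n * efun n x)\<^sup>2 * t)"

definition mu ::
  "real \<Rightarrow> real \<Rightarrow> (real \<Rightarrow> real \<Rightarrow> real) \<Rightarrow> (real \<Rightarrow> real) \<Rightarrow> (real \<Rightarrow> real) \<Rightarrow> (nat \<Rightarrow> real) \<Rightarrow>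
   real \<Rightarrow> real \<Rightarrow> real"
where
  "mu a b f h g m0 t x = (\<Sum>n. mu_n a b f h g m0 (Suc n) t x)"

definition nu ::
  "real \<Rightarrow> real \<Rightarrow> real \<Rightarrow> (nat \<Rightarrow> real) \<Rightarrow> (nat \<Rightarrow> real) \<Rightarrow> real \<Rightarrow> real \<Rightarrow> real"
where
  "nu a b \<sigma> q v0 t x = (\<Sum>n. nu_n a b \<sigma> q v0 (Suc n) t x)"

definition heat_density ::
  "real \<Rightarrow> real \<Rightarrow> real \<Rightarrow> (real \<Rightarrow> real \<Rightarrow> real) \<Rightarrow> (real \<Rightarrow> real) \<Rightarrow> (real \<Rightarrow> real) \<Rightarrow> (nat \<Rightarrow> real) \<Rightarrow>
   (nat \<Rightarrow> real) \<Rightarrow> (nat \<Rightarrow> real) \<Rightarrow> real \<Rightarrow> real \<Rightarrow> real \<Rightarrow> real"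
where
  "heat_density a b \<sigma> f h g q m0 v0 u t x =
     1 / sqrt (2 * pi * nu a b \<sigma> q v0 t x)
       * exp (- ((u - mu a b f h g m0 t x)\<^sup>2 / (2 * nu a b \<sigma> q v0 t x)))"

definition Mcoeff ::
  "real \<Rightarrow> real \<Rightarrow> (real \<Rightarrow> real \<Rightarrow> real) \<Rightarrow> (real \<Rightarrow> real) \<Rightarrow> (real \<Rightarrow> real) \<Rightarrow> (nat \<Rightarrow> real) \<Rightarrow>
   real \<Rightarrow> real \<Rightarrow> real"
where
  "Mcoeff a b f h g m0 t x = - time_deriv (\<lambda>s. mu a b f h g m0 s x) t"

definition Gcoeff ::
  "real \<Rightarrow> real \<Rightarrow> real \<Rightarrow> (nat \<Rightarrow> real) \<Rightarrow> (nat \<Rightarrow> real) \<Rightarrow> real \<Rightarrow> real \<Rightarrow> real"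
where
  "Gcoeff a b \<sigma> q v0 t x = time_deriv (\<lambda>s. nu a b \<sigma> q v0 s x) t"

definition Mtilde ::
  "real \<Rightarrow> real \<Rightarrow> (real \<Rightarrow> real \<Rightarrow> real) \<Rightarrow> (real \<Rightarrow> real) \<Rightarrow> (real \<Rightarrow> real) \<Rightarrow> (nat \<Rightarrow> real) \<Rightarrow>
   real \<Rightarrow> real \<Rightarrow> real \<Rightarrow> real"
where
  "Mtilde a b f h g m0 T s x = Mcoeff a b f h g m0 (T - s) x"

definition Gtilde ::
  "real \<Rightarrow> real \<Rightarrow> real \<Rightarrow> (nat \<Rightarrow> real) \<Rightarrow> (nat \<Rightarrow> real) \<Rightarrow> real \<Rightarrow> real \<Rightarrow> real \<Rightarrow> real"
where
  "Gtilde a b \<sigma> q v0 T s x = Gcoeff a b \<sigma> q v0 (T - s) x"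

end

theory Submission
  imports Defs
begin

text \<open>
  For fixed \<open>x\<close> the density \<open>p(u, t, x)\<close> is the value at \<open>u\<close> of the normal density with mean
  \<open>\<mu>(t, x)\<close> and variance \<open>\<nu>(t, x)\<close>. The equation for \<open>Uhat\<close> has deterministic coefficients, so its
  solution is explicit: \<open>Uhat(T) = u + \<integral> Mtilde ds + \<integral> sqrt Gtilde dB\<close> over \<open>[T - t, T]\<close>. Since
  \<open>Mtilde\<close> and \<open>Gtilde\<close> are the time-reversed derivatives of \<open>- \<mu>\<close> and \<open>\<nu>\<close>, the drift integral is
  \<open>\<mu>(0, x) - \<mu>(t, x)\<close> and the stochastic integral is a centred Gaussian of variance
  \<open>\<nu>(t, x) - \<nu>(0, x)\<close>. Averaging the normal density of variance \<open>\<nu>(0, x)\<close> over such a Gaussian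
  is a convolution of Gaussians, and the variances add up to \<open>\<nu>(t, x)\<close>.

  Two things need real work. The first is the law of the Ito integral of a deterministic function
  when the integral is a limit of integrals of random simple processes. Replacing every random
  height by its mean, on the same partition, does not increase the mean square distance to the
  integrand, and by the Ito isometry it changes the integral by no more than that distance. So the
  integral is also a limit of integrals of deterministic step functions, and those smooth a normal
  density one Brownian increment at a time (\<open>simple_process_mean_approximation\<close>,
  \<open>gaussian_density_ito_integral\<close>).

  The second is that \<open>\<mu>\<close> and \<open>\<nu>\<close> are continuous in \<open>t \<ge> 0\<close> and differentiable for \<open>t > 0\<close>, which is
  what the fundamental theorem of calculus asks for. The eigenvalues \<open>\<lambda>\<^sub>n\<close> are of order \<open>- n\<^sup>2\<close>, so
  away from \<open>t = 0\<close> the factors \<open>exp (\<lambda>\<^sub>n t)\<close> make up for every power of \<open>n\<close>, and convolution of a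
  bounded forcing with \<open>exp (\<lambda>\<^sub>n t)\<close> gains a factor \<open>1 / n\<^sup>2\<close>. This settles the termwise
  differentiated series of \<open>\<nu>\<close> and of most of \<open>\<mu>\<close>. The contribution of the Dirichlet datum \<open>g\<close> to \<open>\<mu>\<close> is worse: its
  terms decay only like \<open>1 / n\<close> and the series converges conditionally. For \<open>x < 1\<close> the signs
  \<open>(-1)\<^sup>n cos (\<beta>\<^sub>n x)\<close> have bounded partial sums, and the remaining factors have bounded variation in
  \<open>n\<close>, uniformly in time, so summation by parts gives uniform convergence
  (\<open>uniformly_convergent_boundary_series\<close>, \<open>mu_regular\<close>, \<open>nu_regular\<close>). At \<open>x = 1\<close> all
  eigenfunctions vanish and both sides of the representation are \<open>0\<close>.
\<close>

section \<open>Brownian increments and Gaussian smoothing\<close>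

lemma (in prob_space) nn_integral_indep_pair:
  assumes ind: "indep_var S X T Y" and f: "f \<in> borel_measurable (S \<Otimes>\<^sub>M T)"
  shows "(\<integral>\<^sup>+w. f (X w, Y w) \<partial>M) = (\<integral>\<^sup>+w. \<integral>\<^sup>+w'. f (X w, Y w') \<partial>M \<partial>M)"
proof -
  have X[measurable]: "X \<in> measurable M S" and Y[measurable]: "Y \<in> measurable M T"
    and eq: "distr M S X \<Otimes>\<^sub>M distr M T Y = distr M (S \<Otimes>\<^sub>M T) (\<lambda>w. (X w, Y w))"
    using ind unfolding indep_var_distribution_eq by auto
  interpret X: prob_space "distr M S X" by (rule prob_space_distr) fact
  interpret Y: prob_space "distr M T Y" by (rule prob_space_distr) fact
  have f': "f \<in> borel_measurable (distr M S X \<Otimes>\<^sub>M distr M T Y)"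
    using f by (simp cong: measurable_cong_sets)
  have "(\<integral>\<^sup>+w. f (X w, Y w) \<partial>M) = integral\<^sup>N (distr M (S \<Otimes>\<^sub>M T) (\<lambda>w. (X w, Y w))) f"
    by (rule nn_integral_distr[symmetric]) (use f in simp_all)
  also have "\<dots> = (\<integral>\<^sup>+x. \<integral>\<^sup>+y. f (x, y) \<partial>distr M T Y \<partial>distr M S X)"
    unfolding eq[symmetric] by (rule Y.nn_integral_fst[OF f', symmetric])
  also have "\<dots> = (\<integral>\<^sup>+w. \<integral>\<^sup>+y. f (X w, y) \<partial>distr M T Y \<partial>M)"
  proof (rule nn_integral_distr[OF X])
    show "(\<lambda>x. \<integral>\<^sup>+y. f (x, y) \<partial>distr M T Y) \<in> borel_measurable (distr M S X)"
      by (rule Y.borel_measurable_nn_integral_fst[OF f'])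
  qed
  also have "\<dots> = (\<integral>\<^sup>+w. \<integral>\<^sup>+w'. f (X w, Y w') \<partial>M \<partial>M)"
  proof (rule nn_integral_cong)
    fix w assume w: "w \<in> space M"
    have "(\<lambda>y. f (X w, y)) \<in> borel_measurable T"
      using measurable_compose[OF measurable_Pair1'[OF measurable_space[OF X w]] f] .
    then show "(\<integral>\<^sup>+y. f (X w, y) \<partial>distr M T Y) = (\<integral>\<^sup>+w'. f (X w, Y w') \<partial>M)"
      by (intro nn_integral_distr[OF Y]) simp
  qed
  finally show ?thesis .
qed

text \<open>Conditionally on \<open>X\<close>, averaging over \<open>Z\<close> convolves the two normal densities. The case
  \<open>c = 0\<close> is separate because \<open>c * Z\<close> then has no density.\<close>

lemma (in prob_space) gaussian_smoothing:
  assumes ind: "indep_var borel X borel Z"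
    and Z: "distributed M lborel Z (normal_density 0 s)" and s: "0 < s" and \<sigma>: "0 < \<sigma>"
  shows "(\<integral>\<^sup>+w. normal_density 0 \<sigma> (y - (X w + c * Z w)) \<partial>M)
       = (\<integral>\<^sup>+w. normal_density 0 (sqrt (\<sigma>\<^sup>2 + c\<^sup>2 * s\<^sup>2)) (y - X w) \<partial>M)"
proof (cases "c = 0")
  case True
  then show ?thesis using \<sigma> by simp
next
  case False
  have "distributed M lborel (\<lambda>w. 0 + c * Z w) (normal_density (0 + c * 0) (\<bar>c\<bar> * s))"
    by (rule normal_density_affine[OF Z s False])
  then have D: "distributed M lborel (\<lambda>w. c * Z w) (normal_density 0 (\<bar>c\<bar> * s))" by simp
  have pos: "0 < \<bar>c\<bar> * s" using False s by simp
  have conv: "(\<integral>\<^sup>+w'. normal_density 0 \<sigma> (z - c * Z w') \<partial>M)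
        = normal_density 0 (sqrt (\<sigma>\<^sup>2 + c\<^sup>2 * s\<^sup>2)) z" for z
  proof -
    have "(\<integral>\<^sup>+w'. normal_density 0 \<sigma> (z - c * Z w') \<partial>M)
        = (\<integral>\<^sup>+r. ennreal (normal_density 0 (\<bar>c\<bar> * s) r) * ennreal (normal_density 0 \<sigma> (z - r)) \<partial>lborel)"
      by (rule distributed_nn_integral[OF D, symmetric]) simp
    also have "\<dots> = (\<integral>\<^sup>+r. ennreal (normal_density 0 \<sigma> (z - r) * normal_density 0 (\<bar>c\<bar> * s) r) \<partial>lborel)"
      by (simp add: ennreal_mult'' normal_density_nonneg mult.commute)
    also have "\<dots> = normal_density 0 (sqrt (\<sigma>\<^sup>2 + (\<bar>c\<bar> * s)\<^sup>2)) z"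
      using fun_cong[OF conv_normal_density_zero_mean[OF \<sigma> pos]] .
    finally show ?thesis by (simp add: power_mult_distrib)
  qed
  have "(\<integral>\<^sup>+w. normal_density 0 \<sigma> (y - (X w + c * Z w)) \<partial>M)
      = (\<integral>\<^sup>+w. \<integral>\<^sup>+w'. normal_density 0 \<sigma> (y - (X w + c * Z w')) \<partial>M \<partial>M)"
    using nn_integral_indep_pair[OF ind, of "\<lambda>(x, z). ennreal (normal_density 0 \<sigma> (y - (x + c * z)))"]
    by simp
  then show ?thesis
    using conv by (simp add: diff_diff_eq[symmetric])
qed

lemma brownian_motion_wrtD:
  assumes "brownian_motion_wrt M F B"
  shows "prob_space M" "space (F t) = space M" "s \<le> t \<Longrightarrow> sets (F s) \<subseteq> sets (F t)"
    "sets (F t) \<subseteq> sets M" "t \<ge> 0 \<Longrightarrow> B t \<in> borel_measurable (F t)"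
    "0 \<le> s \<Longrightarrow> s < t \<Longrightarrow>
       distributed M lborel (\<lambda>w. B t w - B s w) (normal_density 0 (sqrt (t - s)))"
  using assms
  by (auto simp: brownian_motion_wrt_def filtration.space_F dest: filtration.sets_F_mono)

lemma adapted_measurable_later:
  assumes bm: "brownian_motion_wrt M F B" and X: "X \<in> borel_measurable (F s)" and "s \<le> t"
  shows "X \<in> borel_measurable (F t)" "X \<in> borel_measurable M"
  using X brownian_motion_wrtD(2-4)[OF bm] \<open>s \<le> t\<close>
  by (auto simp: measurable_def subset_iff)

lemma brownian_increment_indep:
  assumes bm: "brownian_motion_wrt M F B" and st: "0 \<le> s" "s < t"
    and X: "X \<in> borel_measurable (F s)"
  shows "prob_space.indep_var M borel X borel (\<lambda>w. B t w - B s w)"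
proof -
  interpret prob_space M by (rule brownian_motion_wrtD(1)[OF bm])
  let ?Z = "\<lambda>w. B t w - B s w"
  have ind: "indep_set (sets (vimage_algebra (space M) ?Z borel)) (sets (F s))"
    using bm st unfolding brownian_motion_wrt_def by blast
  have Z: "random_variable borel ?Z"
    using brownian_motion_wrtD(6)[OF bm st] by (auto dest: distributed_measurable)
  have sub: "sigma_sets (space M) {X -` A \<inter> space M | A. A \<in> sets borel} \<subseteq> sets (F s)"
  proof -
    have "sigma_sets (space (F s)) {X -` A \<inter> space M | A. A \<in> sets borel} \<subseteq> sets (F s)"
      using X brownian_motion_wrtD(2)[OF bm]
      by (intro sets.sigma_sets_subset) (auto simp: measurable_def)
    then show ?thesis by (simp add: brownian_motion_wrtD(2)[OF bm])
  qed
  show ?thesis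
    unfolding indep_var_eq
  proof (intro conjI)
    show "random_variable borel X" using adapted_measurable_later(2)[OF bm X order_refl] .
    show "indep_set (sigma_sets (space M) {X -` A \<inter> space M | A. A \<in> sets borel})
       (sigma_sets (space M) {?Z -` A \<inter> space M | A. A \<in> sets borel})"
      unfolding indep_sets2_eq
    proof (intro conjI ballI)
      have "sets (vimage_algebra (space M) ?Z borel) \<subseteq> events"
        and prod: "\<And>C D. C \<in> sets (vimage_algebra (space M) ?Z borel) \<Longrightarrow> D \<in> sets (F s) \<Longrightarrow>
          prob (C \<inter> D) = prob C * prob D"
        using ind unfolding indep_sets2_eq by blast+
      then show "sigma_sets (space M) {?Z -` A \<inter> space M | A. A \<in> sets borel} \<subseteq> events"
        by (simp add: sets_vimage_algebra)
      show "sigma_sets (space M) {X -` A \<inter> space M | A. A \<in> sets borel} \<subseteq> events"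
        using sub brownian_motion_wrtD(4)[OF bm, of s] by (rule order_trans)
      fix D C
      assume "D \<in> sigma_sets (space M) {X -` A \<inter> space M | A. A \<in> sets borel}"
        and "C \<in> sigma_sets (space M) {?Z -` A \<inter> space M | A. A \<in> sets borel}"
      then have "prob (C \<inter> D) = prob C * prob D"
        using sub by (intro prod) (auto simp: sets_vimage_algebra)
      then show "prob (D \<inter> C) = prob D * prob C"
        by (simp add: Int_commute mult.commute)
    qed
  qed (fact Z)
qed

lemma simple_integral_adapted:
  assumes bm: "brownian_motion_wrt M F B" and sp: "simple_process F a b N \<tau> \<xi>" and a: "0 \<le> a"
  shows "simple_integral B N \<tau> \<xi> \<in> borel_measurable (F (\<tau> N))"
  using sp
proof (induction N)
  case 0
  then show ?case by (simp add: simple_integral_def[abs_def])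
next
  case (Suc N)
  have IH: "simple_integral B N \<tau> \<xi> \<in> borel_measurable (F (\<tau> N))"
    using Suc by (auto simp: simple_process_def)
  have mono: "\<tau> N \<le> \<tau> (Suc N)" and nn: "0 \<le> \<tau> N"
    and \<xi>: "\<xi> N \<in> borel_measurable (F (\<tau> N))"
    using Suc.prems a by (auto simp: simple_process_def intro: order_trans[OF a])
  note [measurable] = adapted_measurable_later(1)[OF bm IH mono] adapted_measurable_later(1)[OF bm \<xi> mono]
    adapted_measurable_later(1)[OF bm brownian_motion_wrtD(5)[OF bm nn] mono]
    brownian_motion_wrtD(5)[OF bm order_trans[OF nn mono]]
  have "simple_integral B (Suc N) \<tau> \<xi> =
      (\<lambda>w. simple_integral B N \<tau> \<xi> w + \<xi> N w * (B (\<tau> (Suc N)) w - B (\<tau> N) w))"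
    by (simp add: simple_integral_def fun_eq_iff)
  then show ?case by simp
qed

lemma simple_process_const:
  assumes "simple_process F a b N \<tau> \<xi>"
  shows "simple_process F a b N \<tau> (\<lambda>i w. c i)"
  using assms by (auto simp: simple_process_def)

text \<open>The last increment is independent of everything before it, so it can be averaged out first,
  which enlarges the variance \<open>v\<close>; this is why the induction keeps \<open>v\<close> arbitrary.\<close>

lemma gaussian_density_simple_integral:
  assumes bm: "brownian_motion_wrt M F B" and sp: "simple_process F a b N \<tau> (\<lambda>i w. c i)"
    and a: "0 \<le> a" and v: "0 < v"
  shows "(\<integral>\<^sup>+w. normal_density 0 (sqrt v) (y - simple_integral B N \<tau> (\<lambda>i w. c i) w) \<partial>M)
       = normal_density 0 (sqrt (v + (\<Sum>i<N. (c i)\<^sup>2 * (\<tau> (Suc i) - \<tau> i)))) y"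
  using sp v
proof (induction N arbitrary: v)
  interpret prob_space M by (rule brownian_motion_wrtD(1)[OF bm])
  case 0
  then show ?case by (simp add: simple_integral_def emeasure_space_1)
next
  interpret prob_space M by (rule brownian_motion_wrtD(1)[OF bm])
  case (Suc N)
  let ?X = "simple_integral B N \<tau> (\<lambda>i w. c i)"
  have sp: "simple_process F a b N \<tau> (\<lambda>i w. c i)"
    using Suc.prems by (auto simp: simple_process_def)
  have mono: "\<tau> N \<le> \<tau> (Suc N)" and nn: "0 \<le> \<tau> N"
    using Suc.prems a by (auto simp: simple_process_def intro: order_trans[OF a])
  have eq: "simple_integral B (Suc N) \<tau> (\<lambda>i w. c i) w
      = ?X w + c N * (B (\<tau> (Suc N)) w - B (\<tau> N) w)" for w
    by (simp add: simple_integral_def)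
  show ?case
  proof (cases "\<tau> N = \<tau> (Suc N)")
    case True
    then show ?thesis using Suc.IH[OF sp \<open>0 < v\<close>] by (simp add: eq)
  next
    case False
    then have less: "\<tau> N < \<tau> (Suc N)" using mono by simp
    have "(\<integral>\<^sup>+w. normal_density 0 (sqrt v) (y - simple_integral B (Suc N) \<tau> (\<lambda>i w. c i) w) \<partial>M)
        = (\<integral>\<^sup>+w. normal_density 0 (sqrt ((sqrt v)\<^sup>2 + (c N)\<^sup>2 * (sqrt (\<tau> (Suc N) - \<tau> N))\<^sup>2)) (y - ?X w) \<partial>M)"
      unfolding eq
      by (rule gaussian_smoothing[OF brownian_increment_indep[OF bm nn less simple_integral_adapted[OF bm sp a]]
            brownian_motion_wrtD(6)[OF bm nn less]]) (use less \<open>0 < v\<close> in auto)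
    also have "\<dots> = (\<integral>\<^sup>+w. normal_density 0 (sqrt (v + (c N)\<^sup>2 * (\<tau> (Suc N) - \<tau> N))) (y - ?X w) \<partial>M)"
      using less \<open>0 < v\<close> by simp
    also have "\<dots> = normal_density 0 (sqrt (v + (c N)\<^sup>2 * (\<tau> (Suc N) - \<tau> N)
         + (\<Sum>i<N. (c i)\<^sup>2 * (\<tau> (Suc i) - \<tau> i)))) y"
      by (rule Suc.IH[OF sp]) (use less \<open>0 < v\<close> in \<open>simp add: add_pos_nonneg\<close>)
    finally show ?thesis by (simp add: algebra_simps)
  qed
qed

lemma brownian_increment_moments:
  assumes bm: "brownian_motion_wrt M F B" and st: "0 \<le> s" "s < t"
  shows "integrable M (\<lambda>w. B t w - B s w)" "(\<integral>w. B t w - B s w \<partial>M) = 0"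
    "integrable M (\<lambda>w. (B t w - B s w)\<^sup>2)" "(\<integral>w. (B t w - B s w)\<^sup>2 \<partial>M) = t - s"
proof -
  interpret prob_space M by (rule brownian_motion_wrtD(1)[OF bm])
  have p: "0 < sqrt (t - s)" using st by simp
  note D = brownian_motion_wrtD(6)[OF bm st]
  show "integrable M (\<lambda>w. B t w - B s w)"
  proof (rule distributed_integrable[OF D, of "\<lambda>x. x", THEN iffD1])
    show "integrable lborel (\<lambda>x. normal_density 0 (sqrt (t - s)) x * x)"
      by (rule integrable_normal_moment_nz_1[OF p])
  qed (simp_all add: normal_density_nonneg)
  show e: "(\<integral>w. B t w - B s w \<partial>M) = 0"
    using normal_distributed_expectation[OF p D] .
  show "integrable M (\<lambda>w. (B t w - B s w)\<^sup>2)"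
  proof (rule distributed_integrable[OF D, of "\<lambda>x. x\<^sup>2", THEN iffD1])
    show "integrable lborel (\<lambda>x. normal_density 0 (sqrt (t - s)) x * x\<^sup>2)"
      using integrable_normal_moment[OF p, of 0 2] by simp
  qed (simp_all add: normal_density_nonneg)
  show "(\<integral>w. (B t w - B s w)\<^sup>2 \<partial>M) = t - s"
    using normal_distributed_variance[OF p D] st unfolding e by simp
qed

text \<open>The mixed terms vanish because each increment is centred and independent of the past.\<close>

lemma ito_isometry_simple:
  assumes bm: "brownian_motion_wrt M F B" and sp: "simple_process F a b N \<tau> \<xi>" and a: "0 \<le> a"
  shows "integrable M (\<lambda>w. (simple_integral B N \<tau> \<xi> w)\<^sup>2) \<and>
    (\<integral>w. (simple_integral B N \<tau> \<xi> w)\<^sup>2 \<partial>M) = (\<Sum>i<N. (\<integral>w. (\<xi> i w)\<^sup>2 \<partial>M) * (\<tau> (Suc i) - \<tau> i))"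
  using sp
proof (induction N)
  case 0
  then show ?case by (simp add: simple_integral_def)
next
  case (Suc N)
  interpret prob_space M by (rule brownian_motion_wrtD(1)[OF bm])
  let ?S = "simple_integral B N \<tau> \<xi>"
  let ?D = "\<lambda>w. B (\<tau> (Suc N)) w - B (\<tau> N) w"
  have sp: "simple_process F a b N \<tau> \<xi>"
    using Suc.prems by (auto simp: simple_process_def)
  have mono: "\<tau> N \<le> \<tau> (Suc N)" and nn: "0 \<le> \<tau> N"
    and \<xi>: "\<xi> N \<in> borel_measurable (F (\<tau> N))"
    using Suc.prems a by (auto simp: simple_process_def intro: order_trans[OF a])
  obtain C where C: "\<And>w. w \<in> space M \<Longrightarrow> \<bar>\<xi> N w\<bar> \<le> C"
    using Suc.prems unfolding simple_process_def brownian_motion_wrtD(2)[OF bm] by blast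
  have eq: "simple_integral B (Suc N) \<tau> \<xi> w = ?S w + \<xi> N w * ?D w" for w
    by (simp add: simple_integral_def)
  show ?case
  proof (cases "\<tau> N = \<tau> (Suc N)")
    case True
    then show ?thesis using Suc.IH[OF sp] by (simp add: eq)
  next
    case False
    then have less: "\<tau> N < \<tau> (Suc N)" using mono by simp
    note IH = Suc.IH[OF sp] and mom = brownian_increment_moments[OF bm nn less]
    note SF = simple_integral_adapted[OF bm sp a]
    have SM[measurable]: "?S \<in> borel_measurable M" and \<xi>M[measurable]: "\<xi> N \<in> borel_measurable M"
      using adapted_measurable_later(2)[OF bm SF order_refl] adapted_measurable_later(2)[OF bm \<xi> order_refl]
      by auto
    have S2: "integrable M (\<lambda>w. (?S w)\<^sup>2)" using IH by simp
    have S1: "integrable M ?S" by (rule square_integrable_imp_integrable[OF SM S2])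
    have S\<xi>: "integrable M (\<lambda>w. ?S w * \<xi> N w)"
    proof (rule Bochner_Integration.integrable_bound[of M "\<lambda>w. C * ?S w"])
      show "AE w in M. norm (?S w * \<xi> N w) \<le> norm (C * ?S w)"
      proof (rule AE_I2)
        fix w assume "w \<in> space M"
        then have "\<bar>\<xi> N w\<bar> \<le> \<bar>C\<bar>" using C by force
        then show "norm (?S w * \<xi> N w) \<le> norm (C * ?S w)"
          by (simp add: abs_mult mult.commute mult_right_mono)
      qed
    qed (use S1 in auto)
    have \<xi>2: "integrable M (\<lambda>w. (\<xi> N w)\<^sup>2)"
    proof (rule integrable_const_bound[of _ "C\<^sup>2"])
      show "AE w in M. norm ((\<xi> N w)\<^sup>2) \<le> C\<^sup>2"
        using C by (intro AE_I2) (simp add: abs_le_square_iff[symmetric], force)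
    qed simp
    have [measurable]: "\<xi> N \<in> borel_measurable (F (\<tau> N))" by fact
    have i1: "indep_var borel (\<lambda>w. ?S w * \<xi> N w) borel ?D"
      by (rule brownian_increment_indep[OF bm nn less]) (intro borel_measurable_times SF \<xi>)
    have i2: "indep_var borel (\<lambda>w. (\<xi> N w)\<^sup>2) borel (\<lambda>w. (?D w)\<^sup>2)"
      using indep_var_compose[OF brownian_increment_indep[OF bm nn less \<xi>], of "\<lambda>x. x\<^sup>2" borel "\<lambda>x. x\<^sup>2" borel]
      by (simp add: comp_def)
    have c1: "integrable M (\<lambda>w. ?S w * \<xi> N w * ?D w)" "(\<integral>w. ?S w * \<xi> N w * ?D w \<partial>M) = 0"
      using indep_var_integrable[OF i1 S\<xi> mom(1)] indep_var_lebesgue_integral[OF i1 S\<xi> mom(1)] mom(2)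
      by auto
    have c2: "integrable M (\<lambda>w. (\<xi> N w)\<^sup>2 * (?D w)\<^sup>2)"
      "(\<integral>w. (\<xi> N w)\<^sup>2 * (?D w)\<^sup>2 \<partial>M) = (\<integral>w. (\<xi> N w)\<^sup>2 \<partial>M) * (\<tau> (Suc N) - \<tau> N)"
      using indep_var_integrable[OF i2 \<xi>2 mom(3)] indep_var_lebesgue_integral[OF i2 \<xi>2 mom(3)] mom(4)
      by auto
    have sq: "(simple_integral B (Suc N) \<tau> \<xi> w)\<^sup>2
        = (?S w)\<^sup>2 + 2 * (?S w * \<xi> N w * ?D w) + (\<xi> N w)\<^sup>2 * (?D w)\<^sup>2" for w
      unfolding eq by (simp add: power2_sum power_mult_distrib)
    show ?thesis
      unfolding sq using S2 c1 c2 IH by simp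
  qed
qed

section \<open>Ito integrals of deterministic integrands\<close>

text \<open>At most one of the intervals contains \<open>r\<close>, so the square has no mixed terms.\<close>

lemma square_sum_disjoint_intervals:
  fixes c \<tau> :: "nat \<Rightarrow> real"
  assumes mono: "\<And>i. i < N \<Longrightarrow> \<tau> i \<le> \<tau> (Suc i)"
  shows "(\<Sum>i<N. c i * indicator {\<tau> i<..\<tau> (Suc i)} r)\<^sup>2
       = (\<Sum>i<N. (c i)\<^sup>2 * indicator {\<tau> i<..\<tau> (Suc i)} r)"
proof (cases "\<exists>i<N. r \<in> {\<tau> i<..\<tau> (Suc i)}")
  case False
  then have "indicator {\<tau> i<..\<tau> (Suc i)} r = (0::real)" if "i < N" for i
    using that by (auto simp: indicator_def)
  then show ?thesis by simp
next
  case True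
  then obtain i where i: "i < N" "r \<in> {\<tau> i<..\<tau> (Suc i)}" by auto
  have inc: "\<tau> m \<le> \<tau> n" if "m \<le> n" "n \<le> N" for m n
    using that by (induction rule: dec_induct) (auto intro: order_trans[OF _ mono])
  have ind: "indicator {\<tau> j<..\<tau> (Suc j)} r = (if j = i then 1 else (0::real))" if "j < N" for j
  proof (cases j i rule: linorder_cases)
    case less
    then have "\<tau> (Suc j) \<le> \<tau> i" using i by (intro inc) auto
    then show ?thesis using i less by auto
  next
    case greater
    then have "\<tau> (Suc i) \<le> \<tau> j" using that by (intro inc) auto
    then show ?thesis using i greater by auto
  qed (use i in auto)
  have pick: "(\<Sum>j<N. d j * indicator {\<tau> j<..\<tau> (Suc j)} r) = d i" for d :: "nat \<Rightarrow> real"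
  proof -
    have "(\<Sum>j<N. d j * indicator {\<tau> j<..\<tau> (Suc j)} r) = (\<Sum>j<N. if j = i then d j else 0)"
      by (intro sum.cong refl) (simp only: lessThan_iff ind, simp)
    then show ?thesis using i by simp
  qed
  show ?thesis by (simp only: pick)
qed

lemma step_function_integral:
  fixes V \<tau> :: "nat \<Rightarrow> real"
  assumes sp: "simple_process F a b N \<tau> \<xi>" and V: "\<And>i. 0 \<le> V i"
  shows "(\<integral>\<^sup>+r. ennreal (\<Sum>i<N. V i * indicator {\<tau> i<..\<tau> (Suc i)} r) * indicator {a..b} r \<partial>lborel)
       = ennreal (\<Sum>i<N. V i * (\<tau> (Suc i) - \<tau> i))"
proof -
  have in_ab: "{\<tau> i<..\<tau> (Suc i)} \<subseteq> {a..b}" and le: "\<tau> i \<le> \<tau> (Suc i)" if "i < N" for i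
  proof -
    have "a \<le> \<tau> i" "\<tau> (Suc i) \<le> b" using sp that by (auto simp: simple_process_def)
    then show "{\<tau> i<..\<tau> (Suc i)} \<subseteq> {a..b}" by auto
    show "\<tau> i \<le> \<tau> (Suc i)" using sp that by (auto simp: simple_process_def)
  qed
  have "(\<integral>\<^sup>+r. ennreal (\<Sum>i<N. V i * indicator {\<tau> i<..\<tau> (Suc i)} r) * indicator {a..b} r \<partial>lborel)
      = (\<integral>\<^sup>+r. (\<Sum>i<N. ennreal (V i) * indicator {\<tau> i<..\<tau> (Suc i)} r) \<partial>lborel)"
  proof (rule nn_integral_cong)
    fix r :: real
    have "ennreal (\<Sum>i<N. V i * indicator {\<tau> i<..\<tau> (Suc i)} r) * indicator {a..b} r
        = (\<Sum>i<N. ennreal (V i * indicator {\<tau> i<..\<tau> (Suc i)} r) * indicator {a..b} r)"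
      unfolding sum_distrib_right[symmetric] using V by (subst sum_ennreal) auto
    also have "\<dots> = (\<Sum>i<N. ennreal (V i) * indicator {\<tau> i<..\<tau> (Suc i)} r)"
    proof (intro sum.cong refl)
      fix i assume "i \<in> {..<N}"
      then have "{\<tau> i<..\<tau> (Suc i)} \<subseteq> {a..b}" using in_ab by simp
      then show "ennreal (V i * indicator {\<tau> i<..\<tau> (Suc i)} r) * indicator {a..b} r
          = ennreal (V i) * indicator {\<tau> i<..\<tau> (Suc i)} r"
        by (cases "r \<in> {\<tau> i<..\<tau> (Suc i)}") (auto simp: subset_iff)
    qed
    finally show "ennreal (\<Sum>i<N. V i * indicator {\<tau> i<..\<tau> (Suc i)} r) * indicator {a..b} r
        = (\<Sum>i<N. ennreal (V i) * indicator {\<tau> i<..\<tau> (Suc i)} r)" .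
  qed
  also have "\<dots> = (\<Sum>i<N. ennreal (V i) * ennreal (\<tau> (Suc i) - \<tau> i))"
    using le by (subst nn_integral_sum) (auto simp: nn_integral_cmult)
  also have "\<dots> = ennreal (\<Sum>i<N. V i * (\<tau> (Suc i) - \<tau> i))"
    using V le by (subst sum_ennreal[symmetric]) (auto simp: ennreal_mult)
  finally show ?thesis .
qed

text \<open>The bias-variance identity. Both summands on the right will be integrated over time: the
  variance measures how far a simple process is from its mean, the bias how far the mean is from
  the integrand.\<close>

lemma (in prob_space) mean_square_decomp:
  assumes X[measurable]: "X \<in> borel_measurable M" and bd: "\<And>w. w \<in> space M \<Longrightarrow> \<bar>X w\<bar> \<le> C"
  shows "(\<integral>\<^sup>+w. ennreal ((X w - c)\<^sup>2) \<partial>M)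
    = ennreal (expectation (\<lambda>w. (X w - expectation X)\<^sup>2)) + ennreal ((expectation X - c)\<^sup>2)"
proof -
  have X1: "integrable M X"
    by (rule integrable_const_bound[of _ C]) (use bd in auto)
  have X2: "integrable M (\<lambda>w. (X w)\<^sup>2)"
  proof (rule integrable_const_bound[of _ "C\<^sup>2"])
    show "AE w in M. norm ((X w)\<^sup>2) \<le> C\<^sup>2"
      using bd by (intro AE_I2) (simp add: abs_le_square_iff[symmetric], force)
  qed simp
  have V: "integrable M (\<lambda>w. (X w - d)\<^sup>2)" for d
    using X1 X2 by (simp add: power2_diff)
  have "(\<integral>\<^sup>+w. ennreal ((X w - c)\<^sup>2) \<partial>M) = ennreal (expectation (\<lambda>w. (X w - c)\<^sup>2))"
    by (rule nn_integral_eq_integral[OF V]) simp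
  also have "expectation (\<lambda>w. (X w - c)\<^sup>2)
      = expectation (\<lambda>w. (X w - expectation X)\<^sup>2) + (expectation X - c)\<^sup>2"
    using X1 X2 by (simp add: power2_diff prob_space algebra_simps power2_eq_square)
  finally show ?thesis by simp
qed

text \<open>\<open>D\<close> is the mean square distance of a random simple process from a deterministic \<open>k\<close>. By the
  bias-variance identity at every time, \<open>D\<close> splits into the distance of the mean step function
  from \<open>k\<close> and the integrated variance, and by the Ito isometry the latter is the distance between
  the stochastic integrals of the process and of its mean.\<close>

lemma simple_process_mean_approximation:
  assumes bm: "brownian_motion_wrt M F B" and sp: "simple_process F a b N \<tau> \<xi>" and a: "0 \<le> a"
    and k[measurable]: "k \<in> borel_measurable borel"
  defines "c \<equiv> \<lambda>i. (\<integral>w. \<xi> i w \<partial>M)"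
  defines "D \<equiv> (\<integral>\<^sup>+w. (\<integral>\<^sup>+r\<in>{a..b}. ennreal ((simple_value N \<tau> \<xi> r w - k r)\<^sup>2) \<partial>lborel) \<partial>M)"
  shows "(\<integral>\<^sup>+r\<in>{a..b}. ennreal (((\<Sum>i<N. c i * indicator {\<tau> i<..\<tau> (Suc i)} r) - k r)\<^sup>2) \<partial>lborel) \<le> D"
    and "(\<integral>\<^sup>+w. ennreal ((simple_integral B N \<tau> \<xi> w - simple_integral B N \<tau> (\<lambda>i w. c i) w)\<^sup>2) \<partial>M) \<le> D"
proof -
  interpret prob_space M by (rule brownian_motion_wrtD(1)[OF bm])
  interpret pair_sigma_finite lborel M ..
  let ?s = "\<lambda>r. \<Sum>i<N. c i * indicator {\<tau> i<..\<tau> (Suc i)} r :: real"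
  define V where "V i = expectation (\<lambda>w. (\<xi> i w - c i)\<^sup>2)" for i
  let ?V = "\<lambda>r. \<Sum>i<N. V i * indicator {\<tau> i<..\<tau> (Suc i)} r :: real"
  have V0: "0 \<le> V i" for i by (simp add: V_def)
  have mono: "\<tau> i \<le> \<tau> (Suc i)" if "i < N" for i using sp that by (simp add: simple_process_def)
  have \<xi>F: "\<xi> i \<in> borel_measurable (F (\<tau> i))" if "i < N" for i
    using sp that by (simp add: simple_process_def)
  have \<xi>M: "\<xi> i \<in> borel_measurable M" if "i < N" for i
    using adapted_measurable_later(2)[OF bm \<xi>F[OF that] order_refl] .
  have "\<exists>C. \<forall>w\<in>space M. \<bar>\<xi> i w\<bar> \<le> C" if "i < N" for i
    using sp that unfolding simple_process_def brownian_motion_wrtD(2)[OF bm] by blast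
  then obtain C where C: "\<And>i w. i < N \<Longrightarrow> w \<in> space M \<Longrightarrow> \<bar>\<xi> i w\<bar> \<le> C i"
    by metis
  have int: "integrable M (\<xi> i)" if "i < N" for i
    by (rule integrable_const_bound[of _ "C i"]) (use C \<xi>M that in auto)
  have sv: "(\<lambda>(r, w). simple_value N \<tau> \<xi> r w) \<in> borel_measurable (lborel \<Otimes>\<^sub>M M)"
    unfolding simple_value_def split_beta'
    by (intro borel_measurable_sum borel_measurable_times)
       (auto intro: measurable_compose[OF measurable_snd \<xi>M] measurable_compose[OF measurable_fst])
  have pointwise: "(\<integral>\<^sup>+w. ennreal ((simple_value N \<tau> \<xi> r w - k r)\<^sup>2) \<partial>M)
      = ennreal (?V r) + ennreal ((?s r - k r)\<^sup>2)" for r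
  proof -
    have meas: "simple_value N \<tau> \<xi> r \<in> borel_measurable M"
      unfolding simple_value_def[abs_def] using \<xi>M by (intro borel_measurable_sum) auto
    have bound: "\<bar>simple_value N \<tau> \<xi> r w\<bar> \<le> (\<Sum>i<N. C i * indicator {\<tau> i<..\<tau> (Suc i)} r)"
      if "w \<in> space M" for w
      unfolding simple_value_def
      by (rule order_trans[OF sum_abs]) (auto intro!: sum_mono mult_right_mono C[OF _ that] simp: abs_mult)
    have mean: "expectation (simple_value N \<tau> \<xi> r) = ?s r"
      unfolding simple_value_def[abs_def] c_def using int
      by (subst Bochner_Integration.integral_sum) auto
    have "(simple_value N \<tau> \<xi> r w - ?s r)\<^sup>2
        = (\<Sum>i<N. (\<xi> i w - c i)\<^sup>2 * indicator {\<tau> i<..\<tau> (Suc i)} r)" for w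
      unfolding simple_value_def sum_subtractf[symmetric] left_diff_distrib[symmetric]
      by (rule square_sum_disjoint_intervals[where N=N and \<tau>=\<tau>]) (rule mono)
    moreover have "integrable M (\<lambda>w. (\<xi> i w - c i)\<^sup>2)" if "i < N" for i
    proof (rule integrable_const_bound[of _ "(C i + \<bar>c i\<bar>)\<^sup>2"])
      show "AE w in M. norm ((\<xi> i w - c i)\<^sup>2) \<le> (C i + \<bar>c i\<bar>)\<^sup>2"
      proof (rule AE_I2)
        fix w assume "w \<in> space M"
        then have "\<bar>\<xi> i w - c i\<bar> \<le> \<bar>C i + \<bar>c i\<bar>\<bar>" using C[OF that] by fastforce
        then show "norm ((\<xi> i w - c i)\<^sup>2) \<le> (C i + \<bar>c i\<bar>)\<^sup>2"
          by (simp add: abs_le_square_iff)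
      qed
    qed (use \<xi>M that in auto)
    ultimately have "expectation (\<lambda>w. (simple_value N \<tau> \<xi> r w - ?s r)\<^sup>2) = ?V r"
      by (simp add: V_def)
    then show ?thesis
      using mean_square_decomp[OF meas bound, of "k r"] by (simp add: mean)
  qed
  have "D = (\<integral>\<^sup>+w. (\<integral>\<^sup>+r. ennreal ((simple_value N \<tau> \<xi> r w - k r)\<^sup>2) * indicator {a..b} r \<partial>lborel) \<partial>M)"
    by (simp add: D_def)
  also have "\<dots> = (\<integral>\<^sup>+r. (\<integral>\<^sup>+w. ennreal ((simple_value N \<tau> \<xi> r w - k r)\<^sup>2) * indicator {a..b} r \<partial>M) \<partial>lborel)"
    using sv by (intro Fubini') (simp add: split_beta')
  also have "\<dots> = (\<integral>\<^sup>+r. (ennreal (?V r) + ennreal ((?s r - k r)\<^sup>2)) * indicator {a..b} r \<partial>lborel)"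
    unfolding pointwise[symmetric] simple_value_def[abs_def] using \<xi>M by (intro nn_integral_cong nn_integral_multc) auto
  also have "\<dots> = (\<integral>\<^sup>+r\<in>{a..b}. ennreal (?V r) \<partial>lborel) + (\<integral>\<^sup>+r\<in>{a..b}. ennreal ((?s r - k r)\<^sup>2) \<partial>lborel)"
    unfolding distrib_right by (rule nn_integral_add) measurable
  finally have D: "D = ennreal (\<Sum>i<N. V i * (\<tau> (Suc i) - \<tau> i))
      + (\<integral>\<^sup>+r\<in>{a..b}. ennreal ((?s r - k r)\<^sup>2) \<partial>lborel)"
    using step_function_integral[OF sp V0] by simp
  show "(\<integral>\<^sup>+r\<in>{a..b}. ennreal ((?s r - k r)\<^sup>2) \<partial>lborel) \<le> D"
    unfolding D by simp
  have spc: "simple_process F a b N \<tau> (\<lambda>i w. \<xi> i w - c i)"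
    unfolding simple_process_def
  proof (intro conjI allI impI)
    fix i assume i: "i < N"
    show "(\<lambda>w. \<xi> i w - c i) \<in> borel_measurable (F (\<tau> i))" using \<xi>F[OF i] by simp
    have "\<bar>\<xi> i w - c i\<bar> \<le> C i + \<bar>c i\<bar>" if "w \<in> space M" for w
      using C[OF i that] by linarith
    then show "\<exists>C. \<forall>w\<in>space (F (\<tau> i)). \<bar>\<xi> i w - c i\<bar> \<le> C"
      unfolding brownian_motion_wrtD(2)[OF bm] by blast
  qed (use sp in \<open>auto simp: simple_process_def\<close>)
  have "(\<integral>\<^sup>+w. ennreal ((simple_integral B N \<tau> \<xi> w - simple_integral B N \<tau> (\<lambda>i w. c i) w)\<^sup>2) \<partial>M)
      = (\<integral>\<^sup>+w. ennreal ((simple_integral B N \<tau> (\<lambda>i w. \<xi> i w - c i) w)\<^sup>2) \<partial>M)"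
    by (simp add: simple_integral_def sum_subtractf left_diff_distrib)
  also have "\<dots> = ennreal (\<Sum>i<N. V i * (\<tau> (Suc i) - \<tau> i))"
    using ito_isometry_simple[OF bm spc a] by (subst nn_integral_eq_integral) (auto simp: V_def)
  finally show "(\<integral>\<^sup>+w. ennreal ((simple_integral B N \<tau> \<xi> w - simple_integral B N \<tau> (\<lambda>i w. c i) w)\<^sup>2) \<partial>M) \<le> D"
    unfolding D by simp
qed

text \<open>Young's inequality with a parameter \<open>\<epsilon>\<close> that is the square root of the (slightly enlarged)
  squared distance makes both error terms small.\<close>

lemma L2_norm_convergence:
  fixes s :: "nat \<Rightarrow> real \<Rightarrow> real"
  assumes s: "\<And>n. integrable N (\<lambda>r. (s n r)\<^sup>2)" and k: "integrable N (\<lambda>r. (k r)\<^sup>2)"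
    and d: "\<And>n. integrable N (\<lambda>r. (s n r - k r)\<^sup>2)"
    and lim: "(\<lambda>n. \<integral>r. (s n r - k r)\<^sup>2 \<partial>N) \<longlonglongrightarrow> 0"
  shows "(\<lambda>n. \<integral>r. (s n r)\<^sup>2 \<partial>N) \<longlonglongrightarrow> (\<integral>r. (k r)\<^sup>2 \<partial>N)"
proof -
  let ?K = "\<integral>r. (k r)\<^sup>2 \<partial>N"
  define \<delta> where "\<delta> n = (\<integral>r. (s n r - k r)\<^sup>2 \<partial>N) + inverse (real (Suc n))" for n
  define \<epsilon> where "\<epsilon> n = sqrt (\<delta> n)" for n
  \<comment> \<open>The added null sequence keeps \<open>\<epsilon> n\<close> positive, since it is divided by below.\<close>
  have \<delta>: "\<delta> n > 0" and D: "(\<integral>r. (s n r - k r)\<^sup>2 \<partial>N) \<le> \<delta> n" for n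
    unfolding \<delta>_def by (auto intro!: add_nonneg_pos integral_nonneg_AE)
  have \<delta>0: "\<delta> \<longlonglongrightarrow> 0"
    unfolding \<delta>_def using tendsto_add[OF lim LIMSEQ_inverse_real_of_nat] by simp
  have \<epsilon>0: "\<epsilon> \<longlonglongrightarrow> 0"
    unfolding \<epsilon>_def using tendsto_real_sqrt[OF \<delta>0] by simp
  have bound: "\<bar>(\<integral>r. (s n r)\<^sup>2 \<partial>N) - ?K\<bar> \<le> \<epsilon> n * ?K + \<delta> n + \<epsilon> n" for n
  proof -
    have \<epsilon>: "\<epsilon> n > 0" "\<epsilon> n * \<epsilon> n = \<delta> n" using \<delta>[of n] by (auto simp: \<epsilon>_def)
    have pt: "\<bar>(s n r)\<^sup>2 - (k r)\<^sup>2\<bar> \<le> \<epsilon> n * (k r)\<^sup>2 + (1 + 1 / \<epsilon> n) * (s n r - k r)\<^sup>2" for r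
    proof -
      define e where "e = s n r - k r"
      have "0 \<le> (\<epsilon> n * \<bar>k r\<bar> - \<bar>e\<bar>)\<^sup>2 / \<epsilon> n" using \<epsilon>(1) by simp
      also have "\<dots> = \<epsilon> n * (k r)\<^sup>2 - 2 * \<bar>k r\<bar> * \<bar>e\<bar> + e\<^sup>2 / \<epsilon> n"
        using \<epsilon>(1) by (simp add: power2_diff power_mult_distrib field_simps power2_eq_square)
      finally have "2 * \<bar>k r * e\<bar> \<le> \<epsilon> n * (k r)\<^sup>2 + e\<^sup>2 / \<epsilon> n" by (simp add: abs_mult)
      moreover have "(s n r)\<^sup>2 - (k r)\<^sup>2 = 2 * (k r * e) + e\<^sup>2"
        by (simp add: e_def power2_eq_square algebra_simps)
      moreover have "\<bar>2 * (k r * e) + e\<^sup>2\<bar> \<le> 2 * \<bar>k r * e\<bar> + e\<^sup>2"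
        using abs_triangle_ineq[of "2 * (k r * e)" "e\<^sup>2"] by simp
      ultimately show ?thesis unfolding e_def[symmetric] by (simp add: algebra_simps)
    qed
    have "\<bar>(\<integral>r. (s n r)\<^sup>2 \<partial>N) - ?K\<bar> = \<bar>\<integral>r. (s n r)\<^sup>2 - (k r)\<^sup>2 \<partial>N\<bar>"
      using s[of n] k by simp
    also have "\<dots> \<le> (\<integral>r. \<bar>(s n r)\<^sup>2 - (k r)\<^sup>2\<bar> \<partial>N)" by (rule integral_abs_bound)
    also have "\<dots> \<le> (\<integral>r. \<epsilon> n * (k r)\<^sup>2 + (1 + 1 / \<epsilon> n) * (s n r - k r)\<^sup>2 \<partial>N)"
      using s[of n] k d[of n] pt by (intro integral_mono) auto
    also have "\<dots> = \<epsilon> n * ?K + (1 + 1 / \<epsilon> n) * (\<integral>r. (s n r - k r)\<^sup>2 \<partial>N)"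
      using k d[of n] by simp
    also have "\<dots> \<le> \<epsilon> n * ?K + (1 + 1 / \<epsilon> n) * \<delta> n"
      using D[of n] \<epsilon>(1) by (intro add_left_mono mult_left_mono) auto
    also have "\<dots> = \<epsilon> n * ?K + \<delta> n + \<epsilon> n"
      using \<epsilon> by (simp add: field_simps)
    finally show ?thesis .
  qed
  have "(\<lambda>n. \<epsilon> n * ?K + \<delta> n + \<epsilon> n) \<longlonglongrightarrow> 0 * ?K + 0 + 0"
    by (intro tendsto_intros \<epsilon>0 \<delta>0)
  then have bound0: "(\<lambda>n. \<epsilon> n * ?K + \<delta> n + \<epsilon> n) \<longlonglongrightarrow> 0" by simp
  have "(\<lambda>n. (\<integral>r. (s n r)\<^sup>2 \<partial>N) - ?K) \<longlonglongrightarrow> 0"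
    by (rule Lim_null_comparison[OF _ bound0]) (simp only: real_norm_def bound eventually_True)
  then show ?thesis by (rule LIM_zero_cancel)
qed

text \<open>The identity holds for the step functions that replace the random heights by their means, and
  both sides pass to the limit. It says that \<open>I\<close> is a centred Gaussian of variance \<open>K\<close>, tested
  against normal densities only.\<close>

lemma gaussian_density_ito_integral:
  assumes bm: "brownian_motion_wrt M F B" and a: "0 \<le> a"
    and ito: "is_ito_integral M F B a b (\<lambda>r w. k r) I"
    and K: "(\<integral>\<^sup>+r\<in>{a..b}. ennreal ((k r)\<^sup>2) \<partial>lborel) = ennreal K" and "0 \<le> K" and v: "0 < v"
  shows "(\<integral>w. normal_density 0 (sqrt v) (y - I w) \<partial>M) = normal_density 0 (sqrt (v + K)) y"
proof -
  interpret prob_space M by (rule brownian_motion_wrtD(1)[OF bm])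
  \<comment> \<open>The integrand is known to be measurable on \<open>{a..b}\<close> only, so it is continued by \<open>0\<close>.\<close>
  define \<kappa> where "\<kappa> r = (if r \<in> {a..b} then k r else 0)" for r
  have I[measurable]: "I \<in> borel_measurable M"
    and kM: "(\<lambda>(r, w). k r) \<in> borel_measurable (restrict_space borel {a..b} \<Otimes>\<^sub>M M)"
    using ito by (auto simp: is_ito_integral_def)
  obtain w0 where w0: "w0 \<in> space M" using not_empty by auto
  have "k \<in> borel_measurable (restrict_space borel {a..b})"
    using measurable_compose[OF measurable_Pair2'[OF w0] kM] by simp
  then have \<kappa>[measurable]: "\<kappa> \<in> borel_measurable borel"
    unfolding \<kappa>_def by (subst (asm) measurable_restrict_space_iff[where c=0]) auto
  obtain N \<tau> \<xi> where sp: "\<And>n. simple_process F a b (N n) (\<tau> n) (\<xi> n)"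
    and D0: "(\<lambda>n. \<integral>\<^sup>+w. (\<integral>\<^sup>+r\<in>{a..b}.
            ennreal ((simple_value (N n) (\<tau> n) (\<xi> n) r w - k r)\<^sup>2) \<partial>lborel) \<partial>M) \<longlonglongrightarrow> 0"
    and E0: "(\<lambda>n. \<integral>\<^sup>+w. ennreal ((simple_integral B (N n) (\<tau> n) (\<xi> n) w - I w)\<^sup>2) \<partial>M) \<longlonglongrightarrow> 0"
    using ito unfolding is_ito_integral_def by blast
  define D where "D n = (\<integral>\<^sup>+w. (\<integral>\<^sup>+r\<in>{a..b}.
            ennreal ((simple_value (N n) (\<tau> n) (\<xi> n) r w - \<kappa> r)\<^sup>2) \<partial>lborel) \<partial>M)" for n
  define E where "E n = (\<integral>\<^sup>+w. ennreal ((simple_integral B (N n) (\<tau> n) (\<xi> n) w - I w)\<^sup>2) \<partial>M)" for n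
  have "D = (\<lambda>n. \<integral>\<^sup>+w. (\<integral>\<^sup>+r\<in>{a..b}.
            ennreal ((simple_value (N n) (\<tau> n) (\<xi> n) r w - k r)\<^sup>2) \<partial>lborel) \<partial>M)"
    unfolding D_def by (intro ext nn_integral_cong) (auto simp: \<kappa>_def indicator_def)
  then have D0: "D \<longlonglongrightarrow> 0" using D0 by simp
  have E0: "E \<longlonglongrightarrow> 0" using E0 unfolding E_def .
  define c where "c n i = (\<integral>w. \<xi> n i w \<partial>M)" for n i
  define s where "s n r = (\<Sum>i<N n. c n i * indicator {\<tau> n i<..\<tau> n (Suc i)} r)" for n and r :: real
  define J where "J n w = simple_integral B (N n) (\<tau> n) (\<lambda>i w. c n i) w" for n w
  define S where "S n w = simple_integral B (N n) (\<tau> n) (\<xi> n) w" for n w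
  have sD: "(\<integral>\<^sup>+r\<in>{a..b}. ennreal ((s n r - \<kappa> r)\<^sup>2) \<partial>lborel) \<le> D n"
    and JD: "(\<integral>\<^sup>+w. ennreal ((S n w - J n w)\<^sup>2) \<partial>M) \<le> D n" for n
    using simple_process_mean_approximation[OF bm sp[of n] a \<kappa>]
    by (auto simp: s_def c_def D_def S_def J_def)
  have spc: "simple_process F a b (N n) (\<tau> n) (\<lambda>i w. c n i)" for n
    by (rule simple_process_const[OF sp])
  have JM[measurable]: "J n \<in> borel_measurable M" and SM[measurable]: "S n \<in> borel_measurable M" for n
    unfolding J_def S_def
    using adapted_measurable_later(2)[OF bm simple_integral_adapted[OF bm spc a] order_refl]
      adapted_measurable_later(2)[OF bm simple_integral_adapted[OF bm sp a] order_refl] by auto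
  have sM[measurable]: "s n \<in> borel_measurable borel" for n unfolding s_def by measurable

  \<comment> \<open>The variances of the Gaussian approximations converge.\<close>
  let ?L = "restrict_space lborel {a..b}"
  define v' where "v' n = (\<Sum>i<N n. (c n i)\<^sup>2 * (\<tau> n (Suc i) - \<tau> n i))" for n
  have s2: "(\<integral>\<^sup>+r. ennreal ((s n r)\<^sup>2) \<partial>?L) = ennreal (v' n)" and v'0: "0 \<le> v' n" for n
  proof -
    have mono: "\<And>i. i < N n \<Longrightarrow> \<tau> n i \<le> \<tau> n (Suc i)" using sp[of n] by (simp add: simple_process_def)
    show "(\<integral>\<^sup>+r. ennreal ((s n r)\<^sup>2) \<partial>?L) = ennreal (v' n)"
    proof -
      have sq: "(s n r)\<^sup>2 = (\<Sum>i<N n. (c n i)\<^sup>2 * indicator {\<tau> n i<..\<tau> n (Suc i)} r)" for r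
        unfolding s_def by (rule square_sum_disjoint_intervals[where N="N n" and \<tau>="\<tau> n"]) (rule mono)
      have "(\<integral>\<^sup>+r. ennreal ((s n r)\<^sup>2) \<partial>?L) = (\<integral>\<^sup>+r\<in>{a..b}. ennreal ((s n r)\<^sup>2) \<partial>lborel)"
        by (rule nn_integral_restrict_space) simp
      also have "\<dots> = ennreal (v' n)"
        unfolding sq v'_def by (rule step_function_integral[OF sp]) simp
      finally show ?thesis .
    qed
    show "0 \<le> v' n" unfolding v'_def using mono by (intro sum_nonneg) auto
  qed
  have k2: "(\<integral>\<^sup>+r. ennreal ((\<kappa> r)\<^sup>2) \<partial>?L) = ennreal K"
  proof -
    have "(\<integral>\<^sup>+r. ennreal ((\<kappa> r)\<^sup>2) \<partial>?L) = (\<integral>\<^sup>+r\<in>{a..b}. ennreal ((\<kappa> r)\<^sup>2) \<partial>lborel)"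
      by (rule nn_integral_restrict_space) simp
    also have "\<dots> = (\<integral>\<^sup>+r\<in>{a..b}. ennreal ((k r)\<^sup>2) \<partial>lborel)"
      by (intro nn_integral_cong) (simp add: \<kappa>_def split: split_indicator)
    finally show ?thesis using K by simp
  qed
  have real_int: "integrable ?L f \<and> (\<integral>r. f r \<partial>?L) = C"
    if "f \<in> borel_measurable borel" "\<And>r. 0 \<le> f r" "(\<integral>\<^sup>+r. ennreal (f r) \<partial>?L) = ennreal C" "0 \<le> C"
    for f :: "real \<Rightarrow> real" and C
  proof -
    have m: "f \<in> borel_measurable ?L" using that(1) by (intro measurable_restrict_space1) simp
    have "integrable ?L f"
      by (rule integrableI_nonneg[OF m]) (simp_all add: that)
    moreover have "(\<integral>r. f r \<partial>?L) = C"
      by (subst integral_eq_nn_integral[OF m]) (simp_all add: that)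
    ultimately show ?thesis ..
  qed
  have si: "integrable ?L (\<lambda>r. (s n r)\<^sup>2)" "(\<integral>r. (s n r)\<^sup>2 \<partial>?L) = v' n" for n
    using real_int[OF _ _ s2[of n] v'0[of n]] by simp_all
  have ki: "integrable ?L (\<lambda>r. (\<kappa> r)\<^sup>2)" "(\<integral>r. (\<kappa> r)\<^sup>2 \<partial>?L) = K"
    using real_int[OF _ _ k2 \<open>0 \<le> K\<close>] by simp_all
  have di: "integrable ?L (\<lambda>r. (s n r - \<kappa> r)\<^sup>2)" for n
  proof (rule Bochner_Integration.integrable_bound[of _ "\<lambda>r. 2 * (s n r)\<^sup>2 + 2 * (\<kappa> r)\<^sup>2"])
    show "AE r in ?L. norm ((s n r - \<kappa> r)\<^sup>2) \<le> norm (2 * (s n r)\<^sup>2 + 2 * (\<kappa> r)\<^sup>2)"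
    proof (rule AE_I2)
      fix r
      have "0 \<le> (s n r + \<kappa> r)\<^sup>2" by simp
      then have "(s n r - \<kappa> r)\<^sup>2 \<le> 2 * (s n r)\<^sup>2 + 2 * (\<kappa> r)\<^sup>2"
        by (simp add: power2_sum power2_diff)
      then show "norm ((s n r - \<kappa> r)\<^sup>2) \<le> norm (2 * (s n r)\<^sup>2 + 2 * (\<kappa> r)\<^sup>2)"
        by simp
    qed
    have "(\<lambda>r. (s n r - \<kappa> r)\<^sup>2) \<in> borel_measurable lborel" by measurable
    then show "(\<lambda>r. (s n r - \<kappa> r)\<^sup>2) \<in> borel_measurable ?L"
      by (rule measurable_restrict_space1)
    show "integrable ?L (\<lambda>r. 2 * (s n r)\<^sup>2 + 2 * (\<kappa> r)\<^sup>2)"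
      using si(1)[of n] ki(1) by simp
  qed
  have "(\<lambda>n. ennreal (\<integral>r. (s n r - \<kappa> r)\<^sup>2 \<partial>?L)) \<longlonglongrightarrow> 0"
  proof (rule tendsto_sandwich[OF _ _ tendsto_const D0])
    show "\<forall>\<^sub>F n in sequentially. ennreal (\<integral>r. (s n r - \<kappa> r)\<^sup>2 \<partial>?L) \<le> D n"
    proof (intro always_eventually allI)
      fix n
      have "ennreal (\<integral>r. (s n r - \<kappa> r)\<^sup>2 \<partial>?L) = (\<integral>\<^sup>+r. ennreal ((s n r - \<kappa> r)\<^sup>2) \<partial>?L)"
        by (rule nn_integral_eq_integral[OF di, symmetric]) simp
      also have "\<dots> = (\<integral>\<^sup>+r\<in>{a..b}. ennreal ((s n r - \<kappa> r)\<^sup>2) \<partial>lborel)"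
        by (rule nn_integral_restrict_space) simp
      finally show "ennreal (\<integral>r. (s n r - \<kappa> r)\<^sup>2 \<partial>?L) \<le> D n" using sD[of n] by simp
    qed
  qed simp
  then have "(\<lambda>n. \<integral>r. (s n r - \<kappa> r)\<^sup>2 \<partial>?L) \<longlonglongrightarrow> 0"
    by (subst (asm) ennreal_tendsto_0_iff) simp_all
  from L2_norm_convergence[OF si(1) ki(1) di this]
  have v'K: "v' \<longlonglongrightarrow> K" by (simp add: si ki)

  \<comment> \<open>The approximations converge to the Ito integral in mean square, hence almost surely along a
    subsequence; an initial segment, where the distance could be infinite, is dropped.\<close>
  have JI: "(\<lambda>n. \<integral>\<^sup>+w. ennreal ((J n w - I w)\<^sup>2) \<partial>M) \<longlonglongrightarrow> 0"
  proof (rule tendsto_sandwich[OF _ _ tendsto_const])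
    have "(\<integral>\<^sup>+w. ennreal ((J n w - I w)\<^sup>2) \<partial>M) \<le> 2 * D n + 2 * E n" for n
    proof -
      have "(J n w - I w)\<^sup>2 \<le> 2 * (S n w - J n w)\<^sup>2 + 2 * (S n w - I w)\<^sup>2" for w
      proof -
        \<comment> \<open>The left-hand side squares the difference of the two brackets, so this is the parallelogram law.\<close>
        have "0 \<le> ((S n w - J n w) + (S n w - I w))\<^sup>2" by simp
        then show ?thesis by (simp add: power2_eq_square algebra_simps)
      qed
      then have "(\<integral>\<^sup>+w. ennreal ((J n w - I w)\<^sup>2) \<partial>M)
          \<le> (\<integral>\<^sup>+w. 2 * ennreal ((S n w - J n w)\<^sup>2) + 2 * ennreal ((S n w - I w)\<^sup>2) \<partial>M)"
      proof (intro nn_integral_mono)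
        fix w
        assume le: "\<And>w. (J n w - I w)\<^sup>2 \<le> 2 * (S n w - J n w)\<^sup>2 + 2 * (S n w - I w)\<^sup>2"
        have "ennreal ((J n w - I w)\<^sup>2) \<le> ennreal (2 * (S n w - J n w)\<^sup>2 + 2 * (S n w - I w)\<^sup>2)"
          using le by (rule ennreal_leI)
        also have "\<dots> = 2 * ennreal ((S n w - J n w)\<^sup>2) + 2 * ennreal ((S n w - I w)\<^sup>2)"
          by (simp add: ennreal_plus ennreal_mult)
        finally show "ennreal ((J n w - I w)\<^sup>2)
            \<le> 2 * ennreal ((S n w - J n w)\<^sup>2) + 2 * ennreal ((S n w - I w)\<^sup>2)" .
      qed
      also have "\<dots> = 2 * (\<integral>\<^sup>+w. ennreal ((S n w - J n w)\<^sup>2) \<partial>M) + 2 * E n"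
        unfolding E_def S_def[symmetric] by (subst nn_integral_add) (simp_all add: nn_integral_cmult)
      also have "\<dots> \<le> 2 * D n + 2 * E n"
        using JD by (intro add_right_mono mult_left_mono) auto
      finally show ?thesis .
    qed
    then show "\<forall>\<^sub>F n in sequentially. (\<integral>\<^sup>+w. ennreal ((J n w - I w)\<^sup>2) \<partial>M) \<le> 2 * D n + 2 * E n"
      by simp
    have "(\<lambda>n. 2 * D n + 2 * E n) \<longlonglongrightarrow> 2 * 0 + 2 * 0"
      using D0 E0 by (intro tendsto_add ennreal_tendsto_cmult) auto
    then show "(\<lambda>n. 2 * D n + 2 * E n) \<longlonglongrightarrow> 0" by simp
  qed simp
  then have "\<forall>\<^sub>F n in sequentially. (\<integral>\<^sup>+w. ennreal ((J n w - I w)\<^sup>2) \<partial>M) < 1"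
    by (rule order_tendstoD) simp
  then obtain n0 where n0: "\<And>n. n \<ge> n0 \<Longrightarrow> (\<integral>\<^sup>+w. ennreal ((J n w - I w)\<^sup>2) \<partial>M) < 1"
    by (auto simp: eventually_sequentially)
  have int: "integrable M (\<lambda>w. (J (n + n0) w - I w)\<^sup>2)" for n
  proof (rule integrableI_nonneg)
    show "(\<integral>\<^sup>+w. ennreal ((J (n + n0) w - I w)\<^sup>2) \<partial>M) < \<infinity>"
      using n0[of "n + n0"] by (simp add: less_trans[OF _ ennreal_one_less_top])
  qed auto
  have "(\<lambda>n. ennreal (\<integral>w. (J (n + n0) w - I w)\<^sup>2 \<partial>M)) \<longlonglongrightarrow> 0"
    using LIMSEQ_ignore_initial_segment[OF JI, of n0]
    by (simp add: nn_integral_eq_integral[OF int])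
  then have "(\<lambda>n. \<integral>w. (J (n + n0) w - I w)\<^sup>2 \<partial>M) \<longlonglongrightarrow> 0"
    by (subst (asm) ennreal_tendsto_0_iff) simp_all
  then obtain \<rho> where \<rho>: "strict_mono \<rho>"
    and AE0: "AE w in M. (\<lambda>n. (J (\<rho> n + n0) w - I w)\<^sup>2) \<longlonglongrightarrow> 0"
    using tendsto_L1_AE_subseq[of M "\<lambda>n w. (J (n + n0) w - I w)\<^sup>2", OF int] by auto
  let ?\<phi> = "\<lambda>z. normal_density 0 (sqrt v) z"
  have bnd: "\<bar>?\<phi> z\<bar> \<le> 1 / sqrt (2 * pi * v)" for z
  proof -
    have "exp (- (z - 0)\<^sup>2 / (2 * (sqrt v)\<^sup>2)) \<le> 1" by simp
    then show ?thesis using v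
      unfolding normal_density_def by (simp add: abs_mult divide_right_mono)
  qed
  have lim: "(\<lambda>n. \<integral>w. ?\<phi> (y - J (\<rho> n + n0) w) \<partial>M) \<longlonglongrightarrow> (\<integral>w. ?\<phi> (y - I w) \<partial>M)"
  proof (rule integral_dominated_convergence[where w = "\<lambda>_. 1 / sqrt (2 * pi * v)"])
    show "AE w in M. (\<lambda>n. ?\<phi> (y - J (\<rho> n + n0) w)) \<longlonglongrightarrow> ?\<phi> (y - I w)"
      using AE0
    proof eventually_elim
      case (elim w)
      have "(\<lambda>n. J (\<rho> n + n0) w - I w) \<longlonglongrightarrow> 0"
        using tendsto_real_sqrt[OF elim] by (simp add: tendsto_rabs_zero_iff)
      then have "(\<lambda>n. J (\<rho> n + n0) w) \<longlonglongrightarrow> I w" by (rule LIM_zero_cancel)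
      then show ?case unfolding normal_density_def using v
        by (intro tendsto_intros) auto
    qed
  qed (use bnd in auto)
  have eq: "(\<integral>w. ?\<phi> (y - J n w) \<partial>M) = normal_density 0 (sqrt (v + v' n)) y" for n
    using gaussian_density_simple_integral[OF bm spc[of n] a v, of y]
    unfolding J_def[symmetric] v'_def[symmetric]
    by (subst integral_eq_nn_integral) simp_all
  have "(\<lambda>n. normal_density 0 (sqrt (v + v' (\<rho> n + n0))) y) \<longlonglongrightarrow> normal_density 0 (sqrt (v + K)) y"
  proof -
    have "(\<lambda>n. v' (\<rho> n + n0)) \<longlonglongrightarrow> K"
      using LIMSEQ_subseq_LIMSEQ[OF LIMSEQ_ignore_initial_segment[OF v'K, of n0] \<rho>] by (simp add: comp_def)
    then show ?thesis unfolding normal_density_def using v \<open>0 \<le> K\<close>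
      by (intro tendsto_intros) auto
  qed
  then show ?thesis by (rule LIMSEQ_unique[OF lim[unfolded eq]])
qed

section \<open>Frequencies, eigenfunctions and alternating cosine series\<close>

lemma bfreq_Suc: "bfreq (Suc n) = (real n + 1/2) * pi"
  by (simp add: bfreq_def)

lemma bfreq_ge: "real n + 1 \<le> bfreq (Suc n)"
proof -
  have "(real n + 1) * 1 \<le> (real n + 1) * (pi / 2)"
    using pi_ge_two by (intro mult_left_mono) auto
  also have "\<dots> \<le> bfreq (Suc n)"
    by (simp add: bfreq_Suc algebra_simps)
  finally show ?thesis by simp
qed

lemma bfreq_pos: "0 < bfreq (Suc n)" and bfreq_ge_1: "1 \<le> bfreq (Suc n)"
  using bfreq_ge[of n] by linarith+

lemma cos_bfreq: "cos (bfreq (Suc n)) = 0" and sin_bfreq: "sin (bfreq (Suc n)) = (-1) ^ n"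
proof -
  have eq: "bfreq (Suc n) = real n * pi + pi / 2" by (simp add: bfreq_Suc algebra_simps)
  show "cos (bfreq (Suc n)) = 0" "sin (bfreq (Suc n)) = (-1) ^ n"
    unfolding eq by (simp_all add: cos_add sin_add)
qed

lemma summable_inverse_bfreq_squared: "summable (\<lambda>n. 1 / (bfreq (Suc n))\<^sup>2)"
proof (rule summable_comparison_test')
  show "summable (\<lambda>n. 1 / (real n + 1)\<^sup>2)"
    using sums_summable[OF inverse_squares_sums] by (simp add: add.commute)
  show "norm (1 / (bfreq (Suc n))\<^sup>2) \<le> 1 / (real n + 1)\<^sup>2" for n
    using bfreq_ge[of n] by (simp add: frac_le power_mono)
qed

lemma abs_efun_le: "\<bar>efun n x\<bar> \<le> sqrt 2"
  unfolding efun_def abs_mult by (simp add: mult_left_le)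

lemma efun_squared_le: "(efun n x)\<^sup>2 \<le> 2"
  using power_mono[OF abs_efun_le[of n x], of 2] by simp

text \<open>Multiplication by \<open>2 * cos (pi * x / 2)\<close> turns the sum into a telescoping one. The factor is
  positive for \<open>x < 1\<close> and vanishes at \<open>x = 1\<close>, where the boundary datum \<open>g\<close> is imposed.\<close>

lemma alternating_cosine_partial_sums_bounded:
  assumes "0 \<le> x" "x < 1"
  shows "\<bar>\<Sum>i<n. (-1) ^ i * cos (bfreq (Suc i) * x)\<bar> \<le> 1 / cos (pi * x / 2)"
proof -
  have pos: "0 < cos (pi * x / 2)"
    using assms by (intro cos_gt_zero_pi) (auto intro: order_less_le_trans[of _ 0])
  have "2 * cos (pi * x / 2) * (\<Sum>i<n. (-1) ^ i * cos (bfreq (Suc i) * x))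
      = 1 - (-1) ^ n * cos (real n * pi * x)"
  proof (induction n)
    case (Suc n)
    have "2 * cos (pi * x / 2) * cos (bfreq (Suc n) * x)
        = cos (pi * x / 2 + bfreq (Suc n) * x) + cos (pi * x / 2 - bfreq (Suc n) * x)"
      by (simp add: cos_add cos_diff)
    also have "pi * x / 2 + bfreq (Suc n) * x = real (Suc n) * pi * x"
      by (simp add: bfreq_Suc algebra_simps)
    also have "pi * x / 2 - bfreq (Suc n) * x = - (real n * pi * x)"
      by (simp add: bfreq_Suc algebra_simps)
    finally have "2 * cos (pi * x / 2) * ((-1) ^ n * cos (bfreq (Suc n) * x))
        = (-1) ^ n * (cos (real (Suc n) * pi * x) + cos (real n * pi * x))"
      by (simp add: mult.left_commute)
    with Suc show ?case by (simp add: distrib_left)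
  qed simp
  from arg_cong[OF this, of abs]
  have "2 * cos (pi * x / 2) * \<bar>\<Sum>i<n. (-1) ^ i * cos (bfreq (Suc i) * x)\<bar>
      = \<bar>1 - (-1) ^ n * cos (real n * pi * x)\<bar>"
    using pos by (simp only: abs_mult abs_of_pos abs_numeral)
  also have "\<dots> \<le> 2"
  proof -
    have "\<bar>(-1) ^ n * cos (real n * pi * x)\<bar> \<le> 1" by (simp add: abs_mult)
    then show ?thesis by linarith
  qed
  finally show ?thesis using pos by (simp add: field_simps)
qed

text \<open>Dirichlet's test with a parameter: summation by parts replaces the conditionally convergent
  series by an absolutely convergent one.\<close>

lemma uniformly_convergent_dirichlet:
  fixes c :: "nat \<Rightarrow> real" and d :: "nat \<Rightarrow> 'a \<Rightarrow> real"
  assumes c: "\<And>n. \<bar>\<Sum>i<n. c i\<bar> \<le> A"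
    and d: "\<And>n t. t \<in> S \<Longrightarrow> \<bar>d n t\<bar> \<le> \<delta> n" and \<delta>: "\<delta> \<longlonglongrightarrow> 0"
    and var: "\<And>n t. t \<in> S \<Longrightarrow> \<bar>d (Suc n) t - d n t\<bar> \<le> \<epsilon> n" and \<epsilon>: "summable \<epsilon>"
  shows "uniformly_convergent_on S (\<lambda>n t. \<Sum>i<n. c i * d i t)"
proof -
  have A: "0 \<le> A" using c[of 0] by simp
  have parts: "(\<Sum>i<n. c i * d i t)
      = (\<Sum>i<n. c i) * d n t - (\<Sum>i<n. (\<Sum>j<Suc i. c j) * (d (Suc i) t - d i t))" for n t
    by (induction n) (simp_all add: algebra_simps)
  have "uniform_limit S (\<lambda>n t. (\<Sum>i<n. c i) * d n t) (\<lambda>_. 0) sequentially"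
  proof (rule uniform_limitI)
    fix e :: real assume "e > 0"
    have "(\<lambda>n. A * \<delta> n) \<longlonglongrightarrow> A * 0" by (intro tendsto_intros \<delta>)
    then have "\<forall>\<^sub>F n in sequentially. A * \<delta> n < e"
      using \<open>e > 0\<close> by (intro order_tendstoD(2)[of _ "A * 0"]) auto
    then show "\<forall>\<^sub>F n in sequentially. \<forall>t\<in>S. dist ((\<Sum>i<n. c i) * d n t) 0 < e"
    proof eventually_elim
      case (elim n)
      have "\<bar>(\<Sum>i<n. c i) * d n t\<bar> \<le> A * \<delta> n" if "t \<in> S" for t
        unfolding abs_mult using c[of n] d[OF that, of n] A by (intro mult_mono) auto
      then show ?case using elim by (auto intro: le_less_trans)
    qed
  qed
  moreover have "uniformly_convergent_on S (\<lambda>n t. \<Sum>i<n. (\<Sum>j<Suc i. c j) * (d (Suc i) t - d i t))"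
  proof (rule Weierstrass_m_test'_ev[where M = "\<lambda>n. A * \<epsilon> n"])
    show "\<forall>\<^sub>F n in sequentially. \<forall>t\<in>S. norm ((\<Sum>j<Suc n. c j) * (d (Suc n) t - d n t)) \<le> A * \<epsilon> n"
    proof (intro always_eventually allI ballI)
      fix n t assume "t \<in> S"
      then show "norm ((\<Sum>j<Suc n. c j) * (d (Suc n) t - d n t)) \<le> A * \<epsilon> n"
        unfolding real_norm_def abs_mult using c[of "Suc n"] var[of t n] A by (intro mult_mono) auto
    qed
    show "summable (\<lambda>n. A * \<epsilon> n)" using \<epsilon> by (rule summable_mult)
  qed
  ultimately show ?thesis
    unfolding parts by (rule uniformly_convergent_minus[OF uniformly_convergentI])
qed

section \<open>Duhamel integrals along the spectrum\<close>

text \<open>The solution of \<open>y' = l * y + \<phi>\<close> with \<open>y 0 = 0\<close>. Every spectral coefficient of the mean and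
  of the variance is an exponential plus such terms.\<close>

definition duhamel :: "real \<Rightarrow> (real \<Rightarrow> real) \<Rightarrow> real \<Rightarrow> real"
  where "duhamel l \<phi> t = integral {0..t} (\<lambda>s. exp (l * (t - s)) * \<phi> s)"

lemma duhamel_has_derivative:
  assumes cont: "continuous_on {0..} \<phi>" and t: "t \<in> {0..R}"
  shows "(duhamel l \<phi> has_real_derivative l * duhamel l \<phi> t + \<phi> t) (at t within {0..R})"
proof -
  have fac: "duhamel l \<phi> r = exp (l * r) * integral {0..r} (\<lambda>s. exp (- l * s) * \<phi> s)" for r
  proof -
    have "(\<lambda>s. exp (l * (r - s)) * \<phi> s) = (\<lambda>s. exp (l * r) * (exp (- l * s) * \<phi> s))"
      by (simp add: fun_eq_iff right_diff_distrib exp_diff exp_minus field_simps)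
    then show ?thesis unfolding duhamel_def by simp
  qed
  have c: "continuous_on {0..R} (\<lambda>s. exp (- l * s) * \<phi> s)"
    by (intro continuous_intros continuous_on_subset[OF cont]) auto
  have D: "((\<lambda>r. exp (l * r) * integral {0..r} (\<lambda>s. exp (- l * s) * \<phi> s)) has_real_derivative
      l * exp (l * t) * integral {0..t} (\<lambda>s. exp (- l * s) * \<phi> s) + exp (l * t) * (exp (- l * t) * \<phi> t))
      (at t within {0..R})"
    using integral_has_real_derivative[OF c t] by (auto intro!: derivative_eq_intros)
  have e: "exp (l * t) * (exp (- l * t) * \<phi> t) = \<phi> t"
    by (simp add: exp_minus)
  show ?thesis
    using D[unfolded e] unfolding fac[abs_def] by (simp add: mult.assoc)
qed

text \<open>Trades the factor \<open>l\<close>, which is unbounded along the spectrum, for a derivative of \<open>\<phi>\<close>.\<close>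

lemma duhamel_integrate_by_parts:
  assumes \<phi>: "\<And>s. 0 \<le> s \<Longrightarrow> (\<phi> has_real_derivative \<phi>' s) (at s within {0..})"
    and \<phi>': "continuous_on {0..} \<phi>'" and t: "0 \<le> t"
  shows "duhamel l \<phi>' t = \<phi> t - exp (l * t) * \<phi> 0 + l * duhamel l \<phi> t"
proof -
  have cont: "continuous_on {0..} \<phi>"
    using \<phi> by (intro DERIV_continuous_on) auto
  have "((\<lambda>s. exp (l * (t - s)) * \<phi>' s - l * (exp (l * (t - s)) * \<phi> s)) has_integral
      exp (l * (t - t)) * \<phi> t - exp (l * (t - 0)) * \<phi> 0) {0..t}"
  proof (rule fundamental_theorem_of_calculus[OF t])
    fix s assume s: "s \<in> {0..t}"
    have "(\<phi> has_real_derivative \<phi>' s) (at s within {0..t})"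
      using s by (intro DERIV_subset[OF \<phi>]) auto
    then have "((\<lambda>s. exp (l * (t - s)) * \<phi> s) has_real_derivative
        exp (l * (t - s)) * \<phi>' s - l * (exp (l * (t - s)) * \<phi> s)) (at s within {0..t})"
      by (auto intro!: derivative_eq_intros)
    then show "((\<lambda>s. exp (l * (t - s)) * \<phi> s) has_vector_derivative
        exp (l * (t - s)) * \<phi>' s - l * (exp (l * (t - s)) * \<phi> s)) (at s within {0..t})"
      by (simp add: has_real_derivative_iff_has_vector_derivative)
  qed
  then have "integral {0..t} (\<lambda>s. exp (l * (t - s)) * \<phi>' s - l * (exp (l * (t - s)) * \<phi> s))
      = \<phi> t - exp (l * t) * \<phi> 0" by (simp add: integral_unique)
  moreover have "(\<lambda>s. exp (l * (t - s)) * \<phi>' s) integrable_on {0..t}"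
    "(\<lambda>s. l * (exp (l * (t - s)) * \<phi> s)) integrable_on {0..t}"
    by (auto intro!: integrable_continuous_real continuous_intros
          continuous_on_subset[OF \<phi>'] continuous_on_subset[OF cont])
  ultimately show ?thesis
    unfolding duhamel_def by (subst (asm) integral_diff) auto
qed

text \<open>The kernel is dominated by the derivative of an explicit \<open>G\<close>; this keeps the integrals of
  the exponentials below elementary.\<close>

lemma convolution_integral_bound:
  fixes \<kappa> \<kappa>' G \<phi> :: "real \<Rightarrow> real"
  assumes t: "0 \<le> t" and \<phi>: "continuous_on {0..t} \<phi>" "\<And>s. s \<in> {0..t} \<Longrightarrow> \<bar>\<phi> s\<bar> \<le> C"
    and \<kappa>: "continuous_on {0..t} \<kappa>" "\<And>r. r \<in> {0..t} \<Longrightarrow> \<bar>\<kappa> r\<bar> \<le> \<kappa>' r"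
    and G: "\<And>r. (G has_real_derivative \<kappa>' r) (at r)" and B: "G t - G 0 \<le> B"
  shows "\<bar>integral {0..t} (\<lambda>s. \<kappa> (t - s) * \<phi> s)\<bar> \<le> C * B"
proof -
  have C: "0 \<le> C" using \<phi>(2)[of 0] t by force
  have "((\<lambda>s. \<kappa>' (t - s) * C) has_integral (- (G (t - t) * C) - - (G (t - 0) * C))) {0..t}"
  proof (rule fundamental_theorem_of_calculus[OF t])
    fix s assume s: "s \<in> {0..t}"
    have "((\<lambda>s. G (t - s)) has_real_derivative \<kappa>' (t - s) * (-1)) (at s within {0..t})"
      by (rule DERIV_chain2[OF G]) (auto intro!: derivative_eq_intros)
    then have "((\<lambda>s. - (G (t - s) * C)) has_real_derivative \<kappa>' (t - s) * C) (at s within {0..t})"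
      by (auto intro!: derivative_eq_intros)
    then show "((\<lambda>s. - (G (t - s) * C)) has_vector_derivative \<kappa>' (t - s) * C) (at s within {0..t})"
      by (simp add: has_real_derivative_iff_has_vector_derivative)
  qed
  then have hi: "((\<lambda>s. \<kappa>' (t - s) * C) has_integral (G t - G 0) * C) {0..t}"
    by (simp add: algebra_simps)
  have "norm (integral {0..t} (\<lambda>s. \<kappa> (t - s) * \<phi> s)) \<le> integral {0..t} (\<lambda>s. \<kappa>' (t - s) * C)"
  proof (rule integral_norm_bound_integral)
    have "continuous_on {0..t} (\<lambda>s. \<kappa> (t - s))"
      by (rule continuous_on_compose2[OF \<kappa>(1)]) (auto intro!: continuous_intros)
    then show "(\<lambda>s. \<kappa> (t - s) * \<phi> s) integrable_on {0..t}"
      by (intro integrable_continuous_real continuous_on_mult \<phi>)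
    show "(\<lambda>s. \<kappa>' (t - s) * C) integrable_on {0..t}" using hi by blast
    fix s assume s: "s \<in> {0..t}"
    have k: "\<bar>\<kappa> (t - s)\<bar> \<le> \<kappa>' (t - s)" using s by (intro \<kappa>(2)) auto
    then show "norm (\<kappa> (t - s) * \<phi> s) \<le> \<kappa>' (t - s) * C"
      unfolding real_norm_def abs_mult using \<phi>(2)[OF s] by (intro mult_mono) auto
  qed
  also have "\<dots> = (G t - G 0) * C" using hi by (rule integral_unique)
  also have "\<dots> \<le> B * C" using B C by (rule mult_right_mono)
  finally show ?thesis by (simp add: mult.commute)
qed

text \<open>Separates the bounded part \<open>B\<close> of a rate, of either sign, from the decay rate \<open>c\<close>, so that
  the finitely many nonnegative eigenvalues need no separate treatment.\<close>

lemma exp_drift_bound: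
  fixes B c r R :: real
  assumes "r \<in> {0..R}"
  shows "exp ((B - c) * r) \<le> exp (\<bar>B\<bar> * R) * exp (- (c * r))"
proof -
  have "B * r \<le> \<bar>B\<bar> * R" using assms by (intro mult_mono) auto
  then show ?thesis by (simp add: exp_add[symmetric] algebra_simps)
qed

lemma duhamel_bound:
  assumes cont: "continuous_on {0..} \<phi>" and C: "\<And>s. s \<in> {0..R} \<Longrightarrow> \<bar>\<phi> s\<bar> \<le> C"
    and c: "0 < c" and t: "t \<in> {0..R}"
  shows "\<bar>duhamel (B - c) \<phi> t\<bar> \<le> C * (exp (\<bar>B\<bar> * R) / c)"
  unfolding duhamel_def
proof (rule convolution_integral_bound[where
      \<kappa> = "\<lambda>r. exp ((B - c) * r)" and \<kappa>' = "\<lambda>r. exp (\<bar>B\<bar> * R) * exp (- (c * r))"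
      and G = "\<lambda>r. - (exp (\<bar>B\<bar> * R) * exp (- (c * r)) / c)"])
  show "((\<lambda>r. - (exp (\<bar>B\<bar> * R) * exp (- (c * r)) / c)) has_real_derivative
      exp (\<bar>B\<bar> * R) * exp (- (c * r))) (at r)" for r
    using c by (auto intro!: derivative_eq_intros)
  show "- (exp (\<bar>B\<bar> * R) * exp (- (c * t)) / c) - - (exp (\<bar>B\<bar> * R) * exp (- (c * 0)) / c)
      \<le> exp (\<bar>B\<bar> * R) / c"
    using c by simp
  show "\<bar>exp ((B - c) * r)\<bar> \<le> exp (\<bar>B\<bar> * R) * exp (- (c * r))" if "r \<in> {0..t}" for r
    using exp_drift_bound[of r R B c] that t by simp
qed (use t C in \<open>auto intro!: continuous_intros continuous_on_subset[OF cont]\<close>)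

text \<open>For a fixed time \<open>u\<close> the map \<open>p \<mapsto> p * exp (- A * p\<^sup>2 * u)\<close> has a total variation of order
  \<open>1 / sqrt u\<close>, which is not bounded as \<open>u\<close> tends to \<open>0\<close>. Integrating over \<open>u\<close> before summing over
  frequencies avoids this: the variation between neighbouring frequencies becomes of order
  \<open>1 / p\<^sup>2\<close>, which is summable.\<close>

lemma duhamel_frequency_variation:
  assumes cont: "continuous_on {0..} \<phi>" and C: "\<And>s. s \<in> {0..R} \<Longrightarrow> \<bar>\<phi> s\<bar> \<le> C"
    and A: "0 < A" and p: "0 < p" "p \<le> r" and t: "t \<in> {0..R}"
  shows "\<bar>r * duhamel (B - A * r\<^sup>2) \<phi> t - p * duhamel (B - A * p\<^sup>2) \<phi> t\<bar>
      \<le> C * (exp (\<bar>B\<bar> * R) * (3 * (r - p) / (A * p\<^sup>2)))"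
proof -
  let ?E = "exp (\<bar>B\<bar> * R)"
  let ?k = "\<lambda>u. r * exp ((B - A * r\<^sup>2) * u) - p * exp ((B - A * p\<^sup>2) * u)"
  let ?k' = "\<lambda>u. ?E * ((r - p) * exp (- (A * r\<^sup>2 * u)) + p * (exp (- (A * p\<^sup>2 * u)) - exp (- (A * r\<^sup>2 * u))))"
  let ?G = "\<lambda>u. ?E * (- ((r - p) * exp (- (A * r\<^sup>2 * u)) / (A * r\<^sup>2))
      + p * (- (exp (- (A * p\<^sup>2 * u)) / (A * p\<^sup>2)) + exp (- (A * r\<^sup>2 * u)) / (A * r\<^sup>2)))"
  have r: "0 < r" and sq: "p\<^sup>2 \<le> r\<^sup>2" using p by (auto intro: power_mono)
  have "\<bar>integral {0..t} (\<lambda>s. ?k (t - s) * \<phi> s)\<bar> \<le> C * (?E * (3 * (r - p) / (A * p\<^sup>2)))"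
  proof (rule convolution_integral_bound[where \<kappa>' = ?k' and G = ?G])
    show "(?G has_real_derivative ?k' u) (at u)" for u
      using A p r by (auto intro!: derivative_eq_intros)
    show "\<bar>?k u\<bar> \<le> ?k' u" if u: "u \<in> {0..t}" for u
    proof -
      have uR: "u \<in> {0..R}" using u t by auto
      define P where "P = exp (- (A * p\<^sup>2 * u))"
      define Q where "Q = exp (- (A * r\<^sup>2 * u))"
      have PQ: "Q \<le> P" "0 < Q" using A sq u by (auto simp: P_def Q_def intro!: mult_right_mono mult_left_mono)
      have "B * u \<le> \<bar>B\<bar> * R" using uR by (intro mult_mono) auto
      then have Bu: "exp (B * u) \<le> ?E" by simp
      have "?k u = exp (B * u) * (r * Q - p * P)"
        by (simp add: P_def Q_def exp_add[symmetric] right_diff_distrib left_diff_distrib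
              mult.left_commute[of "exp (B * u)"] exp_diff exp_minus field_simps)
      also have "\<bar>\<dots>\<bar> = exp (B * u) * \<bar>(r - p) * Q - p * (P - Q)\<bar>"
      proof -
        have "r * Q - p * P = (r - p) * Q - p * (P - Q)" by (simp add: algebra_simps)
        then show ?thesis by (simp only: abs_mult abs_exp_cancel)
      qed
      also have "\<dots> \<le> exp (B * u) * ((r - p) * Q + p * (P - Q))"
        using p PQ by (intro mult_left_mono order_trans[OF abs_triangle_ineq4]) (auto simp: abs_mult)
      also have "\<dots> \<le> ?E * ((r - p) * Q + p * (P - Q))"
        using p PQ Bu by (intro mult_right_mono) auto
      finally show ?thesis by (simp add: P_def Q_def)
    qed
    show "?G t - ?G 0 \<le> ?E * (3 * (r - p) / (A * p\<^sup>2))"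
    proof -
      have "?G t - ?G 0 \<le> ?E * ((r - p) / (A * r\<^sup>2) + p * (1 / (A * p\<^sup>2) - 1 / (A * r\<^sup>2)))"
      proof -
        have "exp (- (A * r\<^sup>2 * t)) / (A * r\<^sup>2) \<le> exp (- (A * p\<^sup>2 * t)) / (A * p\<^sup>2)"
          using A p sq t by (intro frac_le) (auto intro!: mult_right_mono mult_left_mono)
        then have "p * (- (exp (- (A * p\<^sup>2 * t)) / (A * p\<^sup>2)) + exp (- (A * r\<^sup>2 * t)) / (A * r\<^sup>2)) \<le> 0"
          using p by (intro mult_nonneg_nonpos) auto
        moreover have "0 \<le> (r - p) * exp (- (A * r\<^sup>2 * t)) / (A * r\<^sup>2)" using A p by simp
        ultimately show ?thesis
          unfolding right_diff_distrib[symmetric] by (intro mult_left_mono) (auto simp: algebra_simps)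
      qed
      also have "\<dots> \<le> ?E * (3 * (r - p) / (A * p\<^sup>2))"
      proof (intro mult_left_mono)
        have "(r - p) / (A * r\<^sup>2) + p * (1 / (A * p\<^sup>2) - 1 / (A * r\<^sup>2)) = (r - p) * (2 * p + r) / (A * p * r\<^sup>2)"
          using A p r by (simp add: field_simps power2_eq_square)
        also have "\<dots> \<le> (r - p) * (3 * r) / (A * p * r\<^sup>2)"
          using A p r by (intro divide_right_mono mult_left_mono) auto
        also have "\<dots> = 3 * (r - p) / (A * (p * r))"
          using A p r by (simp add: field_simps power2_eq_square)
        also have "\<dots> \<le> 3 * (r - p) / (A * p\<^sup>2)"
          using A p r by (intro divide_left_mono mult_left_mono) (auto simp: power2_eq_square)
        finally show "(r - p) / (A * r\<^sup>2) + p * (1 / (A * p\<^sup>2) - 1 / (A * r\<^sup>2)) \<le> 3 * (r - p) / (A * p\<^sup>2)" .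
      qed simp
      finally show ?thesis .
    qed
  qed (use t C in \<open>auto intro!: continuous_intros continuous_on_subset[OF cont]\<close>)
  moreover have "integral {0..t} (\<lambda>s. ?k (t - s) * \<phi> s)
      = r * duhamel (B - A * r\<^sup>2) \<phi> t - p * duhamel (B - A * p\<^sup>2) \<phi> t"
  proof -
    have i: "(\<lambda>s. exp (l * (t - s)) * \<phi> s) integrable_on {0..t}" for l
      by (intro integrable_continuous_real continuous_intros continuous_on_subset[OF cont]) auto
    have "(\<lambda>s. ?k (t - s) * \<phi> s) = (\<lambda>s. r * (exp ((B - A * r\<^sup>2) * (t - s)) * \<phi> s)
        - p * (exp ((B - A * p\<^sup>2) * (t - s)) * \<phi> s))"
      by (simp add: fun_eq_iff left_diff_distrib mult.assoc)
    then show ?thesis unfolding duhamel_def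
      using i by (simp add: integral_diff integrable_on_mult_right_iff integrable_on_mult_right)
  qed
  ultimately show ?thesis by simp
qed

lemma uniformly_convergent_duhamel_series:
  assumes A: "0 < A" and w: "\<And>n. \<bar>w n\<bar> \<le> W"
    and cont: "\<And>n. continuous_on {0..} (\<phi> n)" and C: "\<And>n s. s \<in> {0..R} \<Longrightarrow> \<bar>\<phi> n s\<bar> \<le> C"
  shows "uniformly_convergent_on {0..R}
    (\<lambda>N t. \<Sum>n<N. w n * duhamel (B - A * (bfreq (Suc n))\<^sup>2) (\<phi> n) t)"
proof (rule Weierstrass_m_test'_ev[where M = "\<lambda>n. (W * C * exp (\<bar>B\<bar> * R) / A) * (1 / (bfreq (Suc n))\<^sup>2)"])
  show "summable (\<lambda>n. (W * C * exp (\<bar>B\<bar> * R) / A) * (1 / (bfreq (Suc n))\<^sup>2))"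
    by (intro summable_mult summable_inverse_bfreq_squared)
  show "\<forall>\<^sub>F n in sequentially. \<forall>t\<in>{0..R}. norm (w n * duhamel (B - A * (bfreq (Suc n))\<^sup>2) (\<phi> n) t)
      \<le> (W * C * exp (\<bar>B\<bar> * R) / A) * (1 / (bfreq (Suc n))\<^sup>2)"
  proof (intro always_eventually allI ballI)
    fix n t assume t: "t \<in> {0..R}"
    have "norm (w n * duhamel (B - A * (bfreq (Suc n))\<^sup>2) (\<phi> n) t)
        \<le> W * (C * (exp (\<bar>B\<bar> * R) / (A * (bfreq (Suc n))\<^sup>2)))"
      unfolding real_norm_def abs_mult
      using w[of n] duhamel_bound[OF cont[of n] C _ t, of "A * (bfreq (Suc n))\<^sup>2" B] A bfreq_pos[of n]
      by (intro mult_mono) (auto intro: order_trans[OF abs_ge_zero])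
    then show "norm (w n * duhamel (B - A * (bfreq (Suc n))\<^sup>2) (\<phi> n) t)
        \<le> (W * C * exp (\<bar>B\<bar> * R) / A) * (1 / (bfreq (Suc n))\<^sup>2)" by simp
  qed
qed

text \<open>The terms are only of order \<open>1 / n\<close>, so convergence comes from the oscillation of the
  coefficients. The rate degenerates as \<open>x\<close> tends to \<open>1\<close>.\<close>

lemma uniformly_convergent_boundary_series:
  assumes A: "0 < A" and x: "0 \<le> x" "x < 1" and cont: "continuous_on {0..} \<phi>"
  shows "uniformly_convergent_on {0..R} (\<lambda>N t. \<Sum>n<N. ((-1) ^ n * cos (bfreq (Suc n) * x))
      * (bfreq (Suc n) * duhamel (B - A * (bfreq (Suc n))\<^sup>2) \<phi> t))"
proof -
  have "bounded (\<phi> ` {0..R})"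
    by (intro compact_imp_bounded compact_continuous_image continuous_on_subset[OF cont]) auto
  then obtain C where C: "\<And>s. s \<in> {0..R} \<Longrightarrow> \<bar>\<phi> s\<bar> \<le> C"
    unfolding bounded_iff real_norm_def by blast
  show ?thesis
  proof (rule uniformly_convergent_dirichlet[OF alternating_cosine_partial_sums_bounded[OF x]])
    show "(\<lambda>n. (C * exp (\<bar>B\<bar> * R) / A) * (1 / (real n + 1))) \<longlonglongrightarrow> 0"
      using tendsto_mult_left[OF LIMSEQ_inverse_real_of_nat, of "C * exp (\<bar>B\<bar> * R) / A"]
      by (simp add: inverse_eq_divide add.commute)
    show "summable (\<lambda>n. (C * exp (\<bar>B\<bar> * R) * 3 * pi / A) * (1 / (bfreq (Suc n))\<^sup>2))"
      by (intro summable_mult summable_inverse_bfreq_squared)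
    fix n t assume t: "t \<in> {0..R}"
    let ?p = "bfreq (Suc n)" and ?r = "bfreq (Suc (Suc n))"
    have C0: "0 \<le> C" using C[OF t] by linarith
    have "\<bar>?p * duhamel (B - A * ?p\<^sup>2) \<phi> t\<bar> \<le> ?p * (C * (exp (\<bar>B\<bar> * R) / (A * ?p\<^sup>2)))"
    proof -
      have "\<bar>duhamel (B - A * ?p\<^sup>2) \<phi> t\<bar> \<le> C * (exp (\<bar>B\<bar> * R) / (A * ?p\<^sup>2))"
        using A bfreq_pos[of n] by (intro duhamel_bound[OF cont C _ t]) auto
      then show ?thesis
        unfolding abs_mult abs_of_pos[OF bfreq_pos] by (rule mult_left_mono[OF _ less_imp_le[OF bfreq_pos]])
    qed
    also have "\<dots> = (C * exp (\<bar>B\<bar> * R) / A) * (1 / ?p)"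
      using bfreq_pos[of n] by (simp add: power2_eq_square)
    also have "\<dots> \<le> (C * exp (\<bar>B\<bar> * R) / A) * (1 / (real n + 1))"
      using bfreq_ge[of n] C0 A by (intro mult_left_mono divide_left_mono) auto
    finally show "\<bar>?p * duhamel (B - A * ?p\<^sup>2) \<phi> t\<bar> \<le> (C * exp (\<bar>B\<bar> * R) / A) * (1 / (real n + 1))" .
    have step: "?r - ?p = pi" by (simp add: bfreq_Suc algebra_simps)
    then have le: "?p \<le> ?r" using pi_gt_zero by linarith
    show "\<bar>?r * duhamel (B - A * ?r\<^sup>2) \<phi> t - ?p * duhamel (B - A * ?p\<^sup>2) \<phi> t\<bar>
        \<le> (C * exp (\<bar>B\<bar> * R) * 3 * pi / A) * (1 / ?p\<^sup>2)"
      using duhamel_frequency_variation[OF cont C A bfreq_pos le t, of B] by (simp add: step)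
  qed
qed

text \<open>Away from time \<open>0\<close> the exponential beats every power of the frequency; gaining two powers
  beyond the factor \<open>p\<^sup>2\<close> is enough for summability.\<close>

lemma exp_smoothing_bound:
  fixes p :: real
  assumes A: "0 < A" and \<delta>: "0 < \<delta>" and p: "0 < p" and t: "t \<in> {\<delta>..R}"
  shows "p\<^sup>2 * exp ((B - A * p\<^sup>2) * t) \<le> (exp (\<bar>B\<bar> * R) * 2 / (A * \<delta>)\<^sup>2) * (1 / p\<^sup>2)"
proof -
  define z where "z = A * p\<^sup>2 * \<delta>"
  have z: "0 < z" using A \<delta> p by (simp add: z_def)
  have "exp ((B - A * p\<^sup>2) * t) \<le> exp (\<bar>B\<bar> * R) * exp (- (A * p\<^sup>2 * t))"
    using t \<delta> by (intro exp_drift_bound) auto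
  also have "\<dots> \<le> exp (\<bar>B\<bar> * R) * exp (- z)"
    using t A by (auto simp: z_def intro!: mult_left_mono)
  also have "\<dots> \<le> exp (\<bar>B\<bar> * R) * (2 / z\<^sup>2)"
  proof (intro mult_left_mono)
    have "z\<^sup>2 / 2 \<le> exp z"
      using exp_lower_Taylor_quadratic[of z] z by linarith
    then have "1 / exp z \<le> 1 / (z\<^sup>2 / 2)" using z by (intro divide_left_mono) auto
    then show "exp (- z) \<le> 2 / z\<^sup>2" by (simp add: exp_minus inverse_eq_divide)
  qed simp
  finally have "p\<^sup>2 * exp ((B - A * p\<^sup>2) * t) \<le> p\<^sup>2 * (exp (\<bar>B\<bar> * R) * (2 / z\<^sup>2))"
    by (rule mult_left_mono) simp
  also have "\<dots> = (exp (\<bar>B\<bar> * R) * 2 / (A * \<delta>)\<^sup>2) * (1 / p\<^sup>2)"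
    using A \<delta> p by (simp add: z_def field_simps power2_eq_square)
  finally show ?thesis .
qed

text \<open>The time \<open>\<theta> y\<close> is a function of the parameter, so that the same statement gives uniformity in
  time and uniformity in space.\<close>

lemma uniformly_convergent_smoothed_series:
  assumes A: "0 < A" and \<delta>: "0 < \<delta>" and \<theta>: "\<And>y. y \<in> S \<Longrightarrow> \<theta> y \<in> {\<delta>..R}"
    and w: "\<And>n y. y \<in> S \<Longrightarrow> \<bar>w n y\<bar> \<le> W * (bfreq (Suc n))\<^sup>2"
  shows "uniformly_convergent_on S (\<lambda>N y. \<Sum>n<N. w n y * exp ((B - A * (bfreq (Suc n))\<^sup>2) * \<theta> y))"
proof (rule Weierstrass_m_test'_ev[where
      M = "\<lambda>n. (\<bar>W\<bar> * (exp (\<bar>B\<bar> * R) * 2 / (A * \<delta>)\<^sup>2)) * (1 / (bfreq (Suc n))\<^sup>2)"])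
  show "summable (\<lambda>n. (\<bar>W\<bar> * (exp (\<bar>B\<bar> * R) * 2 / (A * \<delta>)\<^sup>2)) * (1 / (bfreq (Suc n))\<^sup>2))"
    by (intro summable_mult summable_inverse_bfreq_squared)
  show "\<forall>\<^sub>F n in sequentially. \<forall>y\<in>S. norm (w n y * exp ((B - A * (bfreq (Suc n))\<^sup>2) * \<theta> y))
      \<le> (\<bar>W\<bar> * (exp (\<bar>B\<bar> * R) * 2 / (A * \<delta>)\<^sup>2)) * (1 / (bfreq (Suc n))\<^sup>2)"
  proof (intro always_eventually allI ballI)
    fix n y assume y: "y \<in> S"
    let ?p = "bfreq (Suc n)"
    have "norm (w n y * exp ((B - A * ?p\<^sup>2) * \<theta> y)) \<le> (\<bar>W\<bar> * ?p\<^sup>2) * exp ((B - A * ?p\<^sup>2) * \<theta> y)"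
    proof -
      have "\<bar>w n y\<bar> \<le> \<bar>W\<bar> * ?p\<^sup>2"
        using w[OF y, of n] by (rule order_trans) (simp add: mult_right_mono)
      then show ?thesis unfolding real_norm_def abs_mult by simp
    qed
    also have "\<dots> = \<bar>W\<bar> * (?p\<^sup>2 * exp ((B - A * ?p\<^sup>2) * \<theta> y))" by simp
    also have "\<dots> \<le> \<bar>W\<bar> * ((exp (\<bar>B\<bar> * R) * 2 / (A * \<delta>)\<^sup>2) * (1 / ?p\<^sup>2))"
      by (intro mult_left_mono exp_smoothing_bound[OF A \<delta> bfreq_pos \<theta>[OF y]]) simp
    finally show "norm (w n y * exp ((B - A * ?p\<^sup>2) * \<theta> y))
        \<le> (\<bar>W\<bar> * (exp (\<bar>B\<bar> * R) * 2 / (A * \<delta>)\<^sup>2)) * (1 / ?p\<^sup>2)" by simp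
  qed
qed

lemma uniformly_convergent_exponential_series:
  assumes A: "0 < A" and w: "summable (\<lambda>n. \<bar>w n\<bar>)"
  shows "uniformly_convergent_on {0..R} (\<lambda>N t. \<Sum>n<N. w n * exp ((B - A * (bfreq (Suc n))\<^sup>2) * t))"
proof (rule Weierstrass_m_test'_ev[where M = "\<lambda>n. \<bar>w n\<bar> * exp (\<bar>B\<bar> * R)"])
  show "summable (\<lambda>n. \<bar>w n\<bar> * exp (\<bar>B\<bar> * R))" by (intro summable_mult2 w)
  show "\<forall>\<^sub>F n in sequentially. \<forall>t\<in>{0..R}. norm (w n * exp ((B - A * (bfreq (Suc n))\<^sup>2) * t))
      \<le> \<bar>w n\<bar> * exp (\<bar>B\<bar> * R)"
  proof (intro always_eventually allI ballI)
    fix n t assume t: "t \<in> {0..R}"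
    have "exp ((B - A * (bfreq (Suc n))\<^sup>2) * t) \<le> exp (\<bar>B\<bar> * R) * exp (- (A * (bfreq (Suc n))\<^sup>2 * t))"
      using t by (rule exp_drift_bound)
    also have "\<dots> \<le> exp (\<bar>B\<bar> * R) * 1"
      using A t by (intro mult_left_mono) auto
    finally show "norm (w n * exp ((B - A * (bfreq (Suc n))\<^sup>2) * t)) \<le> \<bar>w n\<bar> * exp (\<bar>B\<bar> * R)"
      unfolding real_norm_def abs_mult by (intro mult_left_mono) auto
  qed
qed

section \<open>Spectral coefficients of the mean and the variance\<close>

lemma efun_Suc: "efun (Suc n) x = sqrt 2 * cos (bfreq (Suc n) * x)"
  by (simp add: efun_def)

lemma set_integrable_mult_efun:
  assumes "set_integrable lborel {0..1} \<phi>"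
  shows "set_integrable lborel {0..1} (\<lambda>x. \<phi> x * efun n x)"
  unfolding set_integrable_def
proof (rule Bochner_Integration.integrable_bound)
  show "integrable lborel (\<lambda>x. sqrt 2 * (indicator {0..1} x *\<^sub>R \<phi> x))"
    using assms unfolding set_integrable_def by simp
  have e: "efun n \<in> borel_measurable borel" unfolding efun_def[abs_def] by measurable
  have "(\<lambda>x. indicator {0..1} x *\<^sub>R \<phi> x) \<in> borel_measurable lborel"
    using assms unfolding set_integrable_def by (rule borel_measurable_integrable)
  with e have "(\<lambda>x. (indicator {0..1} x *\<^sub>R \<phi> x) * efun n x) \<in> borel_measurable lborel"
    by (intro borel_measurable_times) simp_all
  then show "(\<lambda>x. indicator {0..1} x *\<^sub>R (\<phi> x * efun n x)) \<in> borel_measurable lborel"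
    by (simp add: mult.assoc)
  show "AE x in lborel. norm (indicator {0..1} x *\<^sub>R (\<phi> x * efun n x))
      \<le> norm (sqrt 2 * (indicator {0..1} x *\<^sub>R \<phi> x))"
  proof (rule AE_I2)
    fix x :: real
    have "\<bar>\<phi> x\<bar> * \<bar>efun n x\<bar> \<le> \<bar>\<phi> x\<bar> * sqrt 2" by (intro mult_left_mono abs_efun_le) simp
    then show "norm (indicator {0..1} x *\<^sub>R (\<phi> x * efun n x))
        \<le> norm (sqrt 2 * (indicator {0..1} x *\<^sub>R \<phi> x))"
      by (simp add: abs_mult mult.commute split: split_indicator)
  qed
qed

lemma abs_inner01_efun_le:
  assumes \<phi>: "set_integrable lborel {0..1} \<phi>"
  shows "\<bar>inner01 \<phi> (efun n)\<bar> \<le> sqrt 2 * L1norm01 \<phi>"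
proof -
  have "\<bar>inner01 \<phi> (efun n)\<bar> \<le> (LINT x|lborel. \<bar>indicator {0..1} x *\<^sub>R (\<phi> x * efun n x)\<bar>)"
    unfolding inner01_def set_lebesgue_integral_def by (rule integral_abs_bound)
  also have "\<dots> \<le> (LINT x|lborel. sqrt 2 * (indicator {0..1} x *\<^sub>R \<bar>\<phi> x\<bar>))"
  proof (rule integral_mono)
    show "integrable lborel (\<lambda>x. \<bar>indicator {0..1} x *\<^sub>R (\<phi> x * efun n x)\<bar>)"
      using set_integrable_mult_efun[OF \<phi>] unfolding set_integrable_def by (rule integrable_abs)
    show "integrable lborel (\<lambda>x. sqrt 2 * (indicator {0..1} x *\<^sub>R \<bar>\<phi> x\<bar>))"
      using set_integrable_abs[OF \<phi>] unfolding set_integrable_def by simp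
    fix x :: real
    have "\<bar>\<phi> x\<bar> * \<bar>efun n x\<bar> \<le> \<bar>\<phi> x\<bar> * sqrt 2" by (intro mult_left_mono abs_efun_le) simp
    then show "\<bar>indicator {0..1} x *\<^sub>R (\<phi> x * efun n x)\<bar> \<le> sqrt 2 * (indicator {0..1} x *\<^sub>R \<bar>\<phi> x\<bar>)"
      by (simp add: abs_mult mult.commute split: split_indicator)
  qed
  also have "\<dots> = sqrt 2 * L1norm01 \<phi>"
    by (simp add: L1norm01_def set_lebesgue_integral_def)
  finally show ?thesis .
qed

lemma inner01_efun_add:
  assumes "set_integrable lborel {0..1} \<phi>" "set_integrable lborel {0..1} \<psi>"
  shows "inner01 (\<lambda>x. \<phi> x + \<psi> x) (efun n) = inner01 \<phi> (efun n) + inner01 \<psi> (efun n)"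
  unfolding inner01_def distrib_right
  by (intro set_integral_add set_integrable_mult_efun assms)

lemma inner01_efun_diff:
  assumes "set_integrable lborel {0..1} \<phi>" "set_integrable lborel {0..1} \<psi>"
  shows "inner01 (\<lambda>x. \<phi> x - \<psi> x) (efun n) = inner01 \<phi> (efun n) - inner01 \<psi> (efun n)"
  unfolding inner01_def left_diff_distrib
  by (intro set_integral_diff set_integrable_mult_efun assms)

lemma inner01_efun_divide: "inner01 (\<lambda>x. \<phi> x / c) (efun n) = inner01 \<phi> (efun n) / c"
  by (simp add: inner01_def)

text \<open>Evaluated with an explicit antiderivative. The coefficient of \<open>r\<close> decays like
  \<open>1 / bfreq (Suc n)\<close> only, because a nonzero constant violates the boundary condition at \<open>x = 1\<close>
  that the eigenfunctions satisfy.\<close>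

lemma inner01_affine_efun:
  "inner01 (\<lambda>x. p * (x - 1) + r) (efun (Suc n))
    = sqrt 2 * ((-1) ^ n * r / bfreq (Suc n) - p / (bfreq (Suc n))\<^sup>2)"
proof -
  let ?\<beta> = "bfreq (Suc n)"
  define G where "G x = sqrt 2 * ((p * (x - 1) + r) * sin (?\<beta> * x) / ?\<beta> + p * cos (?\<beta> * x) / ?\<beta>\<^sup>2)" for x
  have \<beta>: "?\<beta> \<noteq> 0" using bfreq_pos[of n] by simp
  have "inner01 (\<lambda>x. p * (x - 1) + r) (efun (Suc n)) = G 1 - G 0"
    unfolding inner01_def set_lebesgue_integral_def
  proof (rule integral_FTC_atLeastAtMost)
    fix x :: real assume "0 \<le> x" "x \<le> 1"
    have "(G has_real_derivative (p * (x - 1) + r) * efun (Suc n) x) (at x within {0..1})"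
      unfolding G_def[abs_def] efun_Suc using \<beta>
      by (auto intro!: derivative_eq_intros simp: field_simps power2_eq_square)
    then show "(G has_vector_derivative (p * (x - 1) + r) * efun (Suc n) x) (at x within {0..1})"
      by (simp add: has_real_derivative_iff_has_vector_derivative)
  qed (auto simp: efun_Suc[abs_def] intro!: continuous_intros)
  then show ?thesis
    by (simp add: G_def cos_bfreq sin_bfreq right_diff_distrib mult.commute)
qed

lemma L1norm01_triangle:
  assumes "set_integrable lborel {0..1} \<phi>" "set_integrable lborel {0..1} \<psi>"
  shows "L1norm01 \<phi> \<le> L1norm01 (\<lambda>x. \<phi> x - \<psi> x) + L1norm01 \<psi>"
proof -
  have "L1norm01 \<phi> \<le> (LINT x:{0..1}|lborel. \<bar>\<phi> x - \<psi> x\<bar> + \<bar>\<psi> x\<bar>)"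
    unfolding L1norm01_def
  proof (rule set_integral_mono)
    show "set_integrable lborel {0..1} (\<lambda>x. \<bar>\<phi> x\<bar>)"
      by (rule set_integrable_abs[OF assms(1)])
    show "set_integrable lborel {0..1} (\<lambda>x. \<bar>\<phi> x - \<psi> x\<bar> + \<bar>\<psi> x\<bar>)"
      by (intro set_integral_add(1) set_integrable_abs set_integral_diff(1) assms)
  qed linarith
  also have "\<dots> = L1norm01 (\<lambda>x. \<phi> x - \<psi> x) + L1norm01 \<psi>"
    unfolding L1norm01_def by (intro set_integral_add(2) set_integrable_abs set_integral_diff(1) assms)
  finally show ?thesis .
qed

lemma L1norm01_minus_commute: "L1norm01 (\<lambda>x. \<phi> x - \<psi> x) = L1norm01 (\<lambda>x. \<psi> x - \<phi> x)"
  by (simp add: L1norm01_def abs_minus_commute)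

text \<open>Testing against \<open>efun n\<close> is a linear functional on \<open>L\<^sup>1\<close> of norm at most \<open>sqrt 2\<close> for every
  \<open>n\<close>, so the regularity of \<open>f\<close> passes to its coefficients with bounds that are uniform in \<open>n\<close>.\<close>

lemma C1_L1_coefficients:
  assumes f: "C1_halfline_L1 f"
  obtains F' where
    "\<And>n t. 0 \<le> t \<Longrightarrow> ((\<lambda>s. inner01 (f s) (efun n)) has_real_derivative F' n t) (at t within {0..})"
    "\<And>n. continuous_on {0..} (F' n)"
    "\<And>R. \<exists>C. \<forall>n. \<forall>t\<in>{0..R}. \<bar>inner01 (f t) (efun n)\<bar> \<le> C \<and> \<bar>F' n t\<bar> \<le> C"
proof -
  have fi: "\<And>t. 0 \<le> t \<Longrightarrow> set_integrable lborel {0..1} (f t)"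
    using f by (simp add: C1_halfline_L1_def)
  obtain f' where f': "\<forall>t\<ge>0. set_integrable lborel {0..1} (f' t) \<and>
      ((\<lambda>s. L1norm01 (\<lambda>x. (f s x - f t x) / (s - t) - f' t x)) \<longlongrightarrow> 0) (at t within {0..}) \<and>
      ((\<lambda>s. L1norm01 (\<lambda>x. f' s x - f' t x)) \<longlongrightarrow> 0) (at t within {0..})"
    using f unfolding C1_halfline_L1_def by (elim conjE exE)
  have f'i: "\<And>t. 0 \<le> t \<Longrightarrow> set_integrable lborel {0..1} (f' t)"
    and fd: "\<And>t. 0 \<le> t \<Longrightarrow>
      ((\<lambda>s. L1norm01 (\<lambda>x. (f s x - f t x) / (s - t) - f' t x)) \<longlongrightarrow> 0) (at t within {0..})"
    and f'c: "\<And>t. 0 \<le> t \<Longrightarrow> ((\<lambda>s. L1norm01 (\<lambda>x. f' s x - f' t x)) \<longlongrightarrow> 0) (at t within {0..})"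
    using f' by simp_all
  define F' where "F' n t = inner01 (f' t) (efun n)" for n t
  have deriv: "((\<lambda>s. inner01 (f s) (efun n)) has_real_derivative F' n t) (at t within {0..})"
    if t: "0 \<le> t" for n t
    unfolding has_field_derivative_iff
  proof (rule LIM_zero_cancel, rule Lim_null_comparison)
    show "((\<lambda>s. sqrt 2 * L1norm01 (\<lambda>x. (f s x - f t x) / (s - t) - f' t x)) \<longlongrightarrow> 0) (at t within {0..})"
      by (rule tendsto_mult_right_zero[OF fd[OF t]])
    have "norm ((inner01 (f s) (efun n) - inner01 (f t) (efun n)) / (s - t) - F' n t)
        \<le> sqrt 2 * L1norm01 (\<lambda>x. (f s x - f t x) / (s - t) - f' t x)" if s: "0 \<le> s" for s
    proof -
      have q: "set_integrable lborel {0..1} (\<lambda>x. (f s x - f t x) / (s - t))"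
        by (intro set_integrable_divide set_integral_diff(1) fi s t)
      have "(inner01 (f s) (efun n) - inner01 (f t) (efun n)) / (s - t) - F' n t
          = inner01 (\<lambda>x. (f s x - f t x) / (s - t) - f' t x) (efun n)"
        by (simp only: F'_def inner01_efun_diff[OF q f'i[OF t]] inner01_efun_divide
              inner01_efun_diff[OF fi[OF s] fi[OF t]])
      then show ?thesis
        using abs_inner01_efun_le[OF set_integral_diff(1)[OF q f'i[OF t]], of n] by simp
    qed
    then show "\<forall>\<^sub>F s in at t within {0..}.
        norm ((inner01 (f s) (efun n) - inner01 (f t) (efun n)) / (s - t) - F' n t)
        \<le> sqrt 2 * L1norm01 (\<lambda>x. (f s x - f t x) / (s - t) - f' t x)"
      by (simp add: eventually_at_filter)
  qed
  have cont: "continuous_on {0..} (F' n)" for n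
    unfolding continuous_on_def
  proof (intro ballI, rule LIM_zero_cancel, rule Lim_null_comparison)
    fix t :: real assume "t \<in> {0..}"
    then have t: "0 \<le> t" by simp
    show "((\<lambda>s. sqrt 2 * L1norm01 (\<lambda>x. f' s x - f' t x)) \<longlongrightarrow> 0) (at t within {0..})"
      by (rule tendsto_mult_right_zero[OF f'c[OF t]])
    have "norm (F' n s - F' n t) \<le> sqrt 2 * L1norm01 (\<lambda>x. f' s x - f' t x)" if "0 \<le> s" for s
      using abs_inner01_efun_le[OF set_integral_diff(1)[OF f'i[OF that] f'i[OF t]], of n]
      by (simp add: F'_def inner01_efun_diff f'i that t)
    then show "\<forall>\<^sub>F s in at t within {0..}. norm (F' n s - F' n t) \<le> sqrt 2 * L1norm01 (\<lambda>x. f' s x - f' t x)"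
      by (simp add: eventually_at_filter)
  qed
  have bound: "\<exists>C. \<forall>n. \<forall>t\<in>{0..R}. \<bar>inner01 (f t) (efun n)\<bar> \<le> C \<and> \<bar>F' n t\<bar> \<le> C" for R
  proof -
    have "continuous_on {0..R} (\<lambda>t. L1norm01 (f' t))"
      unfolding continuous_on_def
    proof (intro ballI, rule LIM_zero_cancel, rule Lim_null_comparison)
      fix t :: real assume "t \<in> {0..R}"
      then have t: "0 \<le> t" by simp
      show "((\<lambda>s. L1norm01 (\<lambda>x. f' s x - f' t x)) \<longlongrightarrow> 0) (at t within {0..R})"
        using f'c[OF t] by (rule tendsto_within_subset) auto
      have "norm (L1norm01 (f' s) - L1norm01 (f' t)) \<le> L1norm01 (\<lambda>x. f' s x - f' t x)" if "0 \<le> s" for s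
        using L1norm01_triangle[OF f'i[OF that] f'i[OF t]] L1norm01_triangle[OF f'i[OF t] f'i[OF that]]
          L1norm01_minus_commute[of "f' t" "f' s"] by simp
      then show "\<forall>\<^sub>F s in at t within {0..R}. norm (L1norm01 (f' s) - L1norm01 (f' t))
          \<le> L1norm01 (\<lambda>x. f' s x - f' t x)"
        by (simp add: eventually_at_filter)
    qed
    then have "bounded ((\<lambda>t. L1norm01 (f' t)) ` {0..R})"
      by (intro compact_imp_bounded compact_continuous_image) auto
    then obtain K where K: "\<And>t. t \<in> {0..R} \<Longrightarrow> \<bar>L1norm01 (f' t)\<bar> \<le> K"
      unfolding bounded_iff real_norm_def by blast
    have F'b: "\<bar>F' n t\<bar> \<le> sqrt 2 * K" if t: "t \<in> {0..R}" for n t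
    proof -
      have "\<bar>F' n t\<bar> \<le> sqrt 2 * L1norm01 (f' t)"
        unfolding F'_def using t by (intro abs_inner01_efun_le f'i) auto
      also have "\<dots> \<le> sqrt 2 * K" using K[OF t] by (intro mult_left_mono) auto
      finally show ?thesis .
    qed
    have Fb: "\<bar>inner01 (f t) (efun n)\<bar> \<le> sqrt 2 * L1norm01 (f 0) + sqrt 2 * K * R"
      if t: "t \<in> {0..R}" for n t
    proof -
      have K0: "0 \<le> sqrt 2 * K" using F'b[OF t, of n] by linarith
      have "norm (inner01 (f t) (efun n) - inner01 (f 0) (efun n)) \<le> (sqrt 2 * K) * norm (t - 0)"
      proof (rule field_differentiable_bound[of "{0..R}"])
        show "((\<lambda>s. inner01 (f s) (efun n)) has_real_derivative F' n z) (at z within {0..R})"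
          if "z \<in> {0..R}" for z
          using that by (intro DERIV_subset[OF deriv]) auto
      qed (use F'b t in auto)
      also have "\<dots> \<le> sqrt 2 * K * R"
        using t K0 by (intro mult_left_mono) auto
      finally show ?thesis
        using abs_inner01_efun_le[OF fi[OF order_refl], of n] by simp
    qed
    show ?thesis
    proof (intro exI allI ballI)
      fix n t assume t: "t \<in> {0..R}"
      show "\<bar>inner01 (f t) (efun n)\<bar> \<le> max (sqrt 2 * L1norm01 (f 0) + sqrt 2 * K * R) (sqrt 2 * K)
          \<and> \<bar>F' n t\<bar> \<le> max (sqrt 2 * L1norm01 (f 0) + sqrt 2 * K * R) (sqrt 2 * K)"
        using Fb[OF t, of n] F'b[OF t, of n] by auto
    qed
  qed
  show thesis by (rule that[OF deriv cont bound])
qed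

lemma time_deriv_eq:
  assumes "(\<phi> has_real_derivative d) (at t within {0..})" "0 \<le> t"
  shows "time_deriv \<phi> t = d"
proof -
  have "at t within {0..} \<noteq> bot"
  proof -
    have "t islimpt {t<..<t + 1}" by (rule islimpt_greaterThanLessThan1) simp
    moreover have "{t<..<t + 1} \<subseteq> {0..}" using assms(2) by auto
    ultimately show ?thesis unfolding trivial_limit_within by (blast intro: islimpt_subset)
  qed
  then show ?thesis
    unfolding time_deriv_def using assms(1)
    by (intro vector_derivative_within) (simp_all add: has_real_derivative_iff_has_vector_derivative)
qed

text \<open>Integration by parts removes the derivatives of the boundary data from the forcing, and the
  boundary terms that it creates cancel the corrections \<open>Yn\<close> in \<open>mu_n\<close>. What remains of
  the data is \<open>(a * bfreq (Suc n))\<^sup>2\<close> times the coefficient of \<open>Yfun\<close>, which stays bounded for \<open>h\<close>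
  and grows like \<open>bfreq (Suc n)\<close> for \<open>g\<close>.\<close>

lemma mu_n_eq_duhamel:
  assumes fi: "\<And>t. 0 \<le> t \<Longrightarrow> set_integrable lborel {0..1} (f t)"
    and F: "continuous_on {0..} (\<lambda>t. inner01 (f t) (efun (Suc n)))"
    and g: "\<And>t. 0 \<le> t \<Longrightarrow> (g has_real_derivative g' t) (at t within {0..})" "continuous_on {0..} g'"
    and h: "\<And>t. 0 \<le> t \<Longrightarrow> (h has_real_derivative h' t) (at t within {0..})" "continuous_on {0..} h'"
    and t: "0 \<le> t"
  shows "mu_n a b f h g m0 (Suc n) t x =
      m0 (Suc n) * efun (Suc n) x * exp (eigval a b (Suc n) * t)
    + efun (Suc n) x * duhamel (eigval a b (Suc n)) (\<lambda>s. inner01 (f s) (efun (Suc n)) - a\<^sup>2 * sqrt 2 * h s) t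
    + 2 * a\<^sup>2 * (((-1) ^ n * cos (bfreq (Suc n) * x)) * (bfreq (Suc n) * duhamel (eigval a b (Suc n)) g t))"
proof -
  let ?\<beta> = "bfreq (Suc n)" and ?l = "eigval a b (Suc n)" and ?e = "efun (Suc n) x"
  let ?F = "\<lambda>s. inner01 (f s) (efun (Suc n))"
  let ?c = "sqrt 2 * (-1) ^ n / ?\<beta>" and ?d = "sqrt 2 / ?\<beta>\<^sup>2"
  define y where "y s = ?c * g s - ?d * h s" for s
  define y' where "y' s = ?c * g' s - ?d * h' s" for s
  have \<beta>: "?\<beta> > 0" by (rule bfreq_pos)
  have gc: "continuous_on {0..} g" and hc: "continuous_on {0..} h"
    using g(1) h(1) by (auto intro!: DERIV_continuous_on)
  have yd: "(y has_real_derivative y' s) (at s within {0..})" if "0 \<le> s" for s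
    unfolding y_def[abs_def] y'_def by (intro DERIV_diff DERIV_cmult g(1) h(1) that)
  have yc: "continuous_on {0..} y" and y'c: "continuous_on {0..} y'"
    unfolding y_def[abs_def] y'_def[abs_def]
    by (intro continuous_on_diff continuous_on_mult_left gc hc g(2) h(2))+
  have Yn: "Yn h g (Suc n) s x = y s * ?e" for s
    unfolding Yn_def Yfun_def inner01_affine_efun y_def by (simp add: right_diff_distrib)
  have aff: "set_integrable lborel {0..1} (\<lambda>x. p * (x - 1) + r)" for p r :: real
    by (intro borel_integrable_atLeastAtMost' continuous_intros)
  have ft: "ftilde_n b f h g (Suc n) s x = (?F s - y' s + b * y s) * ?e" if s: "0 \<le> s" for s
  proof -
    have td: "time_deriv (\<lambda>s. Yfun h g s z) s = h' s * (z - 1) + g' s" for z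
      unfolding Yfun_def using h(1)[OF s] g(1)[OF s]
      by (intro time_deriv_eq[OF _ s]) (auto intro!: derivative_eq_intros)
    have "ftilde b f h g s z = f s z - (h' s * (z - 1) + g' s) + ((b * h s) * (z - 1) + b * g s)" for z
      unfolding ftilde_def td by (simp add: Yfun_def algebra_simps)
    then have "ftilde b f h g s = (\<lambda>z. f s z - (h' s * (z - 1) + g' s) + ((b * h s) * (z - 1) + b * g s))"
      by (rule ext)
    then have "inner01 (ftilde b f h g s) (efun (Suc n))
        = ?F s - inner01 (\<lambda>z. h' s * (z - 1) + g' s) (efun (Suc n))
          + inner01 (\<lambda>z. (b * h s) * (z - 1) + b * g s) (efun (Suc n))"
      by (simp only: inner01_efun_add inner01_efun_diff set_integral_diff(1) aff fi[OF s])
    then have "inner01 (ftilde b f h g s) (efun (Suc n)) = ?F s - y' s + b * y s"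
      unfolding inner01_affine_efun by (simp add: y_def y'_def algebra_simps)
    then show ?thesis by (simp add: ftilde_n_def)
  qed
  have cs: "continuous_on {0..t} (\<lambda>s. exp (?l * (t - s)) * \<phi> s)"
    if "continuous_on {0..} \<phi>" for \<phi> :: "real \<Rightarrow> real"
    by (intro continuous_intros continuous_on_subset[OF that]) auto
  have int: "(\<lambda>s. exp (?l * (t - s)) * \<phi> s) integrable_on {0..t}"
    if "continuous_on {0..} \<phi>" for \<phi> :: "real \<Rightarrow> real"
    by (rule integrable_continuous_real[OF cs[OF that]])
  have "(LINT s:{0..t}|lborel. exp (?l * (t - s)) * ftilde_n b f h g (Suc n) s x)
      = (LINT s:{0..t}|lborel. (exp (?l * (t - s)) * (?F s - y' s + b * y s)) * ?e)"
    by (intro set_lebesgue_integral_cong) (auto simp: ft)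
  also have "\<dots> = integral {0..t} (\<lambda>s. (exp (?l * (t - s)) * (?F s - y' s + b * y s)) * ?e)"
    by (intro set_borel_integral_eq_integral(2) borel_integrable_atLeastAtMost' continuous_on_mult_right
          cs continuous_on_add continuous_on_diff continuous_on_mult_left F yc y'c)
  also have "\<dots> = duhamel ?l (\<lambda>s. ?F s - y' s + b * y s) t * ?e"
    by (simp add: duhamel_def)
  also have "duhamel ?l (\<lambda>s. ?F s - y' s + b * y s) t
      = duhamel ?l ?F t - duhamel ?l y' t + b * duhamel ?l y t"
  proof -
    have "(\<lambda>s. exp (?l * (t - s)) * (?F s - y' s + b * y s)) = (\<lambda>s. exp (?l * (t - s)) * ?F s
        - exp (?l * (t - s)) * y' s + b * (exp (?l * (t - s)) * y s))"
      by (simp add: algebra_simps)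
    then show ?thesis
      unfolding duhamel_def using int[OF F] int[OF y'c] int[OF yc]
      by (simp add: integral_add integral_diff integrable_diff integrable_on_mult_right)
  qed
  also have "duhamel ?l y' t = y t - exp (?l * t) * y 0 + ?l * duhamel ?l y t"
    by (rule duhamel_integrate_by_parts[OF yd y'c t])
  finally have L: "(LINT s:{0..t}|lborel. exp (?l * (t - s)) * ftilde_n b f h g (Suc n) s x)
      = (duhamel ?l ?F t + (a * ?\<beta>)\<^sup>2 * duhamel ?l y t - y t + exp (?l * t) * y 0) * ?e"
    by (simp add: eigval_def algebra_simps)
  have dy: "(a * ?\<beta>)\<^sup>2 * duhamel ?l y t
      = a\<^sup>2 * sqrt 2 * ((-1) ^ n * (?\<beta> * duhamel ?l g t)) - a\<^sup>2 * sqrt 2 * duhamel ?l h t"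
  proof -
    have "(\<lambda>s. exp (?l * (t - s)) * y s)
        = (\<lambda>s. ?c * (exp (?l * (t - s)) * g s) - ?d * (exp (?l * (t - s)) * h s))"
      by (simp add: y_def algebra_simps)
    then have "duhamel ?l y t = ?c * duhamel ?l g t - ?d * duhamel ?l h t"
      unfolding duhamel_def using int[OF gc] int[OF hc]
      by (simp only: integral_diff integrable_on_mult_right integral_mult_right)
    then have "?\<beta>\<^sup>2 * duhamel ?l y t = sqrt 2 * ((-1) ^ n * (?\<beta> * duhamel ?l g t)) - sqrt 2 * duhamel ?l h t"
      using \<beta> by (simp add: field_simps power2_eq_square)
    then have "a\<^sup>2 * (?\<beta>\<^sup>2 * duhamel ?l y t)
        = a\<^sup>2 * (sqrt 2 * ((-1) ^ n * (?\<beta> * duhamel ?l g t)) - sqrt 2 * duhamel ?l h t)"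
      by (rule arg_cong)
    then show ?thesis by (simp only: power_mult_distrib mult.assoc right_diff_distrib)
  qed
  have dFh: "duhamel ?l (\<lambda>s. ?F s - a\<^sup>2 * sqrt 2 * h s) t = duhamel ?l ?F t - a\<^sup>2 * sqrt 2 * duhamel ?l h t"
  proof -
    have "(\<lambda>s. exp (?l * (t - s)) * (?F s - a\<^sup>2 * sqrt 2 * h s)) = (\<lambda>s. exp (?l * (t - s)) * ?F s
        - (a\<^sup>2 * sqrt 2) * (exp (?l * (t - s)) * h s))"
      by (simp add: algebra_simps)
    then show ?thesis
      unfolding duhamel_def using int[OF F] int[OF hc]
      by (simp only: integral_diff integrable_on_mult_right integral_mult_right)
  qed
  have e: "sqrt 2 * ?e = 2 * cos (?\<beta> * x)" by (simp add: efun_Suc)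
  have "mu_n a b f h g m0 (Suc n) t x = m0 (Suc n) * ?e * exp (?l * t)
      + (duhamel ?l ?F t + (a * ?\<beta>)\<^sup>2 * duhamel ?l y t) * ?e"
    unfolding mu_n_def L Yn by (simp add: algebra_simps)
  also have "\<dots> = m0 (Suc n) * ?e * exp (?l * t) + ?e * duhamel ?l (\<lambda>s. ?F s - a\<^sup>2 * sqrt 2 * h s) t
      + a\<^sup>2 * ((-1) ^ n * (?\<beta> * duhamel ?l g t)) * (sqrt 2 * ?e)"
    unfolding dy dFh by (simp add: algebra_simps)
  finally show ?thesis unfolding e by (simp add: algebra_simps)
qed

text \<open>A form of the variance that treats zero and nonzero eigenvalues alike.\<close>

lemma nu_n_eq_duhamel:
  assumes t: "0 \<le> t"
  shows "nu_n a b \<sigma> q v0 n t x = v0 n * (efun n x)\<^sup>2 * exp (2 * eigval a b n * t)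
      + (\<sigma> * q n * efun n x)\<^sup>2 * duhamel (2 * eigval a b n) (\<lambda>_. 1) t"
proof (cases "eigval a b n = 0")
  case True
  then show ?thesis using t by (simp add: nu_n_def duhamel_def)
next
  case False
  have "duhamel (2 * eigval a b n) (\<lambda>_. 0) t
      = 1 - exp (2 * eigval a b n * t) * 1 + 2 * eigval a b n * duhamel (2 * eigval a b n) (\<lambda>_. 1) t"
    by (rule duhamel_integrate_by_parts[OF _ _ t]) (auto intro!: derivative_eq_intros)
  then have "duhamel (2 * eigval a b n) (\<lambda>_. 1) t = (exp (2 * eigval a b n * t) - 1) / (2 * eigval a b n)"
    using False by (simp add: duhamel_def field_simps)
  then show ?thesis using False by (simp add: nu_n_def)
qed

section \<open>Regularity of the mean and the variance\<close>

lemma continuous_on_uniformly_convergent_series: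
  fixes f :: "nat \<Rightarrow> 'a::topological_space \<Rightarrow> real"
  assumes unif: "uniformly_convergent_on S (\<lambda>N y. \<Sum>n<N. f n y)" and f: "\<And>n. continuous_on S (f n)"
  shows "continuous_on S (\<lambda>y. \<Sum>n. f n y)"
proof -
  have "continuous_on S (\<lambda>y. lim (\<lambda>N. \<Sum>n<N. f n y))"
  proof (rule uniform_limit_theorem)
    show "uniform_limit S (\<lambda>N y. \<Sum>n<N. f n y) (\<lambda>y. lim (\<lambda>N. \<Sum>n<N. f n y)) sequentially"
      using unif unfolding uniformly_convergent_uniform_limit_iff .
    show "\<forall>\<^sub>F N in sequentially. continuous_on S (\<lambda>y. \<Sum>n<N. f n y)"
      by (intro always_eventually allI continuous_on_sum f)
  qed simp
  then show ?thesis by (simp add: suminf_eq_lim)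
qed

lemma uniformly_convergent_on_imp_summable:
  fixes f :: "nat \<Rightarrow> 'a \<Rightarrow> real"
  assumes "uniformly_convergent_on S (\<lambda>N y. \<Sum>n<N. f n y)" "y \<in> S"
  shows "summable (\<lambda>n. f n y)"
  unfolding summable_iff_convergent
  using uniformly_convergent_imp_convergent[OF assms] .

lemma continuous_on_duhamel:
  assumes "continuous_on {0..} \<phi>"
  shows "continuous_on {0..R} (duhamel l \<phi>)"
  using duhamel_has_derivative[OF assms] by (rule DERIV_continuous_on)

lemma duhamel_has_derivative_C1:
  assumes \<phi>: "\<And>s. 0 \<le> s \<Longrightarrow> (\<phi> has_real_derivative \<phi>' s) (at s within {0..})"
    and \<phi>': "continuous_on {0..} \<phi>'" and S: "S \<subseteq> {0..R}" and t: "t \<in> S"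
  shows "(duhamel l \<phi> has_real_derivative exp (l * t) * \<phi> 0 + duhamel l \<phi>' t) (at t within S)"
proof -
  have cont: "continuous_on {0..} \<phi>"
    using \<phi> by (intro DERIV_continuous_on) auto
  have "(duhamel l \<phi> has_real_derivative l * duhamel l \<phi> t + \<phi> t) (at t within S)"
    using duhamel_has_derivative[OF cont, of t R] S t by (intro DERIV_subset[OF _ S]) auto
  moreover have "l * duhamel l \<phi> t + \<phi> t = exp (l * t) * \<phi> 0 + duhamel l \<phi>' t"
    using duhamel_integrate_by_parts[OF \<phi> \<phi>', of t l] S t by auto
  ultimately show ?thesis by simp
qed

lemma eigval_eq: "eigval a b n = b - a\<^sup>2 * (bfreq n)\<^sup>2"
  by (simp add: eigval_def power_mult_distrib)

lemma abs_eigval_le: "\<bar>eigval a b (Suc n)\<bar> \<le> (\<bar>b\<bar> + a\<^sup>2) * (bfreq (Suc n))\<^sup>2"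
proof -
  have "1 \<le> (bfreq (Suc n))\<^sup>2" using bfreq_ge_1[of n] by (simp add: one_le_power)
  then have "\<bar>b\<bar> * 1 \<le> \<bar>b\<bar> * (bfreq (Suc n))\<^sup>2" by (intro mult_left_mono) auto
  moreover have "\<bar>eigval a b (Suc n)\<bar> \<le> \<bar>b\<bar> + a\<^sup>2 * (bfreq (Suc n))\<^sup>2"
    unfolding eigval_eq using abs_triangle_ineq4[of b "a\<^sup>2 * (bfreq (Suc n))\<^sup>2"] by (simp add: abs_mult)
  ultimately show ?thesis by (simp add: algebra_simps)
qed

lemma summable_abs_bounded:
  fixes u :: "nat \<Rightarrow> real"
  assumes "summable (\<lambda>n. \<bar>u n\<bar>)"
  obtains K where "0 \<le> K" "\<And>n. \<bar>u n\<bar> \<le> K"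
proof -
  show thesis
  proof (rule that)
    show "0 \<le> (\<Sum>n. \<bar>u n\<bar>)" by (intro suminf_nonneg assms) simp
    show "\<bar>u n\<bar> \<le> (\<Sum>n. \<bar>u n\<bar>)" for n
      using sum_le_suminf[OF assms, of "{n}"] by simp
  qed
qed

text \<open>Termwise differentiation on compact time intervals away from \<open>0\<close>. The exponentials, including
  those that differentiating the Duhamel terms produces at the initial time, are smoothed; the
  contributions of \<open>f\<close> and \<open>h\<close> converge absolutely; that of \<open>g\<close> converges by oscillation.\<close>

lemma mu_regular:
  assumes a: "a \<noteq> 0" and g: "C1_halfline g" and h: "C1_halfline h" and f: "C1_halfline_L1 f"
    and m0: "summable (\<lambda>n. \<bar>m0 (Suc n)\<bar>)" and x: "0 \<le> x" "x < 1"
  shows "continuous_on {0..R} (\<lambda>t. mu a b f h g m0 t x)"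
    and "0 < t \<Longrightarrow> \<exists>D. ((\<lambda>t. mu a b f h g m0 t x) has_real_derivative D) (at t)"
proof -
  obtain g' where g': "\<And>t. 0 \<le> t \<Longrightarrow> (g has_real_derivative g' t) (at t within {0..})"
      "continuous_on {0..} g'"
    using g unfolding C1_halfline_def by auto
  obtain h' where h': "\<And>t. 0 \<le> t \<Longrightarrow> (h has_real_derivative h' t) (at t within {0..})"
      "continuous_on {0..} h'"
    using h unfolding C1_halfline_def by auto
  obtain F' where F': "\<And>n t. 0 \<le> t \<Longrightarrow> ((\<lambda>s. inner01 (f s) (efun n)) has_real_derivative F' n t) (at t within {0..})"
      "\<And>n. continuous_on {0..} (F' n)"
      "\<And>R. \<exists>C. \<forall>n. \<forall>t\<in>{0..R}. \<bar>inner01 (f t) (efun n)\<bar> \<le> C \<and> \<bar>F' n t\<bar> \<le> C"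
    using C1_L1_coefficients[OF f] by blast
  have gc: "continuous_on {0..} g" and hc: "continuous_on {0..} h"
    using g'(1) h'(1) by (auto intro!: DERIV_continuous_on)
  have A: "0 < a\<^sup>2" using a by simp
  let ?l = "\<lambda>n. eigval a b (Suc n)" and ?e = "\<lambda>n. efun (Suc n) x"
  let ?\<beta> = "\<lambda>n. bfreq (Suc n)"
  let ?c = "\<lambda>n. (-1) ^ n * cos (?\<beta> n * x)"
  define \<phi> where "\<phi> n s = inner01 (f s) (efun (Suc n)) - a\<^sup>2 * sqrt 2 * h s" for n s
  define \<phi>' where "\<phi>' n s = F' (Suc n) s - a\<^sup>2 * sqrt 2 * h' s" for n s
  have \<phi>d: "(\<phi> n has_real_derivative \<phi>' n s) (at s within {0..})" if "0 \<le> s" for n s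
    unfolding \<phi>_def[abs_def] \<phi>'_def by (intro DERIV_diff DERIV_cmult F'(1) h'(1) that)
  have \<phi>c: "continuous_on {0..} (\<phi> n)" and \<phi>'c: "continuous_on {0..} (\<phi>' n)" for n
  proof -
    show "continuous_on {0..} (\<phi> n)" using \<phi>d by (auto intro!: DERIV_continuous_on)
    show "continuous_on {0..} (\<phi>' n)"
      unfolding \<phi>'_def[abs_def] by (intro continuous_on_diff continuous_on_mult_left F'(2) h'(2))
  qed
  have bound: "\<exists>C. \<forall>n. \<forall>s\<in>{0..R}. \<bar>\<phi> n s\<bar> \<le> C \<and> \<bar>\<phi>' n s\<bar> \<le> C" for R
  proof -
    obtain C where C: "\<And>n s. s \<in> {0..R} \<Longrightarrow> \<bar>inner01 (f s) (efun n)\<bar> \<le> C \<and> \<bar>F' n s\<bar> \<le> C"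
      using F'(3) by blast
    have "bounded (h ` {0..R})" "bounded (h' ` {0..R})"
      by (auto intro!: compact_imp_bounded compact_continuous_image
            continuous_on_subset[OF hc] continuous_on_subset[OF h'(2)])
    then obtain H H' where H: "\<And>s. s \<in> {0..R} \<Longrightarrow> \<bar>h s\<bar> \<le> H" "\<And>s. s \<in> {0..R} \<Longrightarrow> \<bar>h' s\<bar> \<le> H'"
      unfolding bounded_iff real_norm_def by blast
    have "\<bar>\<phi> n s\<bar> \<le> C + a\<^sup>2 * sqrt 2 * max H H' \<and> \<bar>\<phi>' n s\<bar> \<le> C + a\<^sup>2 * sqrt 2 * max H H'"
      if s: "s \<in> {0..R}" for n s
    proof -
      have "\<bar>u - a\<^sup>2 * sqrt 2 * v\<bar> \<le> C + a\<^sup>2 * sqrt 2 * max H H'"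
        if "\<bar>u\<bar> \<le> C" "\<bar>v\<bar> \<le> max H H'" for u v :: real
      proof -
        have "\<bar>a\<^sup>2 * sqrt 2 * v\<bar> \<le> a\<^sup>2 * sqrt 2 * max H H'"
          unfolding abs_mult using that(2) by (intro mult_mono) auto
        then show ?thesis using that(1) by linarith
      qed
      then show ?thesis
        unfolding \<phi>_def \<phi>'_def using C[OF s] H(1)[OF s] H(2)[OF s] by (simp add: le_max_iff_disj)
    qed
    then show ?thesis by blast
  qed
  define T where "T n t = (m0 (Suc n) * ?e n) * exp (?l n * t) + ?e n * duhamel (?l n) (\<phi> n) t
      + 2 * a\<^sup>2 * (?c n * (?\<beta> n * duhamel (?l n) g t))" for n t
  have fi: "\<And>t. 0 \<le> t \<Longrightarrow> set_integrable lborel {0..1} (f t)"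
    using f by (simp add: C1_halfline_L1_def)
  have mu_eq: "mu a b f h g m0 t x = (\<Sum>n. T n t)" if "0 \<le> t" for t
    unfolding mu_def
  proof (rule suminf_cong)
    fix n
    have "continuous_on {0..} (\<lambda>t. inner01 (f t) (efun (Suc n)))"
      by (rule DERIV_continuous_on[OF F'(1)]) simp
    then show "mu_n a b f h g m0 (Suc n) t x = T n t"
      unfolding T_def \<phi>_def[abs_def] by (intro mu_n_eq_duhamel[OF fi _ g' h' that])
  qed
  have e: "\<bar>?e n\<bar> \<le> sqrt 2" for n by (rule abs_efun_le)
  obtain K where K: "0 \<le> K" "\<And>n. \<bar>m0 (Suc n)\<bar> \<le> K"
    using summable_abs_bounded[OF m0] by blast
  have m0e: "summable (\<lambda>n. \<bar>m0 (Suc n) * ?e n\<bar>)"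
  proof (rule summable_comparison_test')
    show "summable (\<lambda>n. \<bar>m0 (Suc n)\<bar> * sqrt 2)" by (intro summable_mult2 m0)
    show "norm \<bar>m0 (Suc n) * ?e n\<bar> \<le> \<bar>m0 (Suc n)\<bar> * sqrt 2" for n
      using e[of n] by (simp add: abs_mult mult_left_mono)
  qed
  have unif: "uniformly_convergent_on {0..R} (\<lambda>N t. \<Sum>n<N. T n t)" for R
  proof -
    obtain C where C: "\<And>n s. s \<in> {0..R} \<Longrightarrow> \<bar>\<phi> n s\<bar> \<le> C" using bound by blast
    show ?thesis
      unfolding T_def sum.distrib sum_distrib_left[symmetric] eigval_eq
      by (intro uniformly_convergent_add uniformly_convergent_mult
          uniformly_convergent_exponential_series[OF A m0e]
          uniformly_convergent_duhamel_series[OF A e \<phi>c C]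
          uniformly_convergent_boundary_series[OF A x gc])
  qed
  have Tc: "continuous_on {0..R} (T n)" for n R
    unfolding T_def[abs_def] by (intro continuous_intros continuous_on_duhamel \<phi>c gc)
  have "continuous_on {0..R} (\<lambda>t. \<Sum>n. T n t)"
    by (rule continuous_on_uniformly_convergent_series[OF unif Tc])
  then show "continuous_on {0..R} (\<lambda>t. mu a b f h g m0 t x)"
    by (rule continuous_on_eq) (simp add: mu_eq)
  assume t: "0 < t"
  define w where "w n = m0 (Suc n) * ?e n * ?l n + ?e n * \<phi> n 0 + 2 * a\<^sup>2 * (?c n * (?\<beta> n * g 0))" for n
  define T' where "T' n s = w n * exp (?l n * s) + ?e n * duhamel (?l n) (\<phi>' n) s
      + 2 * a\<^sup>2 * (?c n * (?\<beta> n * duhamel (?l n) g' s))" for n s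
  let ?S = "{t / 2..t + 1}"
  have Td: "(T n has_real_derivative T' n s) (at s within ?S)" if s: "s \<in> ?S" for n s
  proof -
    have sub: "?S \<subseteq> {0..t + 1}" using t by auto
    have "(T n has_real_derivative (m0 (Suc n) * ?e n) * (exp (?l n * s) * ?l n)
        + ?e n * (exp (?l n * s) * \<phi> n 0 + duhamel (?l n) (\<phi>' n) s)
        + 2 * a\<^sup>2 * (?c n * (?\<beta> n * (exp (?l n * s) * g 0 + duhamel (?l n) g' s)))) (at s within ?S)"
      unfolding T_def[abs_def]
      by (intro DERIV_add DERIV_cmult duhamel_has_derivative_C1[OF \<phi>d \<phi>'c sub s]
            duhamel_has_derivative_C1[OF g' sub s]) (auto intro!: derivative_eq_intros)
    then show ?thesis by (simp add: T'_def w_def algebra_simps)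
  qed
  have unif': "uniformly_convergent_on ?S (\<lambda>N s. \<Sum>n<N. T' n s)"
  proof -
    obtain C where C: "\<And>n s. s \<in> {0..t + 1} \<Longrightarrow> \<bar>\<phi> n s\<bar> \<le> C" "\<And>n s. s \<in> {0..t + 1} \<Longrightarrow> \<bar>\<phi>' n s\<bar> \<le> C"
      using bound by blast
    \<comment> \<open>All three initial contributions grow at most like the square of the frequency.\<close>
    let ?W = "K * sqrt 2 * (\<bar>b\<bar> + a\<^sup>2) + sqrt 2 * C + 2 * a\<^sup>2 * \<bar>g 0\<bar>"
    have w: "\<bar>w n\<bar> \<le> ?W * (?\<beta> n)\<^sup>2" for n
    proof -
      have b2: "?\<beta> n \<le> (?\<beta> n)\<^sup>2" "1 \<le> (?\<beta> n)\<^sup>2"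
        using bfreq_ge_1[of n] by (auto intro: self_le_power one_le_power)
      have C0: "0 \<le> C" using C(1)[of 0 0] t by auto
      have "\<bar>m0 (Suc n) * ?e n * ?l n\<bar> \<le> K * sqrt 2 * ((\<bar>b\<bar> + a\<^sup>2) * (?\<beta> n)\<^sup>2)"
        unfolding abs_mult using K e[of n] abs_eigval_le[of a b n] by (intro mult_mono) auto
      moreover have "\<bar>?e n * \<phi> n 0\<bar> \<le> (sqrt 2 * C) * (?\<beta> n)\<^sup>2"
      proof -
        have "\<bar>?e n * \<phi> n 0\<bar> \<le> sqrt 2 * C"
          unfolding abs_mult using e[of n] C(1)[of 0 n] t by (intro mult_mono) auto
        also have "\<dots> \<le> (sqrt 2 * C) * (?\<beta> n)\<^sup>2"
          using mult_left_mono[OF b2(2), of "sqrt 2 * C"] C0 by simp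
        finally show ?thesis .
      qed
      moreover have "\<bar>2 * a\<^sup>2 * (?c n * (?\<beta> n * g 0))\<bar> \<le> 2 * a\<^sup>2 * (1 * ((?\<beta> n)\<^sup>2 * \<bar>g 0\<bar>))"
        unfolding abs_mult using b2 bfreq_pos[of n]
        by (intro mult_mono) auto
      ultimately have "\<bar>w n\<bar> \<le> K * sqrt 2 * ((\<bar>b\<bar> + a\<^sup>2) * (?\<beta> n)\<^sup>2) + (sqrt 2 * C) * (?\<beta> n)\<^sup>2
          + 2 * a\<^sup>2 * (1 * ((?\<beta> n)\<^sup>2 * \<bar>g 0\<bar>))"
        unfolding w_def by (intro order_trans[OF abs_triangle_ineq] add_mono)
      then show ?thesis by (simp add: algebra_simps)
    qed
    have "uniformly_convergent_on ?S (\<lambda>N s. \<Sum>n<N. w n * exp ((b - a\<^sup>2 * (?\<beta> n)\<^sup>2) * s))"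
      by (rule uniformly_convergent_smoothed_series[OF A, where \<delta> = "t / 2" and R = "t + 1"]) (use t w in auto)
    moreover have "uniformly_convergent_on ?S (\<lambda>N s. \<Sum>n<N. ?e n * duhamel (b - a\<^sup>2 * (?\<beta> n)\<^sup>2) (\<phi>' n) s)"
      by (rule uniformly_convergent_on_subset[OF uniformly_convergent_duhamel_series[OF A e \<phi>'c C(2)]])
         (use t in auto)
    moreover have "uniformly_convergent_on ?S (\<lambda>N s. \<Sum>n<N. ?c n * (?\<beta> n * duhamel (b - a\<^sup>2 * (?\<beta> n)\<^sup>2) g' s))"
      by (rule uniformly_convergent_on_subset[OF
            uniformly_convergent_boundary_series[OF A x g'(2), of "t + 1"]]) (use t in auto)
    ultimately show ?thesis
      unfolding T'_def sum.distrib sum_distrib_left[symmetric] eigval_eq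
      by (intro uniformly_convergent_add uniformly_convergent_mult)
  qed
  have "((\<lambda>s. \<Sum>n. T n s) has_real_derivative (\<Sum>n. T' n t)) (at t)"
  proof (rule has_field_derivative_series'(2)[OF _ Td unif'])
    show "t \<in> ?S" using t by auto
    show "summable (\<lambda>n. T n t)"
      by (rule uniformly_convergent_on_imp_summable[OF unif[of t]]) (use t in auto)
    show "t \<in> interior ?S" using t by simp
  qed simp_all
  moreover have "\<forall>\<^sub>F s in nhds t. mu a b f h g m0 s x = (\<Sum>n. T n s)"
    using eventually_nhds_in_open[of "{0<..}" t] t by (auto elim!: eventually_mono simp: mu_eq)
  ultimately have "((\<lambda>s. mu a b f h g m0 s x) has_real_derivative (\<Sum>n. T' n t)) (at t)"
    by (subst DERIV_cong_ev[OF refl _ refl]) auto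
  then show "\<exists>D. ((\<lambda>t. mu a b f h g m0 t x) has_real_derivative D) (at t)" by blast
qed

text \<open>Continuity of the derivative in space, the third claim, serves to extend its sign from the
  open interval to the left end point.\<close>

lemma nu_regular:
  fixes a b \<sigma> :: real and q v0 :: "nat \<Rightarrow> real"
  assumes a: "a \<noteq> 0" and q: "summable (\<lambda>n. (q (Suc n))\<^sup>2)" and v0: "summable (\<lambda>n. \<bar>v0 (Suc n)\<bar>)"
  defines "w \<equiv> \<lambda>n. 2 * eigval a b (Suc n) * v0 (Suc n) + (\<sigma> * q (Suc n))\<^sup>2"
  shows "continuous_on {0..R} (\<lambda>t. nu a b \<sigma> q v0 t x)"
    and "0 < t \<Longrightarrow> ((\<lambda>t. nu a b \<sigma> q v0 t x) has_real_derivative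
      (\<Sum>n. w n * (efun (Suc n) x)\<^sup>2 * exp (2 * eigval a b (Suc n) * t))) (at t)"
    and "0 < t \<Longrightarrow> continuous_on UNIV
      (\<lambda>y. \<Sum>n. w n * (efun (Suc n) y)\<^sup>2 * exp (2 * eigval a b (Suc n) * t))"
proof -
  have A: "0 < 2 * a\<^sup>2" using a by simp
  let ?l = "\<lambda>n. eigval a b (Suc n)" and ?\<beta> = "\<lambda>n. bfreq (Suc n)"
  have l2: "2 * ?l n = 2 * b - (2 * a\<^sup>2) * (?\<beta> n)\<^sup>2" for n by (simp add: eigval_eq)
  obtain V where V: "0 \<le> V" "\<And>n. \<bar>v0 (Suc n)\<bar> \<le> V"
    using summable_abs_bounded[OF v0] by blast
  have q': "summable (\<lambda>n. \<bar>(q (Suc n))\<^sup>2\<bar>)" using q by simp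
  obtain Q where Q: "0 \<le> Q" "\<And>n. \<bar>(q (Suc n))\<^sup>2\<bar> \<le> Q"
    using summable_abs_bounded[OF q'] by blast
  define T where "T n t = (v0 (Suc n) * (efun (Suc n) x)\<^sup>2) * exp (2 * ?l n * t)
      + (\<sigma> * q (Suc n) * efun (Suc n) x)\<^sup>2 * duhamel (2 * ?l n) (\<lambda>_. 1) t" for n t
  have nu_eq: "nu a b \<sigma> q v0 t x = (\<Sum>n. T n t)" if "0 \<le> t" for t
    unfolding nu_def T_def by (simp add: nu_n_eq_duhamel[OF that])
  have v0e: "summable (\<lambda>n. \<bar>v0 (Suc n) * (efun (Suc n) x)\<^sup>2\<bar>)"
  proof (rule summable_comparison_test')
    show "summable (\<lambda>n. \<bar>v0 (Suc n)\<bar> * 2)" by (intro summable_mult2 v0)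
    show "norm \<bar>v0 (Suc n) * (efun (Suc n) x)\<^sup>2\<bar> \<le> \<bar>v0 (Suc n)\<bar> * 2" for n
      using efun_squared_le[of "Suc n" x] by (simp add: abs_mult mult_left_mono)
  qed
  have qe: "\<bar>(\<sigma> * q (Suc n) * efun (Suc n) x)\<^sup>2\<bar> \<le> \<sigma>\<^sup>2 * Q * 2" for n
    unfolding power_mult_distrib abs_mult using Q efun_squared_le[of "Suc n" x] by (intro mult_mono) auto
  have unif: "uniformly_convergent_on {0..R} (\<lambda>N t. \<Sum>n<N. T n t)" for R
    unfolding T_def sum.distrib l2
    by (intro uniformly_convergent_add uniformly_convergent_exponential_series[OF A v0e]
        uniformly_convergent_duhamel_series[OF A qe, where C = 1]) auto
  have Tc: "continuous_on {0..R} (T n)" for n R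
    unfolding T_def[abs_def] by (intro continuous_intros continuous_on_duhamel)
  have "continuous_on {0..R} (\<lambda>t. \<Sum>n. T n t)"
    by (rule continuous_on_uniformly_convergent_series[OF unif Tc])
  then show "continuous_on {0..R} (\<lambda>t. nu a b \<sigma> q v0 t x)"
    by (rule continuous_on_eq) (simp add: nu_eq)
  let ?W = "(2 * (\<bar>b\<bar> + a\<^sup>2) * V + \<sigma>\<^sup>2 * Q) * 2"
  have w: "\<bar>w n * (efun (Suc n) y)\<^sup>2\<bar> \<le> ?W * (?\<beta> n)\<^sup>2" for n y
  proof -
    have b2: "1 \<le> (?\<beta> n)\<^sup>2" using bfreq_ge_1[of n] by (simp add: one_le_power)
    have "\<bar>2 * ?l n * v0 (Suc n)\<bar> \<le> 2 * ((\<bar>b\<bar> + a\<^sup>2) * (?\<beta> n)\<^sup>2) * V"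
      unfolding abs_mult using abs_eigval_le[of a b n] V by (intro mult_mono) auto
    moreover have "\<bar>(\<sigma> * q (Suc n))\<^sup>2\<bar> \<le> \<sigma>\<^sup>2 * Q * (?\<beta> n)\<^sup>2"
    proof -
      have "\<bar>(\<sigma> * q (Suc n))\<^sup>2\<bar> \<le> \<sigma>\<^sup>2 * Q"
        unfolding power_mult_distrib abs_mult using Q by (intro mult_mono) auto
      also have "\<dots> \<le> \<sigma>\<^sup>2 * Q * (?\<beta> n)\<^sup>2" using mult_left_mono[OF b2, of "\<sigma>\<^sup>2 * Q"] Q by simp
      finally show ?thesis .
    qed
    ultimately have "\<bar>w n\<bar> \<le> 2 * ((\<bar>b\<bar> + a\<^sup>2) * (?\<beta> n)\<^sup>2) * V + \<sigma>\<^sup>2 * Q * (?\<beta> n)\<^sup>2"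
      unfolding w_def by (intro order_trans[OF abs_triangle_ineq add_mono])
    then have "\<bar>w n\<bar> \<le> (2 * (\<bar>b\<bar> + a\<^sup>2) * V + \<sigma>\<^sup>2 * Q) * (?\<beta> n)\<^sup>2"
      by (simp add: algebra_simps)
    then have W: "\<bar>w n\<bar> * (efun (Suc n) y)\<^sup>2 \<le> ((2 * (\<bar>b\<bar> + a\<^sup>2) * V + \<sigma>\<^sup>2 * Q) * (?\<beta> n)\<^sup>2) * 2"
      by (rule mult_mono) (use efun_squared_le V Q in auto)
    have "\<bar>w n * (efun (Suc n) y)\<^sup>2\<bar> = \<bar>w n\<bar> * (efun (Suc n) y)\<^sup>2" by (simp add: abs_mult)
    also note W
    also have "((2 * (\<bar>b\<bar> + a\<^sup>2) * V + \<sigma>\<^sup>2 * Q) * (?\<beta> n)\<^sup>2) * 2 = ?W * (?\<beta> n)\<^sup>2"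
      by (simp only: mult.assoc mult.commute[of "(?\<beta> n)\<^sup>2" 2])
    finally show ?thesis .
  qed
  assume t: "0 < t"
  show "continuous_on UNIV (\<lambda>y. \<Sum>n. w n * (efun (Suc n) y)\<^sup>2 * exp (2 * ?l n * t))"
  proof (rule continuous_on_uniformly_convergent_series)
    show "uniformly_convergent_on UNIV (\<lambda>N y. \<Sum>n<N. w n * (efun (Suc n) y)\<^sup>2 * exp (2 * ?l n * t))"
      unfolding l2
      by (rule uniformly_convergent_smoothed_series[OF A t, where R = t]) (use w in auto)
  qed (auto simp: efun_def intro!: continuous_intros)
  let ?S = "{t / 2..t + 1}"
  let ?T' = "\<lambda>n s. w n * (efun (Suc n) x)\<^sup>2 * exp (2 * ?l n * s)"
  have Td: "(T n has_real_derivative ?T' n s) (at s within ?S)" if s: "s \<in> ?S" for n s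
  proof -
    have sub: "?S \<subseteq> {0..t + 1}" using t by auto
    have "(duhamel (2 * ?l n) (\<lambda>_. 1) has_real_derivative
        exp (2 * ?l n * s) * 1 + duhamel (2 * ?l n) (\<lambda>_. 0) s) (at s within ?S)"
      by (rule duhamel_has_derivative_C1[OF _ _ sub s]) (auto intro!: derivative_eq_intros)
    then have "(duhamel (2 * ?l n) (\<lambda>_. 1) has_real_derivative exp (2 * ?l n * s)) (at s within ?S)"
      by (simp add: duhamel_def)
    then have "(T n has_real_derivative (v0 (Suc n) * (efun (Suc n) x)\<^sup>2) * (exp (2 * ?l n * s) * (2 * ?l n))
        + (\<sigma> * q (Suc n) * efun (Suc n) x)\<^sup>2 * exp (2 * ?l n * s)) (at s within ?S)"
      unfolding T_def[abs_def] by (intro DERIV_add DERIV_cmult) (auto intro!: derivative_eq_intros)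
    then show ?thesis by (simp add: w_def power_mult_distrib algebra_simps)
  qed
  have unif': "uniformly_convergent_on ?S (\<lambda>N s. \<Sum>n<N. ?T' n s)"
    unfolding l2
    by (rule uniformly_convergent_smoothed_series[OF A, where \<delta> = "t / 2" and R = "t + 1"]) (use t w in auto)
  have "((\<lambda>s. \<Sum>n. T n s) has_real_derivative (\<Sum>n. ?T' n t)) (at t)"
  proof (rule has_field_derivative_series'(2)[OF _ Td unif'])
    show "t \<in> ?S" using t by auto
    show "summable (\<lambda>n. T n t)"
      by (rule uniformly_convergent_on_imp_summable[OF unif[of t]]) (use t in auto)
    show "t \<in> interior ?S" using t by simp
  qed simp_all
  moreover have "\<forall>\<^sub>F s in nhds t. nu a b \<sigma> q v0 s x = (\<Sum>n. T n s)"
    using eventually_nhds_in_open[of "{0<..}" t] t by (auto elim!: eventually_mono simp: nu_eq)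
  ultimately show "((\<lambda>s. nu a b \<sigma> q v0 s x) has_real_derivative (\<Sum>n. ?T' n t)) (at t)"
    by (subst DERIV_cong_ev[OF refl _ refl]) auto
qed

section \<open>The probabilistic representation\<close>

lemma heat_density_eq_normal_density:
  assumes "0 \<le> nu a b \<sigma> q v0 t x"
  shows "heat_density a b \<sigma> f h g q m0 v0 u t x
    = normal_density 0 (sqrt (nu a b \<sigma> q v0 t x)) (u - mu a b f h g m0 t x)"
  using assms by (simp add: heat_density_def normal_density_def)

text \<open>The first eigenfunction is positive on \<open>{0..<1}\<close>, and one positive mode is enough.\<close>

lemma nu_initial_pos:
  assumes v0_pos: "\<And>n. n \<ge> 1 \<Longrightarrow> v0 n > 0" and v0: "summable (\<lambda>n. \<bar>v0 (Suc n)\<bar>)"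
    and x: "0 \<le> x" "x < 1"
  shows "0 < nu a b \<sigma> q v0 0 x"
proof -
  have eq: "nu_n a b \<sigma> q v0 (Suc n) 0 x = v0 (Suc n) * (efun (Suc n) x)\<^sup>2" for n
    by (simp add: nu_n_def)
  have "summable (\<lambda>n. v0 (Suc n) * (efun (Suc n) x)\<^sup>2)"
  proof (rule summable_comparison_test')
    show "summable (\<lambda>n. \<bar>v0 (Suc n)\<bar> * 2)" by (intro summable_mult2 v0)
    show "norm (v0 (Suc n) * (efun (Suc n) x)\<^sup>2) \<le> \<bar>v0 (Suc n)\<bar> * 2" for n
      using efun_squared_le[of "Suc n" x] by (simp add: abs_mult mult_left_mono)
  qed
  moreover have "0 < v0 (Suc 0) * (efun (Suc 0) x)\<^sup>2"
  proof -
    have "0 < cos (pi * x / 2)"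
      using x by (intro cos_gt_zero_pi) (auto intro: order_less_le_trans[of _ 0])
    then have "efun (Suc 0) x \<noteq> 0" by (simp add: efun_def bfreq_def mult.commute)
    then show ?thesis using v0_pos[of "Suc 0"] by simp
  qed
  moreover have "0 \<le> v0 (Suc n) * (efun (Suc n) x)\<^sup>2" for n
    using v0_pos[of "Suc n"] by simp
  ultimately show ?thesis
    unfolding nu_def eq by (intro suminf_pos2[where i = 0]) auto
qed

lemma cond_expectation_event_AE_True:
  fixes f :: "'a \<Rightarrow> real"
  assumes P: "prob_space P" and A: "A \<in> sets P" and AE: "AE w in P. w \<in> A"
    and f: "f \<in> borel_measurable P"
  shows "cond_expectation_event P f A = (\<integral>w. f w \<partial>P)"
proof -
  interpret prob_space P by (rule P)
  have e: "emeasure P A = 1" using prob_eq_1[OF A] AE by (simp add: emeasure_eq_measure)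
  have ind: "(\<lambda>w. indicator A w / 1 :: ennreal) = (\<lambda>w. ennreal (indicator A w))"
    by (auto simp: indicator_def)
  have "cond_expectation_event P f A = (\<integral>w. f w \<partial>density P (\<lambda>w. ennreal (indicator A w)))"
    unfolding cond_expectation_event_def uniform_measure_def e ind ..
  also have "\<dots> = (\<integral>w. indicator A w *\<^sub>R f w \<partial>P)"
    by (rule integral_density) (use A f in auto)
  also have "\<dots> = (\<integral>w. f w \<partial>P)"
    by (rule integral_cong_AE) (use A f AE in auto)
  finally show ?thesis .
qed

text \<open>For \<open>x = 0\<close> the sign is inherited from the points to the right of \<open>0\<close> by continuity of the
  series in space.\<close>

lemma Gcoeff_nonneg:
  assumes a: "a \<noteq> 0" and q: "summable (\<lambda>n. (q (Suc n))\<^sup>2)" and v0: "summable (\<lambda>n. \<bar>v0 (Suc n)\<bar>)"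
    and positivity: "\<And>x. x \<in> {0<..<1} \<Longrightarrow>
      \<exists>S>0. (\<lambda>n. (2 * eigval a b (Suc n) * v0 (Suc n) + (\<sigma> * q (Suc n))\<^sup>2)
                  * (efun (Suc n) x)\<^sup>2 * exp (2 * eigval a b (Suc n) * s)) sums S"
    and s: "0 < s" and x: "0 \<le> x" "x < 1"
  shows "0 \<le> Gcoeff a b \<sigma> q v0 s x"
proof -
  define G where "G y = (\<Sum>n. (2 * eigval a b (Suc n) * v0 (Suc n) + (\<sigma> * q (Suc n))\<^sup>2)
      * (efun (Suc n) y)\<^sup>2 * exp (2 * eigval a b (Suc n) * s))" for y
  have pos: "0 \<le> G y" if "y \<in> {0<..<1}" for y
    using positivity[OF that] sums_unique by (fastforce simp: G_def)
  have "((\<lambda>s. nu a b \<sigma> q v0 s x) has_real_derivative G x) (at s)"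
    unfolding G_def by (rule nu_regular(2)[OF a q v0 s])
  then have "Gcoeff a b \<sigma> q v0 s x = G x"
    unfolding Gcoeff_def using s by (intro time_deriv_eq) (auto intro: has_field_derivative_at_within)
  moreover have "0 \<le> G x"
  proof -
    have "isCont G x"
      using nu_regular(3)[OF a q v0 s, of b \<sigma>] by (simp add: G_def[abs_def] continuous_on_eq_continuous_at)
    then have "(G \<longlongrightarrow> G x) (at_right x)"
      by (simp add: isCont_def filterlim_at_split)
    moreover have "\<forall>\<^sub>F y in at_right x. 0 \<le> G y"
      using eventually_at_right_real[OF x(2)] by eventually_elim (use x in \<open>auto intro: pos\<close>)
    ultimately show ?thesis by (rule tendsto_lowerbound) simp
  qed
  ultimately show ?thesis by simp
qed

theorem theorem2:
  fixes a b \<sigma> T :: real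
    and f :: "real \<Rightarrow> real \<Rightarrow> real" and h g :: "real \<Rightarrow> real"
    and q m0 v0 :: "nat \<Rightarrow> real"
    and M :: "'w measure" and Wn :: "nat \<Rightarrow> real \<Rightarrow> 'w \<Rightarrow> real"
    and U0 :: "real \<Rightarrow> 'w \<Rightarrow> real" and U :: "real \<Rightarrow> real \<Rightarrow> 'w \<Rightarrow> real"
    and P :: "'v measure" and F :: "real \<Rightarrow> 'v measure"
    and B :: "real \<Rightarrow> 'v \<Rightarrow> real" and Uhat :: "real \<Rightarrow> real \<Rightarrow> 'v \<Rightarrow> real"
    and u t x :: real
  assumes a: "a \<noteq> 0"
    and f_measurable: "(\<lambda>(t, x). f t x) \<in> borel_measurable (restrict_space borel ({0..} \<times> {0..1}))"
    and h_measurable: "h \<in> borel_measurable (restrict_space borel {0..})"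
    and g_measurable: "g \<in> borel_measurable (restrict_space borel {0..})"
    and prob_space: "prob_space M"
    and q_nonneg: "\<And>n. n \<ge> 1 \<Longrightarrow> q n \<ge> 0"
    and q_trace: "summable (\<lambda>n. (q (Suc n))\<^sup>2)"
    and Wn: "independent_brownian_motions M Wn"
    and U: "heat_equation_solution M a b \<sigma> f h g (Q_wiener q Wn) U0 U"
    and A0: "C1_halfline g" "C1_halfline h" "C1_halfline_L1 f"
    and A1_normal: "\<And>n. n \<ge> 1 \<Longrightarrow> v0 n > 0 \<and>
          distributed M lborel (\<lambda>w. inner01 (\<lambda>x. U 0 x w) (efun n)) (normal_density (m0 n) (sqrt (v0 n)))"
    and A1_summable: "summable (\<lambda>n. \<bar>m0 (Suc n)\<bar>)" "summable (\<lambda>n. \<bar>v0 (Suc n)\<bar>)"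
    and T: "T > 0"
    and positivity: "\<And>s x. s \<in> {0..<T} \<Longrightarrow> x \<in> {0<..<1} \<Longrightarrow>
          \<exists>S>0. (\<lambda>n. (2 * eigval a b (Suc n) * v0 (Suc n) + (\<sigma> * q (Suc n))\<^sup>2)
                      * (efun (Suc n) x)\<^sup>2 * exp (2 * eigval a b (Suc n) * s)) sums S"
    and t: "t \<in> {0..T}" and x: "x \<in> {0..1}"
    and B: "brownian_motion_wrt P F B"
    and Uhat: "sde_solution P F B
          (\<lambda>s. Mtilde a b f h g m0 T s x) (\<lambda>s. sqrt (Gtilde a b \<sigma> q v0 T s x))
          (T - t) T (\<lambda>s. Uhat s x)"
    and Uhat_init: "AE w in P. Uhat (T - t) x w = u"
  shows "heat_density a b \<sigma> f h g q m0 v0 u t x =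
         cond_expectation_event P (\<lambda>w. heat_density a b \<sigma> f h g q m0 v0 (Uhat T x w) 0 x)
           {w \<in> space P. Uhat (T - t) x w = u}"
proof (cases "x = 1")
  case True
  \<comment> \<open>The variance is \<open>0\<close>, and \<open>1 / sqrt 0 = 0\<close> makes both densities \<open>0\<close>.\<close>
  have "efun (Suc n) 1 = 0" for n
    using efun_Suc[of n 1] by (simp add: cos_bfreq)
  then have "nu_n a b \<sigma> q v0 (Suc n) s 1 = 0" for n s
    by (simp only: nu_n_def) simp
  then have "nu a b \<sigma> q v0 s x = 0" for s
    by (simp add: nu_def True)
  then show ?thesis by (simp add: heat_density_def cond_expectation_event_def)
next
  case False
  interpret prob_space P by (rule brownian_motion_wrtD(1)[OF B])
  have x: "0 \<le> x" "x < 1" using x False by auto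
  have t0: "0 \<le> t" and tT: "t \<le> T" using t by auto
  let ?\<mu> = "\<lambda>s. mu a b f h g m0 s x" and ?\<nu> = "\<lambda>s. nu a b \<sigma> q v0 s x"
  let ?m = "\<lambda>s. Mtilde a b f h g m0 T s x" and ?k = "\<lambda>s. sqrt (Gtilde a b \<sigma> q v0 T s x)"
  have refl_cont: "continuous_on {T - t..T} (\<lambda>s. \<phi> (T - s))" if "continuous_on {0..t} \<phi>" for \<phi> :: "real \<Rightarrow> real"
    by (rule continuous_on_compose2[OF that]) (auto intro!: continuous_intros)
  have refl_deriv: "((\<lambda>s. \<phi> (T - s)) has_real_derivative - D) (at s)"
    if "(\<phi> has_real_derivative D) (at (T - s))" for \<phi> :: "real \<Rightarrow> real" and D s
  proof -
    have "((\<lambda>s. \<phi> (T - s)) has_real_derivative D * (-1)) (at s)"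
      by (rule DERIV_chain2[where f = \<phi> and g = "\<lambda>s. T - s", OF that]) (auto intro!: derivative_eq_intros)
    then show ?thesis by simp
  qed

  \<comment> \<open>The series need not be differentiable at time \<open>0\<close>, so only interior derivatives are used.\<close>
  have "(?m has_integral ?\<mu> (T - T) - ?\<mu> (T - (T - t))) {T - t..T}"
  proof (rule fundamental_theorem_of_calculus_interior)
    show "continuous_on {T - t..T} (\<lambda>s. ?\<mu> (T - s))"
      by (rule refl_cont[OF mu_regular(1)[OF a A0 A1_summable(1) x]])
    fix s assume s: "s \<in> {T - t<..<T}"
    then obtain D where D: "(?\<mu> has_real_derivative D) (at (T - s))"
      using mu_regular(2)[OF a A0 A1_summable(1) x, of "T - s" b] by auto
    have "?m s = - D"
      unfolding Mtilde_def Mcoeff_def using s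
      by (subst time_deriv_eq[OF has_field_derivative_at_within[OF D]]) auto
    then show "((\<lambda>s. ?\<mu> (T - s)) has_vector_derivative ?m s) (at s)"
      using refl_deriv[OF D] by (simp add: has_real_derivative_iff_has_vector_derivative)
  qed (use t0 in simp)
  moreover have m_int: "set_integrable lborel {T - t..T} ?m"
    using Uhat by (simp add: sde_solution_def)
  ultimately have drift: "(LINT s:{T - t..T}|lborel. ?m s) = ?\<mu> 0 - ?\<mu> t"
    by (simp add: set_borel_integral_eq_integral(2) integral_unique)

  have "((\<lambda>s. (?k s)\<^sup>2) has_integral - ?\<nu> (T - T) - - ?\<nu> (T - (T - t))) {T - t..T}"
  proof (rule fundamental_theorem_of_calculus_interior)
    show "continuous_on {T - t..T} (\<lambda>s. - ?\<nu> (T - s))"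
      by (intro continuous_on_minus refl_cont nu_regular(1)[OF a q_trace A1_summable(2)])
    fix s assume s: "s \<in> {T - t<..<T}"
    then have s0: "0 < T - s" "T - s < T" using tT by auto
    obtain D where D: "(?\<nu> has_real_derivative D) (at (T - s))"
      using nu_regular(2)[OF a q_trace A1_summable(2) s0(1)] by blast
    have "Gtilde a b \<sigma> q v0 T s x = D"
      unfolding Gtilde_def Gcoeff_def using s0
      by (subst time_deriv_eq[OF has_field_derivative_at_within[OF D]]) auto
    moreover have "0 \<le> Gtilde a b \<sigma> q v0 T s x"
      unfolding Gtilde_def using s0
      by (intro Gcoeff_nonneg[OF a q_trace A1_summable(2) positivity _ x]) auto
    ultimately have "(?k s)\<^sup>2 = D" by simp
    then show "((\<lambda>s. - ?\<nu> (T - s)) has_vector_derivative (?k s)\<^sup>2) (at s)"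
      using DERIV_minus[OF refl_deriv[OF D]] by (simp add: has_real_derivative_iff_has_vector_derivative)
  qed (use t0 in simp)
  then have k2: "((\<lambda>s. (?k s)\<^sup>2) has_integral ?\<nu> t - ?\<nu> 0) {T - t..T}" by simp
  have K: "(\<integral>\<^sup>+s\<in>{T - t..T}. ennreal ((?k s)\<^sup>2) \<partial>lborel) = ennreal (?\<nu> t - ?\<nu> 0)"
    by (rule nn_integral_has_integral_lebesgue'[OF _ k2]) simp
  have K0: "0 \<le> ?\<nu> t - ?\<nu> 0" by (rule has_integral_nonneg[OF k2]) simp
  have \<nu>0: "0 < ?\<nu> 0" using A1_normal by (intro nu_initial_pos[OF _ A1_summable(2) x]) auto

  have "T \<in> {T - t..T}" using t0 by simp
  then obtain I where I: "is_ito_integral P F B (T - t) T (\<lambda>r w. ?k r) I"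
    and sol: "AE w in P. Uhat T x w = Uhat (T - t) x w + (LINT r:{T - t..T}|lborel. ?m r) + I w"
    using Uhat unfolding sde_solution_def by blast
  have meas: "(\<lambda>w. Uhat s x w) \<in> borel_measurable P" if "s \<in> {T - t..T}" for s
  proof -
    have "(\<lambda>w. Uhat s x w) \<in> borel_measurable (F s)" using Uhat that by (simp add: sde_solution_def)
    then show ?thesis by (rule adapted_measurable_later(2)[OF B _ order_refl])
  qed
  have UT[measurable]: "(\<lambda>w. Uhat T x w) \<in> borel_measurable P"
    and Ut[measurable]: "(\<lambda>w. Uhat (T - t) x w) \<in> borel_measurable P"
    by (rule meas, use t0 in simp)+
  have I_meas[measurable]: "I \<in> borel_measurable P" using I by (simp add: is_ito_integral_def)
  have dens: "heat_density a b \<sigma> f h g q m0 v0 y s x = normal_density 0 (sqrt (?\<nu> s)) (y - ?\<mu> s)"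
    if "s = 0 \<or> s = t" for y s
    using that K0 \<nu>0 by (intro heat_density_eq_normal_density) auto
  have "cond_expectation_event P (\<lambda>w. heat_density a b \<sigma> f h g q m0 v0 (Uhat T x w) 0 x)
           {w \<in> space P. Uhat (T - t) x w = u}
      = (\<integral>w. normal_density 0 (sqrt (?\<nu> 0)) (Uhat T x w - ?\<mu> 0) \<partial>P)"
    using Uhat_init by (subst cond_expectation_event_AE_True[OF prob_space_axioms]) (auto simp: dens)
  also have "\<dots> = (\<integral>w. normal_density 0 (sqrt (?\<nu> 0)) ((?\<mu> t - u) - I w) \<partial>P)"
  proof (rule integral_cong_AE)
    show "AE w in P. normal_density 0 (sqrt (?\<nu> 0)) (Uhat T x w - ?\<mu> 0)
        = normal_density 0 (sqrt (?\<nu> 0)) ((?\<mu> t - u) - I w)"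
      using sol Uhat_init
    proof eventually_elim
      case (elim w)
      then have "Uhat T x w - ?\<mu> 0 = - ((?\<mu> t - u) - I w)" unfolding drift by simp
      moreover have "normal_density 0 r (- z) = normal_density 0 r z" for r z :: real
        by (simp add: normal_density_def)
      ultimately show ?case by (simp only:)
    qed
  qed measurable
  also have "\<dots> = normal_density 0 (sqrt (?\<nu> 0 + (?\<nu> t - ?\<nu> 0))) (?\<mu> t - u)"
    using gaussian_density_ito_integral[OF B _ I K K0 \<nu>0] tT by simp
  also have "\<dots> = heat_density a b \<sigma> f h g q m0 v0 u t x"
    by (simp add: dens normal_density_def power2_commute)
  finally show ?thesis ..
qed

end
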